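(* Let $L\colon\mathbb R^n\times\mathbb R^n\to\mathbb R_+$ and $\varphi\colon\mathbb R^n\to\mathbb R_+\cup\{+\infty\}$ satisfy the standing assumptions listed in the context, let $V$ be the value function and $H$ the Hamiltonian, and assume that $L$ is locally bounded. Then: (i) $V$ is (finite and) locally Lipschitz on $\mathbb R_+^\star\times\mathbb R^n$ and satisfies $$\forall (t,x)\in\mathbb R_+^\star\times\mathbb R^n,\ \forall (p_t,p_x)\in\partial_-V(t,x):\quad p_t+H(x,-p_x)\ge0, \tag{a}$$ $$\forall (t,x)\in\mathbb R_+^\star\times\mathbb R^n,\ \forall u\in\mathbb R^n:\quad D_\downarrow V(t,x)(1,-u)\le L^+(x,u). \tag{b}$$ (ii) Let $W\colon\mathbb R_+^\star\times\mathbb R^n\to\mathbb R_+$ be a locally Lipschitz function which satisfies the two initial conditions $$\forall x\in\mathbb R^n:\quad \liminf_{h\to0+,\ y\to x}W(h,y)=\varphi(x), \tag{c}$$ $$\forall x\in\mathbb R^n,\ \forall\lambda>0:\quad \lim_{\substack{h\to0+,\ y\to x\\ |y-x|\le\lambda h}}W(h,y)=\varphi(x). \tag{d}$$ If $p_t+H(x,-p_x)\ge0$ for all $(t,x)\in\mathbb R_+^\star\times\mathbb R^n$ and all $(p_t,p_x)\in\partial_-W(t,x)$, then $W\ge V$ on $\mathbb R_+^\star\times\mathbb R^n$. If $D_\downarrow W(t,x)(1,-u)\le L^+(x,u)$ for all $(t,x)\in\mathbb R_+^\star\times\mathbb R^n$ and all $u\in\mathbb R^n$, then $W\le V$ on $\mathbb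 R_+^\star\times\mathbb R^n$. (iii) Therefore the restriction of $V$ to $\mathbb R_+^\star\times\mathbb R^n$ is the unique non-negative locally Lipschitz function on $\mathbb R_+^\star\times\mathbb R^n$ which satisfies the initial conditions (c) and (d) and conditions (a) and (b).
   Context: Notation: $\mathbb R_+=[0,+\infty)$, $\mathbb R_+^\star=(0,+\infty)$. Limits in the initial conditions are taken in $[0,+\infty]$. Standing assumptions: $L\colon\mathbb R^n\times\mathbb R^n\to\mathbb R_+$ is lower semicontinuous and $L(x,\cdot)$ is convex for every $x$; there is a convex function $\Theta\colon\mathbb R^n\to\mathbb R_+$ with $\lim_{|u|\to\infty}\Theta(u)/|u|=+\infty$ and $L(x,u)\ge\Theta(u)$ for all $(x,u)$; $\varphi\colon\mathbb R^n\to\mathbb R_+\cup\{+\infty\}$ is lower semicontinuous and not identically $+\infty$. Value function: for $(t,x)\in\mathbb R_+\times\mathbb R^n$, $$V(t,x)=\inf\Big\{\int_0^t L(y(s),y'(s))\,ds+\varphi(y(t)) : y\in W^{1,1}(0,t;\mathbb R^n),\ y(0)=x\Big\}.$$ Hamiltonian: $H(x,p)=\sup_{u\in\mathbb R^n}\big(\langle p,u\rangle-L(x,u)\big)$. The function $L^+$: for $(x,u)\in\mathbb R^n\times\mathbb R^n$, $$L^+(x,u)=\limsup_{h\to0+}\frac1h\inf\Big\{\int_{-h}^0L(y(s),y'(s))\,ds : y\in W^{1,1}(-h,0;\mathbb R^n),\ y(-h)=x-hu,\ y(0)=x\Big\}.$$ For a real-valued function $W$ on $\mathbb R_+^\star\times\mathbb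 R^n$, a point $z=(t,x)$ and $(\alpha,u)\in\mathbb R\times\mathbb R^n$, $$\partial_-W(z)=\Big\{p\in\mathbb R\times\mathbb R^n : \liminf_{z'\to z}\frac{W(z')-W(z)-\langle p,z'-z\rangle}{|z'-z|}\ge0\Big\},$$ $$D_\downarrow W(t,x)(\alpha,u)=\limsup_{h\to0+,\,(\alpha',v)\to(\alpha,u)}\frac{W(t+h\alpha',x+hv)-W(t,x)}{h}.$$ *)

theory Defs
  imports "HOL-Analysis.Analysis"
begin

definition lsc :: "('a::topological_space \<Rightarrow> 'b::linorder) \<Rightarrow> bool" where
  "lsc f \<longleftrightarrow> (\<forall>x. \<forall>c < f x. \<forall>\<^sub>F x' in nhds x. c < f x')"

definition locally_bounded :: "('a::metric_space \<Rightarrow> 'b::metric_space) \<Rightarrow> bool" where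
  "locally_bounded f \<longleftrightarrow> (\<forall>z. \<exists>r>0. bounded (f ` ball z r))"

definition locally_Lipschitz_on :: "'a::metric_space set \<Rightarrow> ('a \<Rightarrow> 'b::metric_space) \<Rightarrow> bool" where
  "locally_Lipschitz_on S f \<longleftrightarrow> (\<forall>z\<in>S. \<exists>r>0. \<exists>C. C-lipschitz_on (ball z r \<inter> S) f)"

text \<open>\<open>W11 a b y g\<close>: on \<open>[a, b]\<close>, \<open>y\<close> is (the absolutely continuous representative of) a function
  in \<open>W^{1,1}(a, b)\<close> with derivative \<open>g\<close>. Since \<open>g\<close> is determined by \<open>y\<close> up to a null set, an integral
  of \<open>L(y, g)\<close> does not depend on the choice of \<open>g\<close>.\<close>

definition W11 :: "real \<Rightarrow> real \<Rightarrow> (real \<Rightarrow> 'a::euclidean_space) \<Rightarrow> (real \<Rightarrow> 'a) \<Rightarrow> bool" where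
  "W11 a b y g \<longleftrightarrow> set_integrable lborel {a..b} g \<and>
     (\<forall>s\<in>{a..b}. y s = y a + (LINT r:{a..s}|lborel. g r))"

text \<open>The running cost is a Lebesgue integral with values in \<open>[0, \<infinity>]\<close>; \<open>ennreal\<close> loses nothing
  because \<open>L\<close> is assumed non-negative wherever these definitions are used.\<close>

definition cost ::
  "('a::euclidean_space \<Rightarrow> 'a \<Rightarrow> real) \<Rightarrow> real \<Rightarrow> real \<Rightarrow> (real \<Rightarrow> 'a) \<Rightarrow> (real \<Rightarrow> 'a) \<Rightarrow> ennreal" where
  "cost L a b y g = (\<integral>\<^sup>+ s\<in>{a..b}. ennreal (L (y s) (g s)) \<partial>lborel)"

definition value_fun ::
  "('a::euclidean_space \<Rightarrow> 'a \<Rightarrow> real) \<Rightarrow> ('a \<Rightarrow> ennreal) \<Rightarrow> real \<Rightarrow> 'a \<Rightarrow> ennreal" where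
  "value_fun L \<phi> t x = (INF (y, g) \<in> {(y, g). W11 0 t y g \<and> y 0 = x}. cost L 0 t y g + \<phi> (y t))"

text \<open>Real-valued version of the value function, meaningful where \<^const>\<open>value_fun\<close> is finite.\<close>

definition value_real ::
  "('a::euclidean_space \<Rightarrow> 'a \<Rightarrow> real) \<Rightarrow> ('a \<Rightarrow> ennreal) \<Rightarrow> real \<times> 'a \<Rightarrow> real" where
  "value_real L \<phi> = (\<lambda>(t, x). enn2real (value_fun L \<phi> t x))"

definition hamiltonian :: "('a::euclidean_space \<Rightarrow> 'a \<Rightarrow> real) \<Rightarrow> 'a \<Rightarrow> 'a \<Rightarrow> ereal" where
  "hamiltonian L x p = (SUP u. ereal (p \<bullet> u - L x u))"

definition L_plus :: "('a::euclidean_space \<Rightarrow> 'a \<Rightarrow> real) \<Rightarrow> 'a \<Rightarrow> 'a \<Rightarrow> ennreal" where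
  "L_plus L x u = Limsup (at_right 0) (\<lambda>h. ennreal (1 / h) *
     (INF (y, g) \<in> {(y, g). W11 (- h) 0 y g \<and> y (- h) = x - h *\<^sub>R u \<and> y 0 = x}. cost L (- h) 0 y g))"

definition subdifferential :: "('z::euclidean_space \<Rightarrow> real) \<Rightarrow> 'z \<Rightarrow> 'z set" where
  "subdifferential W z =
     {p. Liminf (at z) (\<lambda>z'. ereal ((W z' - W z - p \<bullet> (z' - z)) / norm (z' - z))) \<ge> 0}"

definition upper_derivative ::
  "(real \<times> 'a::euclidean_space \<Rightarrow> real) \<Rightarrow> real \<times> 'a \<Rightarrow> real \<times> 'a \<Rightarrow> ereal" where
  "upper_derivative W z d =
     Limsup (at_right 0 \<times>\<^sub>F nhds d) (\<lambda>(h, d'). ereal ((W (z + h *\<^sub>R d') - W z) / h))"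

text \<open>Functions on \<open>(0, \<infinity>) \<times> \<real>\<^sup>n\<close> are represented by functions on \<open>\<real> \<times> \<real>\<^sup>n\<close> whose
  values outside that open set are irrelevant: every notion below only depends on the restriction.\<close>

definition pos_times :: "(real \<times> 'a::euclidean_space) set" where
  "pos_times = {0<..} \<times> UNIV"

definition HJ_super ::
  "('a::euclidean_space \<Rightarrow> 'a \<Rightarrow> real) \<Rightarrow> (real \<times> 'a \<Rightarrow> real) \<Rightarrow> bool" where
  "HJ_super L W \<longleftrightarrow> (\<forall>(t, x) \<in> pos_times. \<forall>(pt, px) \<in> subdifferential W (t, x).
     ereal pt + hamiltonian L x (- px) \<ge> 0)"

definition HJ_sub ::
  "('a::euclidean_space \<Rightarrow> 'a \<Rightarrow> real) \<Rightarrow> (real \<times> 'a \<Rightarrow> real) \<Rightarrow> bool" where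
  "HJ_sub L W \<longleftrightarrow> (\<forall>(t, x) \<in> pos_times. \<forall>u.
     upper_derivative W (t, x) (1, - u) \<le> enn2ereal (L_plus L x u))"

definition initial_liminf ::
  "('a::euclidean_space \<Rightarrow> ennreal) \<Rightarrow> (real \<times> 'a \<Rightarrow> real) \<Rightarrow> bool" where
  "initial_liminf \<phi> W \<longleftrightarrow>
     (\<forall>x. Liminf (at_right 0 \<times>\<^sub>F nhds x) (\<lambda>z. ennreal (W z)) = \<phi> x)"

definition initial_lim_cones ::
  "('a::euclidean_space \<Rightarrow> ennreal) \<Rightarrow> (real \<times> 'a \<Rightarrow> real) \<Rightarrow> bool" where
  "initial_lim_cones \<phi> W \<longleftrightarrow> (\<forall>x. \<forall>c>0.
     ((\<lambda>z. ennreal (W z)) \<longlongrightarrow> \<phi> x)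
       (inf (at_right 0 \<times>\<^sub>F nhds x) (principal {(h, y). norm (y - x) \<le> c * h})))"

text \<open>Non-negative locally Lipschitz functions on \<open>(0, \<infinity>) \<times> \<real>\<^sup>n\<close> attaining the initial data \<open>\<phi>\<close>
  in both senses. Non-negativity makes \<open>ennreal (W z)\<close> above just the number \<open>W z\<close>.\<close>

definition admissible ::
  "('a::euclidean_space \<Rightarrow> ennreal) \<Rightarrow> (real \<times> 'a \<Rightarrow> real) \<Rightarrow> bool" where
  "admissible \<phi> W \<longleftrightarrow> (\<forall>z\<in>pos_times. 0 \<le> W z) \<and> locally_Lipschitz_on pos_times W \<and>
     initial_liminf \<phi> W \<and> initial_lim_cones \<phi> W"

end

theory Submission
  imports Defs "HOL-Complex_Analysis.Great_Picard"
begin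

text \<open>Lipschitz continuity of \<open>V\<close> comes from surgery on near-minimisers: they are prolonged by short segments, and
  shortened in time by replacing a piece of proportionally small length by its chord. The inequalities (a)
  and (b) for \<open>V\<close> are the two halves of dynamic programming.

  If \<open>W\<close> satisfies (b), then \<open>s \<mapsto> W (t - s, y s) + \<integral>\<^sub>0\<^sup>s L (y, y')\<close> is absolutely continuous along every curve of finite
  cost and does not decrease, since \<open>L_plus L (y s) (y' s) \<le> L (y s) (y' s)\<close> almost everywhere.

  If \<open>W\<close> satisfies (a), a mean value argument in the style of Clarke and Ledyaev yields, in each small time step, a
  velocity along which \<open>W\<close> decreases at least as fast as the cost measured by a convex minorant of the
  Lagrangians at nearby points. The resulting polygons are equi-Lipschitz on \<open>[0, t - \<tau>]\<close>; for a uniform limit \<open>y\<close>,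
  Jensen's inequality on dyadic intervals and Fatou's lemma show that the true cost of \<open>y\<close> is still bounded by the
  decrease of \<open>W\<close>. Finally \<open>\<tau> \<rightarrow> 0\<close>, using that \<open>V\<close> is continuous.\<close>

section \<open>Absolutely continuous curves and transition costs\<close>

text \<open>Infima are always approached by near-minimisers, so existence of minimisers is not an
  issue. The obstacle is that \<open>L\<close> is only lower semicontinuous in the position:
  translating a curve can change its cost by an amount that no modulus controls. Two devices replace
  continuity. Upper bounds use segments in a bounded region, where \<open>L\<close> is bounded,
  lasting a small fraction of the time. Lower bounds use affine functions of the velocity: by
  superlinear growth, one that lies below \<open>L x\<close> lies, after an arbitrarily small
  decrease, below \<open>L x'\<close> for all \<open>x'\<close> near \<open>x\<close>.

  The two initial conditions serve different comparisons. A curve of finite cost may approach its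
  end point at no linear rate, so for a subsolution the remaining time is enlarged to the remaining
  distance, which puts the point into a cone where a full limit is available. For a supersolution
  the ends of the approximating curves merely converge to some point, and there the lower limit
  suffices; a segment closes the gap, and continuity of the value function in time absorbs the
  delay.\<close>

lemma set_integrable_const_Icc: "set_integrable lborel {a..b} (\<lambda>_. c)" for a b :: real
  unfolding set_integrable_def
  by (intro integrable_scaleR_left integrable_real_indicator)
     (auto intro: emeasure_bounded_finite simp: less_top[symmetric] emeasure_lborel_Icc_eq)

lemma set_integral_Icc_combine:
  fixes f :: "real \<Rightarrow> 'a::euclidean_space"
  assumes "set_integrable lborel {a..b} f" "a \<le> c" "c \<le> b"
  shows "(LINT r:{a..c}|lborel. f r) + (LINT r:{c..b}|lborel. f r) = (LINT r:{a..b}|lborel. f r)"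
proof -
  have 1: "set_integrable lborel {a..c} f" "set_integrable lborel {c..b} f"
    using assms(2,3) by (auto intro!: set_integrable_subset[OF assms(1)])
  show ?thesis
    using Henstock_Kurzweil_Integration.integral_combine[OF assms(2,3) set_borel_integral_eq_integral(1)[OF assms(1)]]
    by (simp add: set_borel_integral_eq_integral(2) 1 assms(1))
qed

lemma set_integral_Icc_continuous:
  fixes f :: "real \<Rightarrow> 'a::euclidean_space"
  assumes "set_integrable lborel {a..b} f"
  shows "continuous_on {a..b} (\<lambda>s. LINT r:{a..s}|lborel. f r)"
proof -
  have "continuous_on {a..b} (\<lambda>s. integral {a..s} f)"
    by (rule indefinite_integral_continuous_1) (rule set_borel_integral_eq_integral(1)[OF assms])
  then show ?thesis
  proof (rule continuous_on_eq)
    fix s assume "s \<in> {a..b}"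
    then have "set_integrable lborel {a..s} f"
      by (intro set_integrable_subset[OF assms]) auto
    then show "integral {a..s} f = (LINT r:{a..s}|lborel. f r)"
      by (simp add: set_borel_integral_eq_integral(2))
  qed
qed

lemma set_integral_singleton [simp]: "(LINT r:{a}|lborel. f r) = (0 :: 'a::euclidean_space)" for a :: real
  unfolding set_lebesgue_integral_def
  by (rule integral_eq_zero_AE, use AE_lborel_singleton[of a] in eventually_elim) (auto simp: indicator_def)

lemma W11_eq: "W11 a b y g \<Longrightarrow> a \<le> s \<Longrightarrow> s \<le> b \<Longrightarrow> y s = y a + (LINT r:{a..s}|lborel. g r)"
  unfolding W11_def by (meson atLeastAtMost_iff)

lemma W11_integrable: "W11 a b y g \<Longrightarrow> set_integrable lborel {a..b} g"
  unfolding W11_def by blast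

lemma W11_integral:
  assumes "W11 a b y g" "a \<le> c" "c \<le> d" "d \<le> b"
  shows "y d = y c + (LINT r:{c..d}|lborel. g r)"
proof -
  have I: "set_integrable lborel {a..d} g"
    by (rule set_integrable_subset[OF W11_integrable[OF assms(1)]]) (use assms in auto)
  have "y c = y a + (LINT r:{a..c}|lborel. g r)" "y d = y a + (LINT r:{a..d}|lborel. g r)"
    using assms by (auto intro!: W11_eq)
  then show ?thesis
    using set_integral_Icc_combine[OF I assms(2,3)] by (simp add: algebra_simps)
qed

lemma W11_set_integrable:
  assumes "W11 a b y g" "a \<le> c" "d \<le> b"
  shows "set_integrable lborel {c..d} g"
  by (rule set_integrable_subset[OF W11_integrable[OF assms(1)]]) (use assms in auto)

lemma W11_subinterval:
  assumes "W11 a b y g" "a \<le> c" "d \<le> b"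
  shows "W11 c d y g"
  unfolding W11_def
proof (intro conjI ballI)
  show "set_integrable lborel {c..d} g" by (rule W11_set_integrable[OF assms])
  fix s assume "s \<in> {c..d}"
  then show "y s = y c + (LINT r:{c..s}|lborel. g r)"
    using assms(3) by (intro W11_integral[OF assms(1,2)]) auto
qed

lemma W11_continuous_on:
  assumes "W11 a b y g"
  shows "continuous_on {a..b} y"
proof -
  have "continuous_on {a..b} (\<lambda>s. y a + (LINT r:{a..s}|lborel. g r))"
    using assms by (intro continuous_intros set_integral_Icc_continuous W11_integrable)
  then show ?thesis
    by (rule continuous_on_eq) (use assms in \<open>auto intro!: W11_eq[symmetric]\<close>)
qed

lemma W11_norm_diff_le:
  assumes "W11 a b y g" "a \<le> c" "c \<le> d" "d \<le> b"
  shows "norm (y d - y c) \<le> (LINT r:{c..d}|lborel. norm (g r))"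
proof -
  have "set_integrable lborel {c..d} g" using assms by (intro W11_set_integrable) auto
  then show ?thesis
    using W11_integral[OF assms] set_integral_norm_bound[of lborel "{c..d}" g] by simp
qed

lemma W11_shift:
  assumes "W11 a b y g"
  shows "W11 (a + c) (b + c) (\<lambda>s. y (s - c)) (\<lambda>s. g (s - c))"
proof -
  have ind: "indicator {p + c..q + c} (c + 1 * x) = (indicator {p..q} x :: real)" for p q x :: real
    by (auto simp: indicator_def)
  have I: "set_integrable lborel {a + c..b + c} (\<lambda>s. g (s - c))"
    using W11_integrable[OF assms] lborel_integrable_real_affine_iff[of 1 "\<lambda>x. indicator {a + c..b + c} x *\<^sub>R g (x - c)" c]
    unfolding set_integrable_def by (simp only: ind) simp
  have J: "(LINT r:{a + c..s}|lborel. g (r - c)) = (LINT r:{a..s - c}|lborel. g r)" for s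
    using lborel_integral_real_affine[of 1 "\<lambda>x. indicator {a + c..(s - c) + c} x *\<^sub>R g (x - c)" c]
    unfolding set_lebesgue_integral_def by (simp only: ind) simp
  show ?thesis
    unfolding W11_def
  proof (intro conjI ballI)
    fix s assume "s \<in> {a + c..b + c}"
    then show "y (s - c) = y (a + c - c) + (LINT r:{a + c..s}|lborel. g (r - c))"
      using W11_eq[OF assms, of "s - c"] J[of s] by simp
  qed (rule I)
qed

lemma W11_concat:
  assumes 1: "W11 a b y1 g1" and 2: "W11 b c y2 g2" and "a \<le> b" "b \<le> c" "y1 b = y2 b"
  shows "W11 a c (\<lambda>s. if s \<le> b then y1 s else y2 s) (\<lambda>s. if s \<le> b then g1 s else g2 s)"
    (is "W11 a c ?y ?g")
proof -
  have I1: "set_integrable lborel {a..b} ?g"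
    using W11_integrable[OF 1] by (subst set_integrable_cong[OF refl refl, where f' = g1]) auto
  have "set_integrable lborel {b<..c} g2"
    by (rule set_integrable_subset[OF W11_integrable[OF 2]]) auto
  then have I2: "set_integrable lborel {b<..c} ?g"
    by (subst set_integrable_cong[OF refl refl, where f' = g2]) auto
  have I: "set_integrable lborel {a..c} ?g"
    using set_integrable_Un[OF I1 I2] assms by (simp add: ivl_disj_un)
  have b: "?y b = ?y a + (LINT r:{a..b}|lborel. ?g r)"
  proof -
    have "y1 b = y1 a + (LINT r:{a..b}|lborel. g1 r)" using W11_eq[OF 1 \<open>a \<le> b\<close>] by simp
    moreover have "(LINT r:{a..b}|lborel. ?g r) = (LINT r:{a..b}|lborel. g1 r)"
      by (rule set_lebesgue_integral_cong) auto
    ultimately show ?thesis using \<open>a \<le> b\<close> by simp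
  qed
  have "?y s = ?y a + (LINT r:{a..s}|lborel. ?g r)" if s: "s \<in> {a..c}" for s
  proof (cases "s \<le> b")
    case True
    then have "(LINT r:{a..s}|lborel. ?g r) = (LINT r:{a..s}|lborel. g1 r)"
      by (intro set_lebesgue_integral_cong) auto
    then show ?thesis using W11_eq[OF 1 _ True] True s \<open>a \<le> b\<close> by simp
  next
    case False
    have *: "(LINT r:{a..s}|lborel. ?g r) = (LINT r:{a..b}|lborel. ?g r) + (LINT r:{b..s}|lborel. ?g r)"
      using False s assms(3) by (intro set_integral_Icc_combine[symmetric] set_integrable_subset[OF I]) auto
    \<comment> \<open>At the junction \<open>b\<close> the function \<open>?g\<close> still takes
      the value of \<open>g1\<close>, so the integrands agree only up to a null set.\<close>
    have "(LINT r:{b..s}|lborel. ?g r) = (LINT r:{b..s}|lborel. g2 r)"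
      unfolding set_lebesgue_integral_def
    proof (rule integral_cong_AE)
      have "set_integrable lborel {b..s} ?g" using s \<open>a \<le> b\<close> by (intro set_integrable_subset[OF I]) auto
      then show "(\<lambda>r. indicator {b..s} r *\<^sub>R ?g r) \<in> borel_measurable lborel"
        unfolding set_integrable_def by auto
      have "set_integrable lborel {b..s} g2" using s 2 by (intro W11_set_integrable) auto
      then show "(\<lambda>r. indicator {b..s} r *\<^sub>R g2 r) \<in> borel_measurable lborel"
        unfolding set_integrable_def by auto
      show "AE r in lborel. indicator {b..s} r *\<^sub>R ?g r = indicator {b..s} r *\<^sub>R g2 r"
        using AE_lborel_singleton[of b] by eventually_elim (auto simp: indicator_def)
    qed
    moreover have "y2 s = y2 b + (LINT r:{b..s}|lborel. g2 r)"
      using False s W11_eq[OF 2, of s] by simp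
    ultimately show ?thesis using b False * \<open>y1 b = y2 b\<close> by (simp add: algebra_simps)
  qed
  with I show ?thesis unfolding W11_def by blast
qed

lemma W11_line:
  assumes "a \<le> b"
  shows "W11 a b (\<lambda>s. x + (s - a) *\<^sub>R v) (\<lambda>s. v)"
proof -
  have "set_integrable lborel {a..b} (\<lambda>s. v)"
    by (rule set_integrable_const_Icc)
  moreover have "(LINT r:{a..s}|lborel. v) = (s - a) *\<^sub>R v" if "a \<le> s" for s
    using that by (simp add: set_lebesgue_integral_def)
  ultimately show ?thesis unfolding W11_def by auto
qed

text \<open>Made for infima that need not be attained: \<open>a\<close> and \<open>b\<close> will be
  strict upper bounds, each realised by a curve. If \<open>A + B = top\<close> there is nothing to
  show; otherwise each summand leaves room for half an epsilon.\<close>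

lemma ennreal_le_add_gtI:
  fixes A B c :: ennreal
  assumes "\<And>a b. A < a \<Longrightarrow> B < b \<Longrightarrow> c \<le> a + b"
  shows "c \<le> A + B"
proof (rule ennreal_le_epsilon)
  fix e :: real assume AB: "A + B < top" "0 < e"
  then have "c \<le> (A + ennreal (e/2)) + (B + ennreal (e/2))"
    by (intro assms) (auto simp: ennreal_add_left_cancel_less less_top ennreal_zero_less_divide
        intro!: ennreal_lessI)
  also have "\<dots> = A + B + (ennreal (e/2) + ennreal (e/2))" by (simp add: algebra_simps)
  also have "ennreal (e/2) + ennreal (e/2) = ennreal e"
    using AB by (subst ennreal_plus[symmetric]) auto
  finally show "c \<le> A + B + ennreal e" .
qed

lemma lsc_borel_measurable:
  fixes f :: "'a::topological_space \<Rightarrow> real"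
  assumes "lsc f"
  shows "f \<in> borel_measurable borel"
proof -
  have "open {x. c < f x}" for c
  proof (subst open_subopen, intro ballI)
    fix x assume "x \<in> {x. c < f x}"
    then have "\<forall>\<^sub>F x' in nhds x. c < f x'" using assms unfolding lsc_def by auto
    then show "\<exists>T. open T \<and> x \<in> T \<and> T \<subseteq> {x. c < f x}" unfolding eventually_nhds by auto
  qed
  then show ?thesis
    by (intro borel_measurableI_greater borel_open) simp
qed

text \<open>The minimal action between two points, that is, the kernel of the Lax-Oleinik formula
  for \<open>value_fun\<close>. With both ends prescribed, surgery on curves turns into triangle
  inequalities.\<close>

definition trans_cost :: "('a::euclidean_space \<Rightarrow> 'a \<Rightarrow> real) \<Rightarrow> real \<Rightarrow> 'a \<Rightarrow> 'a \<Rightarrow> ennreal" where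
  "trans_cost L T x z = (INF (y, g) \<in> {(y, g). W11 0 T y g \<and> y 0 = x \<and> y T = z}. cost L 0 T y g)"

lemma trans_cost_lessE:
  assumes "trans_cost L T x z < c"
  obtains y g where "W11 0 T y g" "y 0 = x" "y T = z" "cost L 0 T y g < c"
  using assms unfolding trans_cost_def INF_less_iff by auto

lemma value_fun_lessE:
  assumes "value_fun L \<phi> t x < c"
  obtains y g where "W11 0 t y g" "y 0 = x" "cost L 0 t y g + \<phi> (y t) < c"
  using assms unfolding value_fun_def INF_less_iff by auto

lemma value_fun_le_trans_cost: "value_fun L \<phi> t x \<le> trans_cost L t x z + \<phi> z"
proof -
  have "value_fun L \<phi> t x \<le> a + b" if a: "trans_cost L t x z < a" and b: "\<phi> z < b" for a b
  proof -
    obtain y g where "W11 0 t y g" "y 0 = x" "y t = z" "cost L 0 t y g < a"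
      using a by (rule trans_cost_lessE)
    then have "value_fun L \<phi> t x \<le> cost L 0 t y g + \<phi> z"
      unfolding value_fun_def by (intro INF_lower2[of "(y, g)"]) auto
    also have "\<dots> \<le> a + b" using b \<open>cost L 0 t y g < a\<close> by (intro add_mono) auto
    finally show ?thesis .
  qed
  then show ?thesis by (rule ennreal_le_add_gtI)
qed

section \<open>Dynamic programming for lower semicontinuous Lagrangians\<close>

locale nonneg_lsc_lagrangian =
  fixes L :: "'a::euclidean_space \<Rightarrow> 'a \<Rightarrow> real"
  assumes L_nonneg: "\<And>x u. 0 \<le> L x u"
    and L_lsc: "lsc (\<lambda>(x, u). L x u)"
begin

lemma L_borel: "(\<lambda>(x, u). L x u) \<in> borel_measurable borel"
  using L_lsc by (rule lsc_borel_measurable)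

lemma L_curve_measurable:
  assumes "W11 a b y g"
  shows "(\<lambda>s. indicator {a..b} s * L (y s) (g s)) \<in> borel_measurable borel"
proof -
  \<comment> \<open>Outside \<open>{a..b}\<close> nothing is known about \<open>y\<close> and
    \<open>g\<close>, so \<open>L\<close> is composed with their cut-offs, which are Borel on the
    whole line.\<close>
  have [measurable]: "(\<lambda>s. indicator {a..b} s *\<^sub>R y s) \<in> borel_measurable borel"
    by (intro borel_measurable_continuous_on_indicator W11_continuous_on[OF assms]) auto
  have [measurable]: "(\<lambda>s. indicator {a..b} s *\<^sub>R g s) \<in> borel_measurable borel"
    using W11_integrable[OF assms] unfolding set_integrable_def by auto
  have "(\<lambda>s. (indicator {a..b} s *\<^sub>R y s, indicator {a..b} s *\<^sub>R g s)) \<in> borel_measurable borel"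
    by measurable
  from measurable_compose[OF this L_borel]
  have [measurable]: "(\<lambda>s. L (indicator {a..b} s *\<^sub>R y s) (indicator {a..b} s *\<^sub>R g s)) \<in> borel_measurable borel"
    by simp
  have "(\<lambda>s. indicator {a..b} s * L (y s) (g s)) =
      (\<lambda>s. indicator {a..b} s * L (indicator {a..b} s *\<^sub>R y s) (indicator {a..b} s *\<^sub>R g s))"
    by (auto simp: indicator_def fun_eq_iff)
  then show ?thesis by simp
qed

lemma L_curve_measurable_ennreal:
  assumes "W11 a b y g"
  shows "(\<lambda>s. ennreal (L (y s) (g s)) * indicator {a..b} s) \<in> borel_measurable borel"
proof -
  have "(\<lambda>s. ennreal (L (y s) (g s)) * indicator {a..b} s) = (\<lambda>s. ennreal (indicator {a..b} s * L (y s) (g s)))"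
    by (auto simp: fun_eq_iff indicator_def)
  then show ?thesis using L_curve_measurable[OF assms] by simp
qed

lemma cost_split:
  assumes y: "W11 a c y g" and "a \<le> b" "b \<le> c"
  shows "cost L a b y g + cost L b c y g = cost L a c y g"
proof -
  have "cost L a b y g + cost L b c y g
      = (\<integral>\<^sup>+ s. (ennreal (L (y s) (g s)) * indicator {a..b} s + ennreal (L (y s) (g s)) * indicator {b..c} s) \<partial>lborel)"
    unfolding cost_def using assms
    by (intro nn_integral_add[symmetric]) (auto intro!: L_curve_measurable_ennreal W11_subinterval[OF y])
  also have "\<dots> = (\<integral>\<^sup>+ s. ennreal (L (y s) (g s)) * indicator {a..c} s \<partial>lborel)"
    by (rule nn_integral_cong_AE, use AE_lborel_singleton[of b] in eventually_elim)
       (use assms in \<open>auto simp: indicator_def\<close>)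
  finally show ?thesis unfolding cost_def .
qed

lemma cost_mono:
  assumes "a \<le> c" "d \<le> b"
  shows "cost L c d y g \<le> cost L a b y g"
  unfolding cost_def using assms by (intro nn_integral_mono) (auto simp: indicator_def)

text \<open>The left end point is exempt because a concatenated curve keeps its first branch at the
  junction, where the second piece starts.\<close>

lemma cost_cong:
  assumes "\<And>s. s \<in> {a<..b} \<Longrightarrow> y s = y' s \<and> g s = g' s"
  shows "cost L a b y g = cost L a b y' g'"
  unfolding cost_def
  by (rule nn_integral_cong_AE, use AE_lborel_singleton[of a] in eventually_elim)
     (use assms in \<open>auto simp: indicator_def\<close>)

lemma cost_shift:
  assumes "W11 a b y g"
  shows "cost L (a + c) (b + c) (\<lambda>s. y (s - c)) (\<lambda>s. g (s - c)) = cost L a b y g"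
proof -
  have ind: "indicator {p + c..q + c} (c + 1 * x) = (indicator {p..q} x :: ennreal)" for p q x :: real
    by (auto simp: indicator_def)
  show ?thesis
    unfolding cost_def
    using nn_integral_real_affine[OF L_curve_measurable_ennreal[OF W11_shift[OF assms, of c]], of 1 c]
    by (simp only: ind) simp
qed

lemma trans_cost_le_cost:
  assumes "W11 a b y g"
  shows "trans_cost L (b - a) (y a) (y b) \<le> cost L a b y g"
proof -
  have "W11 0 (b - a) (\<lambda>s. y (s + a)) (\<lambda>s. g (s + a))"
    using W11_shift[OF assms, of "-a"] by simp
  moreover have "cost L 0 (b - a) (\<lambda>s. y (s + a)) (\<lambda>s. g (s + a)) = cost L a b y g"
    using cost_shift[OF assms, of "-a"] by simp
  ultimately show ?thesis
    unfolding trans_cost_def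
    by (intro INF_lower2[of "(\<lambda>s. y (s + a), \<lambda>s. g (s + a))"]) auto
qed

lemma INF_cost_eq_trans_cost:
  "(INF (y, g) \<in> {(y, g). W11 a b y g \<and> y a = x \<and> y b = z}. cost L a b y g) = trans_cost L (b - a) x z"
proof (rule antisym)
  show "trans_cost L (b - a) x z \<le> (INF (y, g) \<in> {(y, g). W11 a b y g \<and> y a = x \<and> y b = z}. cost L a b y g)"
    by (rule INF_greatest) (use trans_cost_le_cost in auto)
  show "(INF (y, g) \<in> {(y, g). W11 a b y g \<and> y a = x \<and> y b = z}. cost L a b y g) \<le> trans_cost L (b - a) x z"
    unfolding trans_cost_def
  proof (rule INF_greatest, clarsimp)
    fix y g assume y: "W11 0 (b - a) y g" "x = y 0" "z = y (b - a)"
    have "W11 a b (\<lambda>s. y (s - a)) (\<lambda>s. g (s - a))" using W11_shift[OF y(1), of a] by simp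
    moreover have "cost L a b (\<lambda>s. y (s - a)) (\<lambda>s. g (s - a)) = cost L 0 (b - a) y g"
      using cost_shift[OF y(1), of a] by simp
    ultimately show "(INF (y, g) \<in> {(y', g). W11 a b y' g \<and> y' a = y 0 \<and> y' b = y (b - a)}. cost L a b y g) \<le> cost L 0 (b - a) y g"
      by (intro INF_lower2[of "(\<lambda>s. y (s - a), \<lambda>s. g (s - a))"]) (auto simp: y)
  qed
qed

lemma L_plus_eq:
  "L_plus L x u = Limsup (at_right 0) (\<lambda>h. ennreal (1 / h) * trans_cost L h (x - h *\<^sub>R u) x)"
  unfolding L_plus_def using INF_cost_eq_trans_cost[of "- h" 0 for h] by simp

lemma concat_exists:
  assumes 1: "W11 0 s y1 g1" and 2: "W11 0 t y2 g2" and "0 \<le> s" "0 \<le> t" "y1 s = y2 0"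
  shows "\<exists>y g. W11 0 (s + t) y g \<and> y 0 = y1 0 \<and> y (s + t) = y2 t \<and>
    cost L 0 (s + t) y g = cost L 0 s y1 g1 + cost L 0 t y2 g2"
proof -
  have Y2: "W11 s (s + t) (\<lambda>r. y2 (r - s)) (\<lambda>r. g2 (r - s))"
    using W11_shift[OF 2, of s] by (simp add: add.commute)
  let ?y = "\<lambda>r. if r \<le> s then y1 r else y2 (r - s)" and ?g = "\<lambda>r. if r \<le> s then g1 r else g2 (r - s)"
  have W: "W11 0 (s + t) ?y ?g"
    using assms by (intro W11_concat[OF 1 Y2]) auto
  have "cost L 0 (s + t) ?y ?g = cost L 0 s ?y ?g + cost L s (s + t) ?y ?g"
    using assms by (intro cost_split[OF W, symmetric]) auto
  also have "cost L 0 s ?y ?g = cost L 0 s y1 g1" by (rule cost_cong) auto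
  also have "cost L s (s + t) ?y ?g = cost L s (s + t) (\<lambda>r. y2 (r - s)) (\<lambda>r. g2 (r - s))"
    by (rule cost_cong) auto
  also have "\<dots> = cost L 0 t y2 g2" using cost_shift[OF 2, of s] by (simp add: add.commute)
  finally show ?thesis
    using W assms by (intro exI[of _ ?y] exI[of _ ?g]) auto
qed

lemma trans_cost_triangle:
  assumes "0 \<le> s" "0 \<le> t"
  shows "trans_cost L (s + t) x w \<le> trans_cost L s x z + trans_cost L t z w"
proof (rule ennreal_le_add_gtI)
  fix a b assume a: "trans_cost L s x z < a" and b: "trans_cost L t z w < b"
  obtain y1 g1 where 1: "W11 0 s y1 g1" "y1 0 = x" "y1 s = z" "cost L 0 s y1 g1 < a"
    using a by (rule trans_cost_lessE)
  obtain y2 g2 where 2: "W11 0 t y2 g2" "y2 0 = z" "y2 t = w" "cost L 0 t y2 g2 < b"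
    using b by (rule trans_cost_lessE)
  obtain y g where "W11 0 (s + t) y g" "y 0 = x" "y (s + t) = w"
    "cost L 0 (s + t) y g = cost L 0 s y1 g1 + cost L 0 t y2 g2"
    using concat_exists[OF 1(1) 2(1) assms] 1 2 by auto
  then have "trans_cost L (s + t) x w \<le> cost L 0 s y1 g1 + cost L 0 t y2 g2"
    unfolding trans_cost_def by (intro INF_lower2[of "(y, g)"]) auto
  also have "\<dots> \<le> a + b" using 1 2 by (intro add_mono) auto
  finally show "trans_cost L (s + t) x w \<le> a + b" .
qed

text \<open>The half of dynamic programming behind every insertion of a segment and behind (b) for
  the value function.\<close>

lemma value_fun_le_trans_cost_add:
  assumes "0 \<le> s" "0 \<le> t"
  shows "value_fun L \<phi> (s + t) x \<le> trans_cost L s x z + value_fun L \<phi> t z"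
proof (rule ennreal_le_add_gtI)
  fix a b assume a: "trans_cost L s x z < a" and b: "value_fun L \<phi> t z < b"
  obtain y2 g2 where 2: "W11 0 t y2 g2" "y2 0 = z" "cost L 0 t y2 g2 + \<phi> (y2 t) < b"
    using b by (rule value_fun_lessE)
  have "trans_cost L t z (y2 t) \<le> cost L 0 t y2 g2"
    using trans_cost_le_cost[OF 2(1)] 2(2) by simp
  then have "trans_cost L s x z + trans_cost L t z (y2 t) + \<phi> (y2 t) \<le> a + (cost L 0 t y2 g2 + \<phi> (y2 t))"
    using a by (simp add: add.assoc add_mono less_imp_le)
  then have "trans_cost L s x z + trans_cost L t z (y2 t) + \<phi> (y2 t) \<le> a + b"
    using 2(3) by (meson add_left_mono less_imp_le order_trans)
  moreover have "value_fun L \<phi> (s + t) x \<le> trans_cost L s x z + trans_cost L t z (y2 t) + \<phi> (y2 t)"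
    using value_fun_le_trans_cost[of L \<phi> "s + t" x "y2 t"] trans_cost_triangle[OF assms, of x "y2 t" z]
    by (meson add_right_mono order_trans)
  ultimately show "value_fun L \<phi> (s + t) x \<le> a + b" by simp
qed

end

section \<open>Regularity of the value function\<close>

lemma set_integral_Icc_mono:
  fixes f :: "real \<Rightarrow> real"
  assumes I: "set_integrable lborel {a..b} f" and f: "\<And>r. 0 \<le> f r" and "a \<le> c" "d \<le> b"
  shows "(LINT r:{c..d}|lborel. f r) \<le> (LINT r:{a..b}|lborel. f r)"
proof -
  have "set_integrable lborel {c..d} f" by (rule set_integrable_subset[OF I]) (use assms in auto)
  with I show ?thesis
    unfolding set_lebesgue_integral_def set_integrable_def
    by (intro integral_mono) (use f \<open>a \<le> c\<close> \<open>d \<le> b\<close> in \<open>auto simp: indicator_def\<close>)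
qed

lemma W11_norm_diff_le_total:
  assumes "W11 a b y g" "a \<le> c" "c \<le> b" "a \<le> d" "d \<le> b"
  shows "norm (y d - y c) \<le> (LINT r:{a..b}|lborel. norm (g r))"
proof -
  have *: "norm (y d - y c) \<le> (LINT r:{a..b}|lborel. norm (g r))" if "a \<le> c" "c \<le> d" "d \<le> b" for c d
    using W11_norm_diff_le[OF assms(1) that]
      set_integral_Icc_mono[OF set_integrable_norm[OF W11_integrable[OF assms(1)]], of c d] that by simp
  show ?thesis
    using *[of c d] *[of d c] assms by (cases "c \<le> d") (auto simp: norm_minus_commute)
qed

text \<open>Superlinear growth is kept as lower bounds of arbitrary slope \<open>K\<close>, uniform
  in the position, so that \<open>\<Theta>\<close> disappears. One radius serves position and
  velocity alike, which lets every later constant \<open>R\<close> play both roles.\<close>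

locale tonelli_lagrangian = nonneg_lsc_lagrangian L for L :: "'a::euclidean_space \<Rightarrow> 'a \<Rightarrow> real" +
  assumes L_convex: "\<And>x. convex_on UNIV (L x)"
    and L_growth: "\<And>K. \<exists>C. \<forall>x u. K * norm u - C \<le> L x u"
    and L_bounded: "\<And>R. \<exists>C. \<forall>x u. norm x \<le> R \<longrightarrow> norm u \<le> R \<longrightarrow> L x u \<le> C"
begin

lemma L_growthE:
  obtains C where "0 \<le> C" "\<And>x u. K * norm u - C \<le> L x u"
proof -
  obtain C where "\<forall>x u. K * norm u - C \<le> L x u" using L_growth[of K] by blast
  moreover have "K * norm u - max 0 C \<le> K * norm u - C" for u :: 'a by simp
  ultimately have "K * norm u - max 0 C \<le> L x u" for x u by (meson order_trans)
  then show thesis by (rule that[of "max 0 C", rotated]) simp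
qed

lemma L_boundedE:
  obtains C where "0 \<le> C" "\<And>x u. norm x \<le> R \<Longrightarrow> norm u \<le> R \<Longrightarrow> L x u \<le> C"
proof -
  obtain C where "\<forall>x u. norm x \<le> R \<longrightarrow> norm u \<le> R \<longrightarrow> L x u \<le> C" using L_bounded[of R] by blast
  then show thesis by (intro that[of "max 0 C"]) (auto simp: le_max_iff_disj)
qed

text \<open>Every new piece of curve gets its cost estimate here. The segment stays in the ball by
  convexity and its constant speed is at most \<open>R\<close>; for \<open>T = 0\<close> the last
  hypothesis forces \<open>z = x\<close>.\<close>

lemma trans_cost_line:
  assumes C: "\<And>x u. norm x \<le> R \<Longrightarrow> norm u \<le> R \<Longrightarrow> L x u \<le> C"
    and "0 \<le> T" "norm x \<le> R" "norm z \<le> R" "norm (z - x) \<le> R * T"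
  shows "trans_cost L T x z \<le> ennreal (C * T)"
proof -
  define v where "v = (1 / T) *\<^sub>R (z - x)"
  have "0 \<le> R" using assms(3) norm_ge_zero[of x] by linarith
  have W: "W11 0 T (\<lambda>s. x + (s - 0) *\<^sub>R v) (\<lambda>s. v)" by (rule W11_line) fact
  have yT: "x + T *\<^sub>R v = z"
    using assms by (cases "T = 0") (auto simp: v_def)
  have v: "norm v \<le> R"
  proof (cases "T = 0")
    case False
    then show ?thesis using assms by (simp add: v_def pos_divide_le_eq)
  qed (use \<open>0 \<le> R\<close> in \<open>auto simp: v_def\<close>)
  have "norm (x + s *\<^sub>R v) \<le> R" if "0 \<le> s" "s \<le> T" for s
  proof (cases "T = 0")
    case False
    then have "x + s *\<^sub>R v = (1 - s / T) *\<^sub>R x + (s / T) *\<^sub>R z"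
      by (simp add: v_def algebra_simps)
    also have "\<dots> \<in> cball 0 R"
      using False that assms by (intro convexD_alt[OF convex_cball]) (auto simp: field_simps)
    finally show ?thesis by simp
  qed (use that assms in auto)
  then have "cost L 0 T (\<lambda>s. x + (s - 0) *\<^sub>R v) (\<lambda>s. v) \<le> (\<integral>\<^sup>+ s. ennreal C * indicator {0..T} s \<partial>lborel)"
    unfolding cost_def using v
    by (intro nn_integral_mono) (auto simp: indicator_def intro!: ennreal_leI C)
  also have "\<dots> = ennreal (C * T)"
    using \<open>0 \<le> T\<close> order_trans[OF L_nonneg C[of 0 0]] \<open>0 \<le> R\<close>
    by (simp add: nn_integral_cmult_indicator ennreal_mult)
  finally show ?thesis
    using trans_cost_le_cost[OF W] yT by (auto intro: order_trans)
qed

lemma cost_eq_set_integral: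
  assumes y: "W11 a b y g" and fin: "cost L a b y g < \<infinity>"
  shows "set_integrable lborel {a..b} (\<lambda>s. L (y s) (g s))"
    and "cost L a b y g = ennreal (LINT s:{a..b}|lborel. L (y s) (g s))"
proof -
  have eq: "cost L a b y g = (\<integral>\<^sup>+ s. ennreal (indicator {a..b} s * L (y s) (g s)) \<partial>lborel)"
    unfolding cost_def by (intro nn_integral_cong) (auto simp: indicator_def)
  have I: "integrable lborel (\<lambda>s. indicator {a..b} s * L (y s) (g s))"
    using fin L_curve_measurable[OF y] unfolding eq
    by (intro integrableI_nonneg) (auto simp: L_nonneg)
  then show "set_integrable lborel {a..b} (\<lambda>s. L (y s) (g s))"
    by (simp add: set_integrable_def)
  show "cost L a b y g = ennreal (LINT s:{a..b}|lborel. L (y s) (g s))"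
    unfolding eq set_lebesgue_integral_def using I
    by (subst nn_integral_eq_integral) (auto simp: L_nonneg)
qed

text \<open>Integrate the growth bound. Since the slope \<open>K\<close> is free, a bounded cost
  over a short time forces a short curve: \<open>K\<close> is taken large first, and the time small
  afterwards.\<close>

lemma length_le:
  assumes y: "W11 a b y g" and "a \<le> b" and A: "cost L a b y g \<le> ennreal A" "0 \<le> A"
    and K: "\<And>x u. K * norm u - C \<le> L x u"
  shows "K * (LINT r:{a..b}|lborel. norm (g r)) \<le> A + C * (b - a)"
proof -
  note fin = le_less_trans[OF A(1) ennreal_less_top, folded infinity_ennreal_def]
  note I = cost_eq_set_integral[OF y fin]
  have "(LINT r:{a..b}|lborel. L (y r) (g r)) \<le> A"
    using A I(2) by (simp add: ennreal_le_iff)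
  moreover have C: "set_integrable lborel {a..b} (\<lambda>r. C)"
    by (rule set_integrable_const_Icc)
  have N: "set_integrable lborel {a..b} (\<lambda>r. norm (g r))"
    using W11_integrable[OF y] by (rule set_integrable_norm)
  have "(LINT r:{a..b}|lborel. K * norm (g r) - C) \<le> (LINT r:{a..b}|lborel. L (y r) (g r))"
    using N C I(1) K by (intro set_integral_mono set_integral_diff) auto
  moreover have "(LINT r:{a..b}|lborel. K * norm (g r) - C) = K * (LINT r:{a..b}|lborel. norm (g r)) - C * (b - a)"
  proof -
    have "(LINT r:{a..b}|lborel. C) = C * (b - a)"
      using \<open>a \<le> b\<close> by (simp add: set_lebesgue_integral_def mult.commute)
    then show ?thesis using N C by (subst set_integral_diff) auto
  qed
  ultimately show ?thesis by linarith
qed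

end

section \<open>Finiteness and local Lipschitz continuity of the value function\<close>

locale bolza_problem = tonelli_lagrangian L for L :: "'a::euclidean_space \<Rightarrow> 'a \<Rightarrow> real" +
  fixes \<phi> :: "'a \<Rightarrow> ennreal"
  assumes \<phi>_lsc: "lsc \<phi>"
    and \<phi>_proper: "\<exists>x. \<phi> x \<noteq> \<infinity>"
begin

lemma value_fun_bounded:
  assumes "0 < t1"
  obtains A where "0 \<le> A" "\<And>t x. t1 \<le> t \<Longrightarrow> t \<le> t2 \<Longrightarrow> norm x \<le> R \<Longrightarrow> value_fun L \<phi> t x \<le> ennreal A"
proof -
  obtain z where "\<phi> z \<noteq> \<infinity>" using \<phi>_proper by blast
  then obtain f where f: "0 \<le> f" "\<phi> z = ennreal f" by (cases "\<phi> z") auto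
  \<comment> \<open>Both ends lie in the ball of radius \<open>S\<close>, so a time of at least
    \<open>t1\<close> allows the speed \<open>2 * S / t1\<close>; the sum
    \<open>S + 2 * S / t1\<close> bounds position and speed at once.\<close>
  define S where "S = max \<bar>R\<bar> (norm z)"
  have "0 \<le> S" "norm z \<le> S" "R \<le> S" by (auto simp: S_def)
  obtain C where C: "0 \<le> C" "\<And>x u. norm x \<le> S + 2 * S / t1 \<Longrightarrow> norm u \<le> S + 2 * S / t1 \<Longrightarrow> L x u \<le> C"
    by (rule L_boundedE[of "S + 2 * S / t1"]) blast
  have ge: "S \<le> S + 2 * S / t1" "0 \<le> 2 * S / t1" using \<open>0 \<le> S\<close> \<open>0 < t1\<close> by auto
  have "value_fun L \<phi> t x \<le> ennreal (C * max t1 t2 + f)" if t: "t1 \<le> t" "t \<le> t2" "norm x \<le> R" for t x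
  proof -
    have "norm (z - x) \<le> 2 * S" using norm_triangle_ineq4[of z x] \<open>norm z \<le> S\<close> \<open>R \<le> S\<close> t by linarith
    also have "\<dots> \<le> 2 * S / t1 * t" using t \<open>0 \<le> S\<close> \<open>0 < t1\<close> by (simp add: field_simps mult_left_mono)
    also have "\<dots> \<le> (S + 2 * S / t1) * t" using \<open>0 \<le> S\<close> t \<open>0 < t1\<close> by (simp add: algebra_simps)
    finally have "trans_cost L t x z \<le> ennreal (C * t)"
      using t \<open>R \<le> S\<close> \<open>norm z \<le> S\<close> ge \<open>0 < t1\<close>
      by (intro trans_cost_line[of "S + 2 * S / t1" C]) (use C in auto)
    then have "value_fun L \<phi> t x \<le> ennreal (C * t) + ennreal f"
      using value_fun_le_trans_cost[of L \<phi> t x z] f by (metis add_right_mono order_trans)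
    also have "\<dots> = ennreal (C * t + f)" using C f t \<open>0 < t1\<close> by (subst ennreal_plus) auto
    also have "\<dots> \<le> ennreal (C * max t1 t2 + f)"
      using t C(1) by (intro ennreal_leI add_right_mono mult_left_mono) auto
    finally show ?thesis .
  qed
  then show thesis
    using that[of "C * max t1 t2 + f"] C(1) f(1) \<open>0 < t1\<close> by (auto simp: max_def)
qed

lemma value_fun_finite: "0 < t \<Longrightarrow> value_fun L \<phi> t x < \<infinity>"
  using value_fun_bounded[of t t "norm x"] by (metis ennreal_less_top infinity_ennreal_def le_less_trans order_refl)

lemma value_fun_eq_ennreal: "0 < t \<Longrightarrow> value_fun L \<phi> t x = ennreal (value_real L \<phi> (t, x))"
  using value_fun_finite[of t x] by (simp add: value_real_def less_top)

text \<open>One of the roughly \<open>t / (2 \<eta>)\<close> subintervals of length \<open>2 \<eta>\<close> carries only a fraction of order \<open>\<eta>\<close> of the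
  length of a near-minimiser; running along the chord in half the time saves \<open>\<eta>\<close> at cost \<open>O(\<eta>)\<close>.
  This replaces the Lipschitz regularity of minimisers.\<close>

lemma value_fun_shorten:
  assumes "0 < t1"
  obtains C \<eta>0 where "0 \<le> C" "0 < \<eta>0"
    "\<And>\<eta> t x. 0 \<le> \<eta> \<Longrightarrow> \<eta> < \<eta>0 \<Longrightarrow> t1 \<le> t \<Longrightarrow> t \<le> t2 \<Longrightarrow> norm x \<le> R \<Longrightarrow>
       value_fun L \<phi> t x \<le> value_fun L \<phi> (t + \<eta>) x + ennreal (C * \<eta>)"
proof -
  obtain A where A: "0 \<le> A" "\<And>t x. t1 \<le> t \<Longrightarrow> t \<le> t2 + 1 \<Longrightarrow> norm x \<le> R \<Longrightarrow> value_fun L \<phi> t x \<le> ennreal A"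
    by (rule value_fun_bounded[OF assms, of "t2 + 1" R]) blast
  obtain C1 where C1: "0 \<le> C1" "\<And>x u. 1 * norm u - C1 \<le> L x u" by (rule L_growthE[of 1]) blast
  \<comment> \<open>Bounds the length of a near-minimiser whose error is at most 1 and whose horizon
    is at most \<open>\<bar>t2\<bar> + 1\<close>, by growth of slope 1.\<close>
  define M where "M = A + 1 + C1 * (\<bar>t2\<bar> + 1)"
  have M: "0 \<le> M" using A C1 by (simp add: M_def)
  \<comment> \<open>\<open>\<bar>R\<bar> + M\<close> confines the curve, and
    \<open>4 * M / t1\<close> will bound the speed along the chord.\<close>
  define S where "S = \<bar>R\<bar> + M + 4 * M / t1"
  have S: "\<bar>R\<bar> + M \<le> S" "4 * M / t1 \<le> S" using M assms by (auto simp: S_def)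
  obtain C2 where C2: "0 \<le> C2" "\<And>x u. norm x \<le> S \<Longrightarrow> norm u \<le> S \<Longrightarrow> L x u \<le> C2"
    by (rule L_boundedE[of S]) blast
  show thesis
  proof (rule that[of "C2 + 1" "min 1 (t1 / 4)"])
    fix \<eta> t and x :: 'a assume h: "0 \<le> \<eta>" "\<eta> < min 1 (t1 / 4)" "t1 \<le> t" "t \<le> t2" "norm x \<le> R"
    show "value_fun L \<phi> t x \<le> value_fun L \<phi> (t + \<eta>) x + ennreal ((C2 + 1) * \<eta>)"
    proof (cases "\<eta> = 0")
      case False
      with h have \<eta>: "0 < \<eta>" "\<eta> < 1" "\<eta> < t1 / 4" by auto
      have VA: "value_fun L \<phi> (t + \<eta>) x \<le> ennreal A" using h \<eta> by (intro A) auto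
      have "value_fun L \<phi> (t + \<eta>) x < value_fun L \<phi> (t + \<eta>) x + ennreal \<eta>"
        using \<eta> le_less_trans[OF VA ennreal_less_top] by (auto simp: ennreal_add_left_cancel_less less_top)
      then obtain y g where y: "W11 0 (t + \<eta>) y g" "y 0 = x"
        and yc: "cost L 0 (t + \<eta>) y g + \<phi> (y (t + \<eta>)) < value_fun L \<phi> (t + \<eta>) x + ennreal \<eta>"
        by (rule value_fun_lessE)
      have "cost L 0 (t + \<eta>) y g \<le> value_fun L \<phi> (t + \<eta>) x + ennreal \<eta>"
        using yc by (metis add_increasing2 less_imp_le linorder_not_le zero_le)
      also have "\<dots> \<le> ennreal A + ennreal 1" using VA \<eta> by (intro add_mono ennreal_leI) auto
      also have "\<dots> = ennreal (A + 1)" using A by (subst ennreal_plus) auto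
      finally have cA: "cost L 0 (t + \<eta>) y g \<le> ennreal (A + 1)" .
      have "0 \<le> t + \<eta>" using h assms by linarith
      have "1 * (LINT r:{0..t + \<eta>}|lborel. norm (g r)) \<le> A + 1 + C1 * (t + \<eta> - 0)"
        using \<open>0 \<le> t + \<eta>\<close> A(1) by (intro length_le[OF y(1) _ cA]) (use C1 in auto)
      also have "\<dots> \<le> M" unfolding M_def using h \<eta> C1(1)
        by (intro add_left_mono mult_left_mono) auto
      finally have len: "(LINT r:{0..t + \<eta>}|lborel. norm (g r)) \<le> M" by simp
      \<comment> \<open>Rounding down loses less than one interval; \<open>\<eta> < t1 / 4\<close>
        guarantees that at least \<open>t1 / (4 * \<eta>)\<close> intervals remain.\<close>
      define N where "N = nat \<lfloor>(t + \<eta>) / (2 * \<eta>)\<rfloor>"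
      have N: "real N \<le> (t + \<eta>) / (2 * \<eta>)" "(t + \<eta>) / (2 * \<eta>) - 1 < real N"
        unfolding N_def using h \<eta> assms by auto
      have "t1 / (4 * \<eta>) \<le> (t + \<eta>) / (2 * \<eta>) - 1"
        using h \<eta> by (simp add: field_simps)
      with N have Nge: "t1 / (4 * \<eta>) \<le> real N" by linarith
      moreover have "0 < t1 / (4 * \<eta>)" using assms \<eta> by simp
      ultimately have Npos: "0 < real N" by linarith
      have N2: "2 * \<eta> * real N \<le> t + \<eta>" using N(1) \<eta> by (simp add: field_simps)
      define G where "G i = (LINT r:{0..2 * \<eta> * real i}|lborel. norm (g r))" for i
      have gI: "set_integrable lborel {0..t + \<eta>} (\<lambda>r. norm (g r))"
        by (intro set_integrable_norm W11_integrable[OF y(1)])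
      have node: "2 * \<eta> * real i \<le> t + \<eta>" if "i \<le> N" for i
      proof -
        have "2 * \<eta> * real i \<le> 2 * \<eta> * real N" using that \<eta> by (intro mult_left_mono) auto
        with N2 show ?thesis by linarith
      qed
      \<comment> \<open>Pigeonhole: otherwise the \<open>N\<close> pieces together would be longer
        than \<open>M\<close>.\<close>
      have "\<exists>i<N. G (Suc i) - G i \<le> M / real N"
      proof (rule ccontr)
        assume "\<not> ?thesis"
        then have "(\<Sum>i<N. M / real N) < (\<Sum>i<N. G (Suc i) - G i)"
          using Npos by (intro sum_strict_mono) auto
        also have "\<dots> = G N - G 0" by (rule sum_lessThan_telescope)
        also have "\<dots> = (LINT r:{0..2 * \<eta> * real N}|lborel. norm (g r))" by (simp add: G_def)
        also have "\<dots> \<le> (LINT r:{0..t + \<eta>}|lborel. norm (g r))"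
          using N2 by (intro set_integral_Icc_mono[OF gI]) auto
        finally show False using len Npos by simp
      qed
      then obtain i where i: "i < N" "G (Suc i) - G i \<le> M / real N" by blast
      define a b where "a = 2 * \<eta> * real i" and "b = 2 * \<eta> * real (Suc i)"
      have ab: "0 \<le> a" "a \<le> b" "b \<le> t + \<eta>" "b = a + 2 * \<eta>"
        using \<eta> i node[of "Suc i"] by (auto simp: a_def b_def algebra_simps)
      have "norm (y b - y a) \<le> (LINT r:{a..b}|lborel. norm (g r))"
        by (rule W11_norm_diff_le[OF y(1)]) (use ab in auto)
      also have "\<dots> = G (Suc i) - G i"
      proof -
        have "set_integrable lborel {0..b} (\<lambda>r. norm (g r))"
          by (rule set_integrable_subset[OF gI]) (use ab in auto)
        from set_integral_Icc_combine[OF this ab(1,2)] show ?thesis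
          by (simp add: G_def a_def b_def)
      qed
      also have "\<dots> \<le> M / real N" by (rule i)
      also have "\<dots> \<le> 4 * M / t1 * \<eta>"
      proof -
        have "M / real N \<le> M / (t1 / (4 * \<eta>))"
          using M Nge \<open>0 < t1 / (4 * \<eta>)\<close> by (intro frac_le) auto
        then show ?thesis by (simp add: mult.commute mult.left_commute)
      qed
      also have "\<dots> \<le> S * \<eta>" using S \<eta> by (intro mult_right_mono) auto
      finally have ch: "norm (y b - y a) \<le> S * \<eta>" .
      have pos: "norm (y s) \<le> S" if "0 \<le> s" "s \<le> t + \<eta>" for s
      proof -
        have "norm (y s - y 0) \<le> M"
          using W11_norm_diff_le_total[OF y(1), of 0 s] that len by simp
        then have "norm (y s) \<le> \<bar>R\<bar> + M"
          using norm_triangle_ineq2[of "y s" x] h(5) unfolding y(2) by linarith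
        with S show ?thesis by linarith
      qed
      have tc: "trans_cost L \<eta> (y a) (y b) \<le> ennreal (C2 * \<eta>)"
        by (rule trans_cost_line[of S C2]) (use C2 ch pos ab \<eta> in auto)
      \<comment> \<open>As \<open>b = a + 2 * \<eta>\<close>, following \<open>y\<close> up to
        \<open>a\<close>, the chord for the time \<open>\<eta>\<close>, and \<open>y\<close> again
        from \<open>b\<close> on takes exactly the time \<open>t\<close>. The chord costs
        \<open>C2 * \<eta>\<close>; the 1 in \<open>C2 + 1\<close> pays for the error of the
        near-minimiser.\<close>
      have "value_fun L \<phi> t x = value_fun L \<phi> (a + (\<eta> + (t + \<eta> - b))) (y 0)"
        using ab y(2) by simp
      also have "\<dots> \<le> trans_cost L a (y 0) (y a) + value_fun L \<phi> (\<eta> + (t + \<eta> - b)) (y a)"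
        by (rule value_fun_le_trans_cost_add) (use ab \<eta> in auto)
      also have "\<dots> \<le> trans_cost L a (y 0) (y a) + (trans_cost L \<eta> (y a) (y b) + value_fun L \<phi> (t + \<eta> - b) (y b))"
        by (intro add_left_mono value_fun_le_trans_cost_add) (use ab \<eta> in auto)
      also have "\<dots> \<le> cost L 0 a y g + (ennreal (C2 * \<eta>) + (cost L b (t + \<eta>) y g + \<phi> (y (t + \<eta>))))"
      proof (intro add_mono tc)
        show "trans_cost L a (y 0) (y a) \<le> cost L 0 a y g"
          using trans_cost_le_cost[OF W11_subinterval[OF y(1), of 0 a]] ab by simp
        have "trans_cost L (t + \<eta> - b) (y b) (y (t + \<eta>)) \<le> cost L b (t + \<eta>) y g"
          using trans_cost_le_cost[OF W11_subinterval[OF y(1), of b "t + \<eta>"]] ab by simp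
        then show "value_fun L \<phi> (t + \<eta> - b) (y b) \<le> cost L b (t + \<eta>) y g + \<phi> (y (t + \<eta>))"
          using value_fun_le_trans_cost[of L \<phi> "t + \<eta> - b" "y b" "y (t + \<eta>)"]
          by (meson add_right_mono order_trans)
      qed
      also have "\<dots> = (cost L 0 a y g + cost L b (t + \<eta>) y g) + \<phi> (y (t + \<eta>)) + ennreal (C2 * \<eta>)"
        by (simp add: algebra_simps)
      also have "\<dots> \<le> cost L 0 (t + \<eta>) y g + \<phi> (y (t + \<eta>)) + ennreal (C2 * \<eta>)"
      proof (intro add_right_mono)
        have "cost L 0 a y g + cost L b (t + \<eta>) y g \<le> cost L 0 b y g + cost L b (t + \<eta>) y g"
          using ab by (intro add_right_mono cost_mono) auto
        also have "\<dots> = cost L 0 (t + \<eta>) y g" using ab by (intro cost_split[OF y(1)]) auto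
        finally show "cost L 0 a y g + cost L b (t + \<eta>) y g \<le> cost L 0 (t + \<eta>) y g" .
      qed
      also have "\<dots> \<le> value_fun L \<phi> (t + \<eta>) x + ennreal \<eta> + ennreal (C2 * \<eta>)"
        using yc by (intro add_right_mono) auto
      also have "\<dots> = value_fun L \<phi> (t + \<eta>) x + ennreal ((C2 + 1) * \<eta>)"
        using \<eta> C2(1) by (simp add: add.assoc ennreal_plus[symmetric] algebra_simps del: ennreal_plus)
      finally show ?thesis .
    qed simp
  qed (use C2 assms in auto)
qed

text \<open>A segment from \<open>x'\<close> to \<open>x\<close> run in a time \<open>d\<close>
  equal to the space-time distance leads to the horizon \<open>t + d\<close>; saving the time
  \<open>t + d - t'\<close>, which lies between 0 and \<open>2 * d\<close>, restores
  \<open>t'\<close>. The roles of the two points can be exchanged.\<close>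

lemma value_fun_locally_Lipschitz:
  assumes "0 < t0"
  obtains r C where "0 < r" "r \<le> t0 / 2" "0 \<le> C"
    "\<And>t x t' x'. (t, x) \<in> ball (t0, x0) r \<Longrightarrow> (t', x') \<in> ball (t0, x0) r \<Longrightarrow>
       value_fun L \<phi> t' x' \<le> value_fun L \<phi> t x + ennreal (C * dist (t, x) (t', x'))"
proof -
  define R where "R = norm x0 + 1"
  obtain C1 where C1: "0 \<le> C1" "\<And>x u. norm x \<le> R \<Longrightarrow> norm u \<le> R \<Longrightarrow> L x u \<le> C1" by (rule L_boundedE[of R]) blast
  obtain C2 \<eta>0 where C2: "0 \<le> C2" "0 < \<eta>0" and short:
    "\<And>\<eta> t x. 0 \<le> \<eta> \<Longrightarrow> \<eta> < \<eta>0 \<Longrightarrow> t0 / 2 \<le> t \<Longrightarrow> t \<le> 2 * t0 \<Longrightarrow> norm x \<le> R \<Longrightarrow>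
       value_fun L \<phi> t x \<le> value_fun L \<phi> (t + \<eta>) x + ennreal (C2 * \<eta>)"
    using value_fun_shorten[of "t0 / 2" "2 * t0" R] assms by auto
  \<comment> \<open>Points of the ball are closer than \<open>2 * r\<close>, so the time to be saved
    stays below \<open>4 * r\<close>, hence below \<open>\<eta>0\<close>. The segment has speed at
    most 1, which \<open>R\<close> admits because \<open>1 \<le> R\<close>.\<close>
  define r where "r = min (min 1 (t0 / 2)) (\<eta>0 / 4)"
  have r: "0 < r" "r \<le> 1" "r \<le> t0 / 2" "r \<le> \<eta>0 / 4" using assms C2 by (auto simp: r_def)
  show thesis
  proof (rule that[of r "C1 + 2 * C2"])
    fix t t' and x x' :: 'a assume b: "(t, x) \<in> ball (t0, x0) r" "(t', x') \<in> ball (t0, x0) r"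
    define d where "d = dist (t, x) (t', x')"
    have d: "\<bar>t - t'\<bar> \<le> d" "norm (x - x') \<le> d" "0 \<le> d"
      using dist_fst_le[of "(t, x)" "(t', x')"] dist_snd_le[of "(t, x)" "(t', x')"]
      by (auto simp: d_def dist_norm)
    have "d \<le> dist (t, x) (t0, x0) + dist (t', x') (t0, x0)"
      unfolding d_def by (rule dist_triangle2)
    with b have d2: "d < 2 * r" by (simp add: dist_commute)
    have tt: "\<bar>t - t0\<bar> < r" "\<bar>t' - t0\<bar> < r" "norm (x - x0) < r" "norm (x' - x0) < r"
      using b dist_fst_le[of "(t0, x0)" "(t, x)"] dist_snd_le[of "(t0, x0)" "(t, x)"]
        dist_fst_le[of "(t0, x0)" "(t', x')"] dist_snd_le[of "(t0, x0)" "(t', x')"]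
      by (auto simp: dist_norm norm_minus_commute)
    have xR: "norm x \<le> R" "norm x' \<le> R"
      using tt r norm_triangle_ineq2[of x x0] norm_triangle_ineq2[of x' x0] by (auto simp: R_def)
    have "1 \<le> R" by (simp add: R_def)
    have "value_fun L \<phi> (d + t) x' \<le> trans_cost L d x' x + value_fun L \<phi> t x"
      by (rule value_fun_le_trans_cost_add) (use d tt r in auto)
    also have "trans_cost L d x' x \<le> ennreal (C1 * d)"
    proof (rule trans_cost_line[of R C1])
      have "1 * d \<le> R * d" using \<open>1 \<le> R\<close> d by (intro mult_right_mono) auto
      with d show "norm (x - x') \<le> R * d" by simp
    qed (use C1 xR d in auto)
    finally have 1: "value_fun L \<phi> (d + t) x' \<le> ennreal (C1 * d) + value_fun L \<phi> t x"
      by (meson add_right_mono order_trans)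
    have "value_fun L \<phi> t' x' \<le> value_fun L \<phi> (t' + (t + d - t')) x' + ennreal (C2 * (t + d - t'))"
      by (rule short) (use tt r d d2 xR in auto)
    also have "\<dots> \<le> ennreal (C1 * d) + value_fun L \<phi> t x + ennreal (C2 * (2 * d))"
      using 1 d C2 by (intro add_mono ennreal_leI mult_left_mono) (auto simp: add.commute)
    also have "\<dots> = value_fun L \<phi> t x + (ennreal (C1 * d) + ennreal (C2 * (2 * d)))"
      by (simp add: algebra_simps)
    also have "ennreal (C1 * d) + ennreal (C2 * (2 * d)) = ennreal ((C1 + 2 * C2) * d)"
      using C1 C2 d by (subst ennreal_plus[symmetric]) (auto simp: algebra_simps)
    finally show "value_fun L \<phi> t' x' \<le> value_fun L \<phi> t x + ennreal ((C1 + 2 * C2) * dist (t, x) (t', x'))"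
      by (simp add: d_def)
  qed (use r C1 C2 in auto)
qed

lemma value_real_locally_Lipschitz: "locally_Lipschitz_on pos_times (value_real L \<phi>)"
  unfolding locally_Lipschitz_on_def
proof (rule ballI)
  fix z :: "real \<times> 'a" assume "z \<in> pos_times"
  then obtain t0 x0 where z: "z = (t0, x0)" "0 < t0" by (auto simp: pos_times_def)
  obtain r C where r: "0 < r" "r \<le> t0 / 2" "0 \<le> C" and lip:
    "\<And>t x t' x'. (t, x) \<in> ball (t0, x0) r \<Longrightarrow> (t', x') \<in> ball (t0, x0) r \<Longrightarrow>
       value_fun L \<phi> t' x' \<le> value_fun L \<phi> t x + ennreal (C * dist (t, x) (t', x'))"
    using value_fun_locally_Lipschitz[OF z(2), of x0] by metis
  have *: "value_real L \<phi> (t', x') \<le> value_real L \<phi> (t, x) + C * dist (t, x) (t', x')"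
    if b: "(t, x) \<in> ball (t0, x0) r" "(t', x') \<in> ball (t0, x0) r" "0 < t" "0 < t'" for t x t' x'
  proof -
    have "0 \<le> value_real L \<phi> (t, x)" by (simp add: value_real_def)
    with lip[OF b(1,2)] r(3) b(3,4) show ?thesis
      by (simp add: value_fun_eq_ennreal ennreal_plus[symmetric] ennreal_le_iff del: ennreal_plus)
  qed
  have "C-lipschitz_on (ball z r \<inter> pos_times) (value_real L \<phi>)"
  proof (rule lipschitz_onI)
    fix p q assume pq: "p \<in> ball z r \<inter> pos_times" "q \<in> ball z r \<inter> pos_times"
    obtain t x t' x' where [simp]: "p = (t, x)" "q = (t', x')" by (cases p, cases q) auto
    show "dist (value_real L \<phi> p) (value_real L \<phi> q) \<le> C * dist p q"
      using *[of t x t' x'] *[of t' x' t x] pq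
      by (auto simp: z pos_times_def dist_real_def dist_commute abs_le_iff)
  qed (use r in auto)
  with r show "\<exists>r>0. \<exists>C. C-lipschitz_on (ball z r \<inter> pos_times) (value_real L \<phi>)" by blast
qed

end

section \<open>Hamilton--Jacobi inequalities and initial conditions for the value function\<close>

lemma set_integral_inner:
  fixes f :: "'b \<Rightarrow> 'a::euclidean_space"
  assumes "set_integrable M A f"
  shows "set_integrable M A (\<lambda>r. c \<bullet> f r)" "(LINT r:A|M. c \<bullet> f r) = c \<bullet> (LINT r:A|M. f r)"
proof -
  have eq: "indicator A r *\<^sub>R (c \<bullet> f r) = c \<bullet> (indicator A r *\<^sub>R f r)" for r by simp
  show "set_integrable M A (\<lambda>r. c \<bullet> f r)"
    using assms unfolding set_integrable_def eq by (intro integrable_inner_right) auto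
  show "(LINT r:A|M. c \<bullet> f r) = c \<bullet> (LINT r:A|M. f r)"
    using assms unfolding set_integrable_def set_lebesgue_integral_def eq
    by (intro integral_inner_right) auto
qed

lemma value_real_nonneg: "0 \<le> value_real L \<phi> z"
  by (simp add: value_real_def split: prod.split)

lemma subdifferentialD:
  assumes "p \<in> subdifferential W z" "0 < \<epsilon>"
  obtains \<delta> where "0 < \<delta>" "\<And>z'. dist z' z < \<delta> \<Longrightarrow> - \<epsilon> * norm (z' - z) \<le> W z' - W z - p \<bullet> (z' - z)"
proof -
  have "ereal (- \<epsilon>) < 0" using assms by simp
  also have "0 \<le> Liminf (at z) (\<lambda>z'. ereal ((W z' - W z - p \<bullet> (z' - z)) / norm (z' - z)))"
    using assms by (simp add: subdifferential_def)
  finally have "\<forall>\<^sub>F z' in at z. ereal (- \<epsilon>) < ereal ((W z' - W z - p \<bullet> (z' - z)) / norm (z' - z))"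
    by (rule less_LiminfD)
  then obtain \<delta> where "0 < \<delta>" and \<delta>: "\<And>z'. z' \<noteq> z \<Longrightarrow> dist z' z < \<delta> \<Longrightarrow>
      - \<epsilon> < (W z' - W z - p \<bullet> (z' - z)) / norm (z' - z)"
    unfolding eventually_at by auto
  have "- \<epsilon> * norm (z' - z) \<le> W z' - W z - p \<bullet> (z' - z)" if "dist z' z < \<delta>" for z'
  proof (cases "z' = z")
    case False
    with \<delta>[OF False that] show ?thesis by (simp add: field_simps)
  qed simp
  with \<open>0 < \<delta>\<close> show thesis by (rule that)
qed

context tonelli_lagrangian
begin

text \<open>The substitute for continuity of \<open>L\<close> in the position. Along a violating
  sequence the velocities stay bounded, because growth of slope \<open>norm q + 1\<close> beats the
  slope of the minorant; at a limit velocity, lower semicontinuity of \<open>L\<close> contradicts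
  the minorant at \<open>x\<close>.\<close>

lemma affine_minorant_perturb:
  assumes minor: "\<And>u. a + q \<bullet> u \<le> L x u" and "0 < \<epsilon>"
  obtains \<rho> where "0 < \<rho>" "\<And>x' u. x' \<in> cball x \<rho> \<Longrightarrow> a + q \<bullet> u - \<epsilon> \<le> L x' u"
proof (rule ccontr)
  assume "\<not> thesis"
  with that have "\<exists>x' u. x' \<in> cball x (1 / real (Suc n)) \<and> L x' u < a + q \<bullet> u - \<epsilon>" for n
    by (metis not_less of_nat_0_less_iff zero_less_Suc zero_less_divide_1_iff)
  then obtain X U where XU: "\<And>n. X n \<in> cball x (1 / real (Suc n))" "\<And>n. L (X n) (U n) < a + q \<bullet> U n - \<epsilon>"
    by metis
  obtain C where C: "\<And>x u. (norm q + 1) * norm u - C \<le> L x u"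
    using L_growthE[of "norm q + 1"] by metis
  have "U n \<in> cball 0 (C + \<bar>a\<bar>)" for n
  proof -
    have "(norm q + 1) * norm (U n) - C < a + q \<bullet> U n - \<epsilon>" using C XU(2) by (meson le_less_trans)
    also have "\<dots> \<le> \<bar>a\<bar> + norm q * norm (U n)"
      using norm_cauchy_schwarz[of q "U n"] \<open>0 < \<epsilon>\<close> by linarith
    finally show ?thesis by (simp add: algebra_simps)
  qed
  then obtain u r where r: "strict_mono r" "(U \<circ> r) \<longlonglongrightarrow> u"
    using compact_cball[of "0 :: 'a" "C + \<bar>a\<bar>"] unfolding compact_def by metis
  have "X \<longlonglongrightarrow> x"
  proof (rule metric_LIMSEQ_I)
    fix e :: real assume "0 < e"
    then obtain N where N: "inverse (real (Suc N)) < e" using reals_Archimedean by blast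
    have "dist (X n) x < e" if "N \<le> n" for n
    proof -
      have "dist (X n) x \<le> 1 / real (Suc n)" using XU(1)[of n] by (simp add: dist_commute)
      also have "\<dots> \<le> inverse (real (Suc N))" using that by (simp add: field_simps)
      finally show ?thesis using N by simp
    qed
    then show "\<exists>N. \<forall>n\<ge>N. dist (X n) x < e" by blast
  qed
  from LIMSEQ_subseq_LIMSEQ[OF this r(1)] have "(\<lambda>n. (X (r n), U (r n))) \<longlonglongrightarrow> (x, u)"
    using r(2) by (intro tendsto_Pair) (auto simp: o_def)
  moreover have "\<forall>\<^sub>F p in nhds (x, u). L x u - \<epsilon> / 2 < (\<lambda>(x, u). L x u) p"
    using L_lsc \<open>0 < \<epsilon>\<close> unfolding lsc_def by auto
  ultimately have 1: "\<forall>\<^sub>F n in sequentially. L x u - \<epsilon> / 2 < L (X (r n)) (U (r n))"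
    unfolding filterlim_def le_filter_def eventually_filtermap by fastforce
  have "(\<lambda>n. q \<bullet> U (r n)) \<longlonglongrightarrow> q \<bullet> u" using r(2) by (intro tendsto_intros) (auto simp: o_def)
  then have 2: "\<forall>\<^sub>F n in sequentially. q \<bullet> U (r n) < q \<bullet> u + \<epsilon> / 2"
    using \<open>0 < \<epsilon>\<close> by (intro order_tendstoD(2)) auto
  have "\<forall>\<^sub>F n in sequentially. False"
    using 1 2
  proof eventually_elim
    case (elim n)
    with XU(2)[of "r n"] minor[of u] show False by linarith
  qed
  then show False by simp
qed

end

context bolza_problem
begin

text \<open>A near-optimal passage from \<open>x - h *\<^sub>R u\<close> to \<open>x\<close> in time
  \<open>h\<close> costs at most \<open>h * (c + e / 2)\<close>, and dynamic programming bounds the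
  value at its starting point. The upper derivative also perturbs the direction; the Lipschitz bound
  charges \<open>C * (h * \<delta>)\<close> for that, and \<open>\<delta>\<close> is chosen to make
  this at most \<open>h * (e / 2)\<close>.\<close>

lemma value_HJ_sub: "HJ_sub L (value_real L \<phi>)"
  unfolding HJ_sub_def
proof (clarify)
  fix t and x u :: 'a assume "(t, x) \<in> (pos_times :: (real \<times> 'a) set)"
  then have "0 < t" by (simp add: pos_times_def)
  let ?V = "value_real L \<phi>" and ?F = "at_right 0 \<times>\<^sub>F nhds (1 :: real, - u)"
  obtain r C where r: "0 < r" "r \<le> t / 2" "0 \<le> C" and lip:
    "\<And>s y s' y'. (s, y) \<in> ball (t, x) r \<Longrightarrow> (s', y') \<in> ball (t, x) r \<Longrightarrow>
       value_fun L \<phi> s' y' \<le> value_fun L \<phi> s y + ennreal (C * dist (s, y) (s', y'))"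
    using value_fun_locally_Lipschitz[OF \<open>0 < t\<close>, of x] by metis
  show "upper_derivative ?V (t, x) (1, - u) \<le> enn2ereal (L_plus L x u)"
  proof (rule ereal_le_real)
    fix c assume c: "enn2ereal (L_plus L x u) \<le> ereal c"
    have "0 \<le> c" using c by (metis enn2ereal_nonneg ereal_less_eq(5) order_trans)
    show "upper_derivative ?V (t, x) (1, - u) \<le> ereal c"
    proof (rule ereal_le_epsilon2)
      fix e :: real assume "0 < e"
      have "L_plus L x u \<le> ennreal c"
        using c \<open>0 \<le> c\<close> by (metis e2ennreal_enn2ereal e2ennreal_mono e2ennreal_ereal)
      also have "ennreal c < ennreal (c + e / 2)" using \<open>0 \<le> c\<close> \<open>0 < e\<close> by (intro ennreal_lessI) auto
      finally have "\<forall>\<^sub>F h in at_right 0. ennreal (1 / h) * trans_cost L h (x - h *\<^sub>R u) x < ennreal (c + e / 2)"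
        unfolding L_plus_eq by (rule Limsup_lessD)
      moreover define \<delta> where "\<delta> = min (e / (2 * (C + 1))) 1"
      have "0 < \<delta>" "\<delta> \<le> 1" using \<open>0 < e\<close> r by (auto simp: \<delta>_def)
      have C\<delta>: "C * \<delta> \<le> e / 2"
      proof -
        have "C * \<delta> \<le> (C + 1) * (e / (2 * (C + 1)))"
          using r \<open>0 < \<delta>\<close> by (intro mult_mono) (auto simp: \<delta>_def)
        also have "\<dots> = e / 2" using r by (simp add: divide_simps) (simp add: algebra_simps)?
        finally show ?thesis .
      qed
      moreover have "\<forall>\<^sub>F h in at_right (0::real). h \<in> {0<..<r / (norm (1 :: real, - u) + 1)}"
        using r by (intro eventually_at_right_real divide_pos_pos) (auto intro: add_nonneg_pos)
      ultimately have ev1: "\<forall>\<^sub>F h in at_right 0. ennreal (1 / h) * trans_cost L h (x - h *\<^sub>R u) x < ennreal (c + e / 2)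
          \<and> h \<in> {0<..<r / (norm (1 :: real, - u) + 1)}"
        by (auto intro: eventually_conj)
      have ev2: "\<forall>\<^sub>F d in nhds (1 :: real, - u). dist d (1, - u) < \<delta>"
        using \<open>0 < \<delta>\<close> by (auto simp: eventually_nhds_metric)
      have "\<forall>\<^sub>F p in ?F. (case p of (h, d) \<Rightarrow> ereal ((?V ((t, x) + h *\<^sub>R d) - ?V (t, x)) / h)) \<le> ereal c + ereal e"
      proof (subst eventually_prod_filter, intro exI conjI allI impI)
        fix h and d :: "real \<times> 'a" assume h: "ennreal (1 / h) * trans_cost L h (x - h *\<^sub>R u) x < ennreal (c + e / 2)
            \<and> h \<in> {0<..<r / (norm (1 :: real, - u) + 1)}" and d: "dist d (1, - u) < \<delta>"
        then have "0 < h" by simp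
        have hr: "h * (norm (1 :: real, - u) + 1) < r"
          using h by (simp add: pos_less_divide_eq add_nonneg_pos)
        obtain \<alpha> v where [simp]: "d = (\<alpha>, v)" by (cases d)
        have nd: "norm d \<le> norm (1 :: real, - u) + 1"
          using d \<open>\<delta> \<le> 1\<close> norm_triangle_ineq2[of d "(1, - u)"] by (simp add: dist_norm)
        have b: "(t, x) + h *\<^sub>R d' \<in> ball (t, x) r" if "norm d' \<le> norm (1 :: real, - u) + 1" for d'
        proof -
          have "dist (t, x) ((t, x) + h *\<^sub>R d') = h * norm d'" using \<open>0 < h\<close> by (simp add: dist_norm)
          also have "\<dots> \<le> h * (norm (1 :: real, - u) + 1)" using that \<open>0 < h\<close> by (intro mult_left_mono) auto
          finally show ?thesis using hr by simp
        qed
        have pos: "0 < s" if "(s, y) \<in> ball (t, x) r" for s y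
          using that dist_fst_le[of "(t, x)" "(s, y)"] r \<open>0 < t\<close> by (auto simp: dist_real_def)
        have trans: "trans_cost L h (x - h *\<^sub>R u) x \<le> ennreal (h * (c + e / 2))"
        proof -
          have "trans_cost L h (x - h *\<^sub>R u) x = ennreal h * (ennreal (1 / h) * trans_cost L h (x - h *\<^sub>R u) x)"
            using \<open>0 < h\<close> by (simp add: mult.assoc[symmetric] ennreal_mult'[symmetric])
          also have "\<dots> \<le> ennreal h * ennreal (c + e / 2)" using h by (intro mult_left_mono) auto
          also have "\<dots> = ennreal (h * (c + e / 2))"
            using \<open>0 < h\<close> \<open>0 \<le> c\<close> \<open>0 < e\<close> by (subst ennreal_mult) auto
          finally show ?thesis .
        qed
        have eq: "(t, x) + h *\<^sub>R (1, - u) = (h + t, x - h *\<^sub>R u)" "(t, x) + h *\<^sub>R d = (t + h * \<alpha>, x + h *\<^sub>R v)"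
          by simp_all
        have dd: "dist (h + t, x - h *\<^sub>R u) (t + h * \<alpha>, x + h *\<^sub>R v) = h * dist d (1, - u)"
        proof -
          have "(h + t, x - h *\<^sub>R u) - (t + h * \<alpha>, x + h *\<^sub>R v) = h *\<^sub>R ((1, - u) - d)"
            by (simp add: algebra_simps)
          then show ?thesis
            by (simp only: dist_norm norm_scaleR norm_minus_commute[of d] abs_of_pos[OF \<open>0 < h\<close>])
        qed
        have m1: "(h + t, x - h *\<^sub>R u) \<in> ball (t, x) r" using b[of "(1, - u)"] unfolding eq by simp
        have m2: "(t + h * \<alpha>, x + h *\<^sub>R v) \<in> ball (t, x) r" using b[OF nd] unfolding eq .
        have "value_fun L \<phi> (t + h * \<alpha>) (x + h *\<^sub>R v)
            \<le> value_fun L \<phi> (h + t) (x - h *\<^sub>R u) + ennreal (C * (h * dist d (1, - u)))"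
          using lip[OF m1 m2] unfolding dd .
        also have "\<dots> \<le> (ennreal (h * (c + e / 2)) + value_fun L \<phi> t x) + ennreal (C * (h * \<delta>))"
        proof (intro add_mono ennreal_leI mult_left_mono)
          show "value_fun L \<phi> (h + t) (x - h *\<^sub>R u) \<le> ennreal (h * (c + e / 2)) + value_fun L \<phi> t x"
            using value_fun_le_trans_cost_add[of h t \<phi> "x - h *\<^sub>R u" x] \<open>0 < h\<close> \<open>0 < t\<close> trans
            by (meson add_right_mono less_imp_le order_trans)
        qed (use d \<open>0 < h\<close> r in auto)
        finally have "?V (t + h * \<alpha>, x + h *\<^sub>R v) \<le> h * (c + e / 2) + ?V (t, x) + C * (h * \<delta>)"
          using pos[OF m2] \<open>0 < t\<close> \<open>0 < h\<close> \<open>0 \<le> c\<close> \<open>0 < e\<close> \<open>0 < \<delta>\<close> r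
          by (simp add: value_fun_eq_ennreal ennreal_plus[symmetric] value_real_nonneg ennreal_le_iff del: ennreal_plus)
        also have "\<dots> \<le> h * (c + e / 2) + ?V (t, x) + h * (e / 2)"
        proof -
          have "h * (C * \<delta>) \<le> h * (e / 2)" using C\<delta> \<open>0 < h\<close> by (intro mult_left_mono) auto
          then show ?thesis by (simp only: mult.left_commute[of C h \<delta>] add_left_mono)
        qed
        also have "\<dots> = ?V (t, x) + h * (c + e)" by (simp add: algebra_simps)
        finally have "(?V ((t, x) + h *\<^sub>R d) - ?V (t, x)) / h \<le> c + e"
          using \<open>0 < h\<close> unfolding eq by (simp add: field_simps)
        then show "(case (h, d) of (h, d) \<Rightarrow> ereal ((?V ((t, x) + h *\<^sub>R d) - ?V (t, x)) / h)) \<le> ereal c + ereal e"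
          by simp
      qed (rule ev1, rule ev2)
      then show "upper_derivative ?V (t, x) (1, - u) \<le> ereal c + ereal e"
        unfolding upper_derivative_def by (rule Limsup_bounded)
    qed
  qed
qed

text \<open>Failure means that \<open>- h - px \<bullet> u\<close> is an affine minorant of
  \<open>L x\<close> for some \<open>h < - pt\<close>. Integrated along a near-minimiser on
  \<open>{0..\<eta>}\<close> it bounds the cost from below, while the subgradient bounds it from
  above; the terms with \<open>px\<close> cancel and a deficit \<open>\<kappa> * \<eta>\<close>
  remains. To keep the errors below it, the length of the curve on \<open>{0..\<eta>}\<close> must
  be shown to be \<open>O(\<eta>)\<close>.\<close>

lemma value_HJ_super: "HJ_super L (value_real L \<phi>)"
  unfolding HJ_super_def
proof (clarify)
  fix t pt and x px :: 'a
  assume "(t, x) \<in> (pos_times :: (real \<times> 'a) set)" and p: "(pt, px) \<in> subdifferential (value_real L \<phi>) (t, x)"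
  then have "0 < t" by (simp add: pos_times_def)
  let ?V = "value_real L \<phi>"
  show "0 \<le> ereal pt + hamiltonian L x (- px)"
  proof (rule ccontr)
    assume "\<not> ?thesis"
    then have "hamiltonian L x (- px) < ereal (- pt)"
      by (cases "hamiltonian L x (- px)") auto
    then obtain h where h: "hamiltonian L x (- px) < ereal h" "h < - pt"
      using ereal_dense2 by force
    have minor: "- h + (- px) \<bullet> u \<le> L x u" for u
    proof -
      have "ereal ((- px) \<bullet> u - L x u) \<le> hamiltonian L x (- px)"
        unfolding hamiltonian_def by (rule SUP_upper) simp
      from this h(1) have "ereal ((- px) \<bullet> u - L x u) < ereal h" by (rule le_less_trans)
      then show ?thesis by simp
    qed
    define \<kappa> where "\<kappa> = - pt - h"
    have "0 < \<kappa>" using h by (simp add: \<kappa>_def)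
    \<comment> \<open>In the slope, \<open>norm px\<close> absorbs the subgradient term, one unit
      absorbs \<open>\<epsilon> * len\<close>, and one unit is left to bound
      \<open>len\<close>.\<close>
    obtain C1 where C1: "0 \<le> C1" "\<And>x u. (norm px + 2) * norm u - C1 \<le> L x u"
      using L_growthE[of "norm px + 2"] by metis
    define C' where "C' = \<bar>pt\<bar> + 2 + C1"
    have "0 < C'" using C1 by (simp add: C'_def)
    define \<epsilon> where "\<epsilon> = min 1 (\<kappa> / (4 * (2 + C')))"
    have \<epsilon>: "0 < \<epsilon>" "\<epsilon> \<le> 1" using \<open>0 < \<kappa>\<close> \<open>0 < C'\<close> by (auto simp: \<epsilon>_def)
    have \<epsilon>\<kappa>: "\<epsilon> * (2 + C') \<le> \<kappa> / 4"
    proof -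
      have "\<epsilon> * (2 + C') \<le> \<kappa> / (4 * (2 + C')) * (2 + C')"
        using \<open>0 < C'\<close> by (intro mult_right_mono) (auto simp: \<epsilon>_def)
      also have "\<dots> = \<kappa> / 4" using \<open>0 < C'\<close> by (simp add: divide_simps) (simp add: algebra_simps)?
      finally show ?thesis .
    qed
    obtain \<rho> where \<rho>: "0 < \<rho>" "\<And>x' u. x' \<in> cball x \<rho> \<Longrightarrow> - h + (- px) \<bullet> u - \<epsilon> \<le> L x' u"
      using affine_minorant_perturb[OF minor \<epsilon>(1)] by metis
    obtain \<delta> where \<delta>: "0 < \<delta>" "\<And>z'. dist z' (t, x) < \<delta> \<Longrightarrow>
        - \<epsilon> * norm (z' - (t, x)) \<le> ?V z' - ?V (t, x) - (pt, px) \<bullet> (z' - (t, x))"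
      using subdifferentialD[OF p \<epsilon>(1)] by metis
    define A where "A = ?V (t, x) + 1"
    have A: "1 \<le> A" by (simp add: A_def value_real_nonneg)
    \<comment> \<open>A slope for a first, rough bound: over a short time the length is at most
      \<open>\<delta> / 2\<close>, so the end point lies where the subgradient inequality
      holds.\<close>
    define K where "K = 4 * A / \<delta>"
    have K: "0 < K" using A \<delta> by (simp add: K_def)
    obtain C2 where C2: "0 \<le> C2" "\<And>x u. K * norm u - C2 \<le> L x u" using L_growthE[of K] by metis
    define \<eta> where "\<eta> = min (min (min 1 (t / 2)) (\<kappa> / 4)) (min (\<rho> / C') (min (\<delta> / 8) (\<delta> * K / (4 * (C2 + 1)))))"
    have \<eta>: "0 < \<eta>" "\<eta> \<le> 1" "\<eta> \<le> t / 2" "\<eta> \<le> \<kappa> / 4" "\<eta> \<le> \<rho> / C'" "\<eta> \<le> \<delta> / 8" "\<eta> \<le> \<delta> * K / (4 * (C2 + 1))"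
    proof -
      have "0 < \<rho> / C'" "0 < \<delta> * K / (4 * (C2 + 1))"
        using \<rho>(1) \<delta>(1) K C2(1) \<open>0 < C'\<close> by (auto intro!: divide_pos_pos mult_pos_pos)
      then show "0 < \<eta>" using \<open>0 < t\<close> \<open>0 < \<kappa>\<close> \<delta>(1) unfolding \<eta>_def by linarith
    qed (unfold \<eta>_def, linarith+)
    have sq: "\<eta> * \<eta> \<le> \<eta>" using \<eta> by (simp add: mult_left_le)
    \<comment> \<open>An error proportional to \<open>\<eta>\<close> could consume the deficit; its
      square, divided by \<open>\<eta>\<close>, is at most \<open>\<kappa> / 4\<close>.\<close>
    have "value_fun L \<phi> t x < ennreal (?V (t, x) + \<eta> * \<eta>)"
      using \<open>0 < t\<close> \<eta> by (simp add: value_fun_eq_ennreal ennreal_less_iff value_real_nonneg)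
    then obtain y g where y: "W11 0 t y g" "y 0 = x"
      and yc: "cost L 0 t y g + \<phi> (y t) < ennreal (?V (t, x) + \<eta> * \<eta>)"
      by (rule value_fun_lessE)
    have y\<eta>: "W11 0 \<eta> y g" by (rule W11_subinterval[OF y(1)]) (use \<eta> in auto)
    have "value_fun L \<phi> (t - \<eta>) (y \<eta>) \<le> cost L \<eta> t y g + \<phi> (y t)"
    proof -
      have "trans_cost L (t - \<eta>) (y \<eta>) (y t) \<le> cost L \<eta> t y g"
        by (rule trans_cost_le_cost) (rule W11_subinterval[OF y(1)], use \<eta> in auto)
      then show ?thesis
        using value_fun_le_trans_cost[of L \<phi> "t - \<eta>" "y \<eta>" "y t"] by (meson add_right_mono order_trans)
    qed
    then have "cost L 0 \<eta> y g + value_fun L \<phi> (t - \<eta>) (y \<eta>) \<le> cost L 0 \<eta> y g + (cost L \<eta> t y g + \<phi> (y t))"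
      by (rule add_left_mono)
    also have "\<dots> = cost L 0 t y g + \<phi> (y t)"
      using cost_split[OF y(1), of \<eta>] \<eta> \<open>0 < t\<close> by (simp add: add.assoc[symmetric])
    finally have dp: "cost L 0 \<eta> y g + value_fun L \<phi> (t - \<eta>) (y \<eta>) \<le> ennreal (?V (t, x) + \<eta> * \<eta>)"
      using yc by simp
    have cfin: "cost L 0 \<eta> y g < \<infinity>"
      using dp by (metis add_increasing2 ennreal_less_top infinity_ennreal_def le_less_trans order_refl order_trans zero_le)
    define l where "l = (LINT s:{0..\<eta>}|lborel. L (y s) (g s))"
    have l0: "0 \<le> l" unfolding l_def set_lebesgue_integral_def by (intro Bochner_Integration.integral_nonneg) (auto simp: L_nonneg)
    have cl: "cost L 0 \<eta> y g = ennreal l" unfolding l_def by (rule cost_eq_set_integral(2)[OF y\<eta> cfin])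
    have lV: "l + ?V (t - \<eta>, y \<eta>) \<le> ?V (t, x) + \<eta> * \<eta>"
      using dp \<eta> \<open>0 < t\<close> l0 unfolding cl
      by (simp add: value_fun_eq_ennreal ennreal_plus[symmetric] value_real_nonneg ennreal_le_iff del: ennreal_plus)
    define len where "len = (LINT s:{0..\<eta>}|lborel. norm (g s))"
    have len0: "0 \<le> len" unfolding len_def set_lebesgue_integral_def by (intro Bochner_Integration.integral_nonneg) auto
    have lA: "l \<le> A" using lV sq \<eta>(2) value_real_nonneg[of L \<phi> "(t - \<eta>, y \<eta>)"] unfolding A_def by linarith
    have "K * len \<le> A + C2 * (\<eta> - 0)" unfolding len_def
      by (rule length_le[OF y\<eta>]) (use \<eta> lA A C2 in \<open>auto simp: cl intro: ennreal_leI\<close>)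
    moreover have "C2 * \<eta> \<le> \<delta> * K / 4"
    proof -
      have "C2 * \<eta> \<le> (C2 + 1) * (\<delta> * K / (4 * (C2 + 1)))" using \<eta> C2(1) by (intro mult_mono) auto
      also have "\<dots> = \<delta> * K / 4" using C2(1) by (simp add: divide_simps) (simp add: algebra_simps)?
      finally show ?thesis .
    qed
    moreover have "A = K * \<delta> / 4" using \<delta> by (simp add: K_def)
    ultimately have "K * len \<le> K * (\<delta> / 2)" by (simp add: algebra_simps)
    then have len\<delta>: "len \<le> \<delta> / 2" using K by simp
    define w where "w = (LINT s:{0..\<eta>}|lborel. g s)"
    have w: "y \<eta> - x = w" using W11_integral[OF y\<eta>, of 0 \<eta>] \<eta> y(2) by (simp add: w_def)
    have wlen: "norm w \<le> len" using W11_norm_diff_le_total[OF y\<eta>, of 0 \<eta>] \<eta> w y(2) by (simp add: len_def)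
    have dz: "norm ((t - \<eta>, y \<eta>) - (t, x)) \<le> \<eta> + len"
      using norm_Pair_le[of "- \<eta>" "y \<eta> - x"] \<eta> w wlen by simp
    have "- \<epsilon> * norm ((t - \<eta>, y \<eta>) - (t, x)) \<le> ?V (t - \<eta>, y \<eta>) - ?V (t, x) - (pt, px) \<bullet> ((t - \<eta>, y \<eta>) - (t, x))"
      by (rule \<delta>(2)) (use dz len\<delta> \<eta> \<delta>(1) in \<open>simp add: dist_norm\<close>)
    moreover have "\<epsilon> * norm ((t - \<eta>, y \<eta>) - (t, x)) \<le> \<epsilon> * (\<eta> + len)"
      using dz \<epsilon> by (intro mult_left_mono) auto
    ultimately have 1: "l \<le> pt * \<eta> - px \<bullet> w + \<epsilon> * (\<eta> + len) + \<eta> * \<eta>"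
      using lV w by simp
    \<comment> \<open>Bootstrap: the cost is now bounded through the subgradient inequality itself,
      which improves the rough bound on \<open>len\<close> to a linear one.\<close>
    have "(norm px + 2) * len \<le> l + C1 * (\<eta> - 0)" unfolding len_def
      by (rule length_le[OF y\<eta>]) (use \<eta> l0 C1 in \<open>auto simp: cl\<close>)
    moreover have "pt * \<eta> \<le> \<bar>pt\<bar> * \<eta>" using \<eta> by (intro mult_right_mono) auto
    moreover have "- (px \<bullet> w) \<le> norm px * len"
      using norm_cauchy_schwarz[of "- px" w] mult_left_mono[OF wlen, of "norm px"] by simp
    moreover have "\<epsilon> * (\<eta> + len) \<le> 1 * (\<eta> + len)" using \<epsilon> \<eta> len0 by (intro mult_right_mono) auto
    ultimately have lenC: "len \<le> C' * \<eta>" using 1 sq by (simp add: C'_def algebra_simps)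
    also have "\<dots> \<le> \<rho>" using \<eta>(5) \<open>0 < C'\<close> by (simp add: field_simps)
    finally have len\<rho>: "len \<le> \<rho>" .
    have ig: "set_integrable lborel {0..\<eta>} g" by (rule W11_integrable[OF y\<eta>])
    have ic: "set_integrable lborel {0..\<eta>} (\<lambda>s. - h - \<epsilon>)"
      by (rule set_integrable_const_Icc)
    have "(LINT s:{0..\<eta>}|lborel. (- h - \<epsilon>) + (- px) \<bullet> g s) \<le> l"
      unfolding l_def
    proof (rule set_integral_mono)
      show "set_integrable lborel {0..\<eta>} (\<lambda>s. (- h - \<epsilon>) + (- px) \<bullet> g s)"
        by (intro set_integral_add(1) ic set_integral_inner(1) ig)
      show "set_integrable lborel {0..\<eta>} (\<lambda>s. L (y s) (g s))"
        by (rule cost_eq_set_integral(1)[OF y\<eta> cfin])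
      fix s assume s: "s \<in> {0..\<eta>}"
      then have "norm (y s - x) \<le> len"
        using W11_norm_diff_le_total[OF y\<eta>, of 0 s] y(2) by (simp add: len_def)
      then have "y s \<in> cball x \<rho>" using len\<rho> by (simp add: dist_norm norm_minus_commute)
      from \<rho>(2)[OF this, of "g s"] show "(- h - \<epsilon>) + (- px) \<bullet> g s \<le> L (y s) (g s)" by simp
    qed
    moreover have "(LINT s:{0..\<eta>}|lborel. (- h - \<epsilon>) + (- px) \<bullet> g s) = (- h - \<epsilon>) * \<eta> - px \<bullet> w"
    proof -
      have "(LINT s:{0..\<eta>}|lborel. (- h - \<epsilon>)) = (- h - \<epsilon>) * \<eta>"
        using \<eta> by (simp add: set_lebesgue_integral_def)
      moreover have "(LINT s:{0..\<eta>}|lborel. (- px) \<bullet> g s) = (- px) \<bullet> w"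
        unfolding w_def by (rule set_integral_inner(2)[OF ig])
      ultimately show ?thesis
        using set_integral_add(2)[OF ic set_integral_inner(1)[OF ig, of "- px"]] by simp
    qed
    ultimately have "(- h - \<epsilon>) * \<eta> \<le> pt * \<eta> + \<epsilon> * (\<eta> + len) + \<eta> * \<eta>" using 1 by linarith
    moreover have "\<epsilon> * len \<le> \<epsilon> * (C' * \<eta>)" using lenC \<epsilon> by (intro mult_left_mono) auto
    ultimately have "0 \<le> \<eta> * (pt + h + \<epsilon> * (2 + C') + \<eta>)" by (simp add: algebra_simps)
    then have "0 \<le> pt + h + \<epsilon> * (2 + C') + \<eta>" using \<eta>(1) by (simp add: zero_le_mult_iff)
    with \<epsilon>\<kappa> \<eta>(4) \<open>0 < \<kappa>\<close> show False by (simp add: \<kappa>_def)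
  qed
qed

text \<open>A curve of cost below \<open>d\<close> over a short time has length below
  \<open>r / 2\<close>, so starting near \<open>x\<close> it ends where \<open>\<phi>\<close> still
  exceeds \<open>d\<close>. The slope is chosen so that
  \<open>K * (r / 2) = 2 * (d' + 1)\<close>.\<close>

lemma value_eventually_gt:
  assumes "c < \<phi> x"
  shows "\<forall>\<^sub>F z in at_right 0 \<times>\<^sub>F nhds x. c < ennreal (value_real L \<phi> z)"
proof -
  obtain d where d: "c < d" "d < \<phi> x" using dense[OF assms] by blast
  then obtain d' where d': "d = ennreal d'" "0 \<le> d'" by (cases d) auto
  obtain r where r: "0 < r" "\<And>x'. dist x' x < r \<Longrightarrow> d < \<phi> x'"
    using \<phi>_lsc d(2) unfolding lsc_def eventually_nhds_metric by metis
  define K where "K = 4 * (d' + 1) / r"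
  have "0 < K" using r d' by (simp add: K_def)
  obtain C where C: "0 \<le> C" "\<And>x u. K * norm u - C \<le> L x u" using L_growthE[of K] by metis
  have 1: "\<forall>\<^sub>F h in at_right (0::real). h \<in> {0<..<1 / (C + 1)}"
    using C by (intro eventually_at_right_real) auto
  have 2: "\<forall>\<^sub>F x' in nhds x. dist x' x < r / 2"
    using r(1) unfolding eventually_nhds_metric by (intro exI[of _ "r / 2"]) auto
  show ?thesis
  proof (subst eventually_prod_filter, intro exI conjI allI impI, rule 1, rule 2)
    fix h x' assume h: "h \<in> {0<..<1 / (C + 1)}" and x': "dist x' x < r / 2"
    then have "0 < h" by simp
    show "c < ennreal (value_real L \<phi> (h, x'))"
    proof (rule ccontr)
      assume "\<not> ?thesis"
      then have "value_fun L \<phi> h x' < d"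
        using d(1) \<open>0 < h\<close> by (simp add: value_fun_eq_ennreal)
      then obtain y g where y: "W11 0 h y g" "y 0 = x'" "cost L 0 h y g + \<phi> (y h) < d"
        by (rule value_fun_lessE)
      have "cost L 0 h y g \<le> ennreal d'"
        using y(3) unfolding d' by (metis add_increasing2 less_imp_le linorder_not_le zero_le)
      then have "K * (LINT r:{0..h}|lborel. norm (g r)) \<le> d' + C * (h - 0)"
        by (intro length_le[OF y(1)]) (use \<open>0 < h\<close> d' C in auto)
      also have "\<dots> < d' + 1 + d' + 1"
      proof -
        have "C * h \<le> (C + 1) * h" using \<open>0 < h\<close> by simp
        also have "\<dots> < 1" using h C(1) by (simp add: field_simps)
        finally show ?thesis using d' by simp
      qed
      also have "\<dots> = K * (r / 2)" using r by (simp add: K_def)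
      finally have "(LINT r:{0..h}|lborel. norm (g r)) < r / 2" using \<open>0 < K\<close> by simp
      then have "norm (y h - x') < r / 2"
        using W11_norm_diff_le_total[OF y(1), of 0 h] \<open>0 < h\<close> y(2) by simp
      then have "dist (y h) x < r"
        using x' dist_triangle[of "y h" x x'] by (simp add: dist_norm)
      then have "d < \<phi> (y h)" by (rule r)
      with y(3) show False
        by (metis add_increasing less_imp_le linorder_not_le zero_le)
    qed
  qed
qed

text \<open>Inside the cone the segment to \<open>x\<close> has speed at most \<open>c\<close> and
  hence costs \<open>O(h)\<close>, which gives the upper estimate; the lower one holds without a
  cone.\<close>

lemma value_initial_lim_cones: "initial_lim_cones \<phi> (value_real L \<phi>)"
  unfolding initial_lim_cones_def
proof (intro allI impI)
  fix x :: 'a and c :: real assume "0 < c"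
  let ?F = "inf (at_right 0 \<times>\<^sub>F nhds x) (principal {(h, y). norm (y - x) \<le> c * h})"
  show "((\<lambda>z. ennreal (value_real L \<phi> z)) \<longlongrightarrow> \<phi> x) ?F"
  proof (rule order_tendstoI)
    fix a assume "a < \<phi> x"
    then show "\<forall>\<^sub>F z in ?F. a < ennreal (value_real L \<phi> z)"
      using value_eventually_gt filter_leD[OF inf_le1] by blast
  next
    fix D assume "\<phi> x < D"
    then obtain D' where D': "\<phi> x < D'" "D' < D" using dense by blast
    then obtain d where d: "D' = ennreal d" "0 \<le> d" by (cases D') auto
    obtain f where f: "\<phi> x = ennreal f" "0 \<le> f" using D' by (cases "\<phi> x") auto
    have "f < d" using D' d f by (simp add: ennreal_less_iff)
    define R where "R = norm x + c"
    obtain C where C: "0 \<le> C" "\<And>x u. norm x \<le> R \<Longrightarrow> norm u \<le> R \<Longrightarrow> L x u \<le> C"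
      using L_boundedE[of R] by metis
    have 1: "\<forall>\<^sub>F h in at_right (0::real). h \<in> {0<..<min 1 ((d - f) / (C + 1))}"
      using C \<open>f < d\<close> by (intro eventually_at_right_real) auto
    show "\<forall>\<^sub>F z in ?F. ennreal (value_real L \<phi> z) < D"
      unfolding eventually_inf_principal
    proof (subst eventually_prod_filter, intro exI conjI allI impI, rule 1, rule eventually_True)
      fix h y assume h: "h \<in> {0<..<min 1 ((d - f) / (C + 1))}" and y: "(h, y) \<in> {(h, y). norm (y - x) \<le> c * h}"
      then have "0 < h" "h \<le> 1" by auto
      have "norm (y - x) \<le> c" using y \<open>h \<le> 1\<close> \<open>0 < c\<close> by (auto intro: order_trans mult_left_le)
      then have "norm y \<le> R" using norm_triangle_ineq2[of y x] by (simp add: R_def)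
      have "norm (x - y) \<le> R * h"
      proof -
        have "c * h \<le> R * h" using \<open>0 < h\<close> by (intro mult_right_mono) (auto simp: R_def)
        then show ?thesis using y by (simp add: norm_minus_commute)
      qed
      then have "trans_cost L h y x \<le> ennreal (C * h)"
        by (intro trans_cost_line[of R C]) (use C \<open>0 < h\<close> \<open>norm y \<le> R\<close> \<open>0 < c\<close> in \<open>auto simp: R_def\<close>)
      then have "value_fun L \<phi> h y \<le> ennreal (C * h) + ennreal f"
        using value_fun_le_trans_cost[of L \<phi> h y x] f(1) by (metis add_right_mono order_trans)
      also have "\<dots> = ennreal (C * h + f)" using C f \<open>0 < h\<close> by (subst ennreal_plus) auto
      also have "\<dots> \<le> D'"
      proof -
        have "C * h \<le> (C + 1) * h" using \<open>0 < h\<close> by simp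
        also have "\<dots> \<le> d - f" using h C(1) by (simp add: field_simps)
        finally show ?thesis unfolding d by (intro ennreal_leI) simp
      qed
      finally show "ennreal (value_real L \<phi> (h, y)) < D"
        using D'(2) \<open>0 < h\<close> by (simp add: value_fun_eq_ennreal)
    qed
  qed
qed

lemma value_initial_liminf: "initial_liminf \<phi> (value_real L \<phi>)"
  unfolding initial_liminf_def
proof (intro allI antisym)
  fix x :: 'a
  let ?V = "\<lambda>z. ennreal (value_real L \<phi> z)" and ?G = "at_right (0::real) \<times>\<^sub>F nhds x"
  let ?F = "inf ?G (principal {(h, y). norm (y - x) \<le> 1 * h})"
  show "\<phi> x \<le> Liminf ?G ?V"
    unfolding le_Liminf_iff using value_eventually_gt by blast
  \<comment> \<open>Over a trivial filter the lower limit would be \<open>top\<close>; the points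
    \<open>(h, x)\<close> show that the cone filter is proper.\<close>
  have "?F \<noteq> bot"
  proof
    assume "?F = bot"
    then have "\<forall>\<^sub>F z in ?G. z \<notin> {(h, y). norm (y - x) \<le> 1 * h}"
      using eventually_inf_principal[of "\<lambda>_. False" ?G "{(h, y). norm (y - x) \<le> 1 * h}"] by simp
    then obtain P Q where PQ: "eventually P (at_right (0::real))" "eventually Q (nhds x)"
      "\<And>h y. P h \<Longrightarrow> Q y \<Longrightarrow> (h, y) \<notin> {(h, y). norm (y - x) \<le> 1 * h}"
      unfolding eventually_prod_filter by blast
    have "\<forall>\<^sub>F h in at_right (0::real). P h \<and> h \<in> {0<..<1}"
      using PQ(1) eventually_at_right_real[of 0 "1::real"] by (simp add: eventually_conj_iff)
    then obtain h where "P h" "0 < h" using eventually_happens[of _ "at_right (0::real)"] by auto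
    moreover have "Q x" using PQ(2) by (rule eventually_nhds_x_imp_x)
    ultimately show False using PQ(3)[of h x] by auto
  qed
  moreover have "(?V \<longlongrightarrow> \<phi> x) ?F"
    using value_initial_lim_cones unfolding initial_lim_cones_def by (metis zero_less_one)
  ultimately have "Liminf ?F ?V = \<phi> x" by (rule lim_imp_Liminf)
  moreover have "Liminf ?G ?V \<le> Liminf ?F ?V"
    unfolding le_Liminf_iff using less_LiminfD filter_leD[OF inf_le1] by blast
  ultimately show "Liminf ?G ?V \<le> \<phi> x" by simp
qed

lemma value_admissible: "admissible \<phi> (value_real L \<phi>)"
  unfolding admissible_def
  using value_real_locally_Lipschitz value_initial_liminf value_initial_lim_cones
  by (auto simp: value_real_nonneg)

end

section \<open>Left differentiability almost everywhere\<close>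

text \<open>Outer regularity of the finite measure with density \<open>w\<close>, for which
  \<open>A\<close> is null. It serves twice: for sublevel sets in the differentiation theorem, and
  for the exceptional null set of a subsolution along a curve.\<close>

lemma open_superset_small_density:
  fixes w :: "real \<Rightarrow> real"
  assumes w: "integrable lborel w" "\<And>r. 0 \<le> w r"
    and A: "A \<in> sets borel" "AE r in lborel. r \<in> A \<longrightarrow> w r = 0" and "0 < e"
  obtains U where "open U" "A \<subseteq> U" "emeasure (density lborel (\<lambda>r. ennreal (w r))) U < ennreal e"
proof -
  let ?P = "density lborel (\<lambda>r. ennreal (w r))"
  have [measurable]: "w \<in> borel_measurable borel" using w by auto
  have "emeasure ?P (space ?P) \<noteq> \<infinity>"
    using w by (simp add: emeasure_density nn_integral_eq_integral)
  moreover have "emeasure ?P A = 0"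
  proof -
    have "(\<integral>\<^sup>+r. ennreal (w r) * indicator A r \<partial>lborel) = (\<integral>\<^sup>+(r::real). 0 \<partial>lborel)"
    proof (rule nn_integral_cong_AE)
      show "AE r in lborel. ennreal (w r) * indicator A r = 0"
        using A(2) by (rule AE_mp) (auto simp: indicator_def intro!: AE_I2)
    qed
    then show ?thesis using A(1) by (simp add: emeasure_density)
  qed
  ultimately have "(INF U \<in> {U. A \<subseteq> U \<and> open U}. emeasure ?P U) = 0"
    using outer_regular[of ?P A] A(1) by simp
  then have "(INF U \<in> {U. A \<subseteq> U \<and> open U}. emeasure ?P U) < ennreal e" using \<open>0 < e\<close> by simp
  then show thesis using that unfolding INF_less_iff by blast
qed

text \<open>An open set \<open>U\<close> around \<open>{f < \<alpha>}\<close> carries little of the mass of \<open>(f - \<alpha>)\<^sup>+\<close>, while disjoint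
  intervals on which the mean of \<open>f\<close> exceeds \<open>\<beta>\<close> carry at least \<open>\<beta> - \<alpha>\<close> times their length.\<close>

lemma negligible_upper_derivate_gap:
  fixes f :: "real \<Rightarrow> real"
  assumes f: "integrable lborel f" and "\<alpha> < \<beta>"
  shows "negligible {s \<in> {-n<..<n}. f s < \<alpha> \<and> (\<forall>d>0. \<exists>h. 0 < h \<and> h < d \<and> \<beta> * h < (LINT r:{s - h..s}|lborel. f r))}"
    (is "negligible ?E")
  unfolding negligible_outer_le
proof (intro allI impI)
  fix e :: real assume "0 < e"
  have [measurable]: "f \<in> borel_measurable borel" using f by auto
  define w where "w = (\<lambda>r. indicator {-n<..<n} r * max 0 (f r - \<alpha>))"
  have w0: "0 \<le> w r" for r by (simp add: w_def)
  have "integrable lborel (\<lambda>r. indicator {-n<..<n} r *\<^sub>R \<alpha>)"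
  proof (intro integrable_scaleR_left integrable_real_indicator)
    show "emeasure lborel {-n<..<n} < \<infinity>"
      by (rule emeasure_bounded_finite, rule bounded_subset[OF bounded_closed_interval[of "-n" n]]) auto
  qed auto
  then have "integrable lborel (\<lambda>r. \<bar>f r\<bar> + \<bar>indicator {-n<..<n} r *\<^sub>R \<alpha>\<bar>)"
    using f by (intro Bochner_Integration.integrable_add integrable_abs)
  then have w: "integrable lborel w"
    by (rule Bochner_Integration.integrable_bound) (auto simp: w_def indicator_def)
  then have [measurable]: "w \<in> borel_measurable borel" by auto
  let ?P = "density lborel (\<lambda>r. ennreal (w r))"
  obtain U0 where U0: "open U0" "{s \<in> {-n<..<n}. f s < \<alpha>} \<subseteq> U0" "emeasure ?P U0 < ennreal ((\<beta> - \<alpha>) * e)"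
  proof (rule open_superset_small_density[OF w w0])
    show "{s \<in> {-n<..<n}. f s < \<alpha>} \<in> sets borel" by measurable
    show "AE r in lborel. r \<in> {s \<in> {-n<..<n}. f s < \<alpha>} \<longrightarrow> w r = 0" by (auto simp: w_def)
    show "0 < (\<beta> - \<alpha>) * e" using assms \<open>0 < e\<close> by simp
  qed blast
  define U where "U = U0 \<inter> {-n<..<n}"
  have U: "open U" "?E \<subseteq> U" "U \<subseteq> {-n<..<n}" using U0 by (auto simp: U_def)
  define K where "K = {(s, h). 0 < h \<and> {s - h..s} \<subseteq> U \<and> \<beta> * h < (LINT r:{s - h..s}|lborel. f r)}"
  \<comment> \<open>\<open>{s - h..s}\<close> is written as the closed ball about its midpoint, so
    \<open>s\<close> lies on the boundary; the Vitali covering only requires that it belongs to the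
    ball.\<close>
  define a where "a = (\<lambda>(s, h). s - h / 2 :: real)"
  let ?r = "\<lambda>(s, h). h / 2 :: real"
  have I: "cball (a i) (?r i) = {fst i - snd i..fst i}" for i :: "real \<times> real"
    by (cases i) (simp add: a_def cball_eq_atLeastAtMost)
  obtain C where C: "countable C" "C \<subseteq> K"
    "pairwise (\<lambda>i j. disjnt (cball (a i) (?r i)) (cball (a j) (?r j))) C"
    "negligible (?E - (\<Union>i\<in>C. cball (a i) (?r i)))"
  proof (rule Vitali_covering_theorem_cballs[of K ?r ?E a])
    show "0 < ?r i" if "i \<in> K" for i using that by (auto simp: K_def)
    fix s d :: real assume s: "s \<in> ?E" and "0 < d"
    then have "s \<in> U" using U by auto
    then obtain \<epsilon> where \<epsilon>: "0 < \<epsilon>" "ball s \<epsilon> \<subseteq> U" using U(1) open_contains_ball by blast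
    then have "0 < min \<epsilon> d" using \<open>0 < d\<close> by simp
    then obtain h where h: "0 < h" "h < min \<epsilon> d" "\<beta> * h < (LINT r:{s - h..s}|lborel. f r)" using s by blast
    have "{s - h..s} \<subseteq> ball s \<epsilon>" using h by (auto simp: dist_real_def)
    with \<epsilon> h have "(s, h) \<in> K" by (auto simp: K_def)
    moreover have "s \<in> cball (a (s, h)) (?r (s, h))" unfolding I using h by simp
    ultimately show "\<exists>i. i \<in> K \<and> s \<in> cball (a i) (?r i) \<and> ?r i < d" using h by (intro exI[of _ "(s, h)"]) auto
  qed blast
  define J where "J = (\<Union>i\<in>C. cball (a i) (?r i))"
  have J[measurable]: "J \<in> sets borel" unfolding J_def using C(1) by (intro sets.countable_UN') auto
  have disj: "disjoint_family_on (\<lambda>i. cball (a i) (?r i)) C"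
    using C(3) by (auto simp: disjoint_family_on_def pairwise_def disjnt_def)
  have "ennreal (\<beta> - \<alpha>) * emeasure lborel J = ennreal (\<beta> - \<alpha>) * (\<integral>\<^sup>+i. emeasure lborel (cball (a i) (?r i)) \<partial>count_space C)"
    unfolding J_def using C(1) disj by (subst emeasure_UN_countable) auto
  also have "\<dots> = (\<integral>\<^sup>+i. ennreal (\<beta> - \<alpha>) * emeasure lborel (cball (a i) (?r i)) \<partial>count_space C)"
    by (subst nn_integral_cmult) auto
  also have "\<dots> \<le> (\<integral>\<^sup>+i. emeasure ?P (cball (a i) (?r i)) \<partial>count_space C)"
  proof (rule nn_integral_mono, simp only: space_count_space)
    fix i assume "i \<in> C"
    then obtain s h where i: "i = (s, h)" "0 < h" "{s - h..s} \<subseteq> U" "\<beta> * h < (LINT r:{s - h..s}|lborel. f r)"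
      using C(2) by (auto simp: K_def)
    have fI: "set_integrable lborel {s - h..s} f"
      using f unfolding set_integrable_def by (intro integrable_mult_indicator) auto
    have wI: "set_integrable lborel {s - h..s} w"
      using w unfolding set_integrable_def by (intro integrable_mult_indicator) auto
    have cI: "set_integrable lborel {s - h..s} (\<lambda>r. \<alpha>)"
      by (rule set_integrable_const_Icc)
    have "(\<beta> - \<alpha>) * h \<le> (LINT r:{s - h..s}|lborel. f r) - \<alpha> * h" using i by (simp add: algebra_simps)
    also have "\<dots> = (LINT r:{s - h..s}|lborel. f r - \<alpha>)"
    proof -
      have "(LINT r:{s - h..s}|lborel. \<alpha>) = \<alpha> * h" using i by (simp add: set_lebesgue_integral_def)
      then show ?thesis using set_integral_diff(2)[OF fI cI] by simp
    qed
    also have "\<dots> \<le> (LINT r:{s - h..s}|lborel. w r)"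
    proof (rule set_integral_mono[OF set_integral_diff(1)[OF fI cI] wI])
      fix r assume "r \<in> {s - h..s}"
      then have "r \<in> {-n<..<n}" using i U by blast
      then show "f r - \<alpha> \<le> w r" by (simp add: w_def)
    qed
    finally have *: "(\<beta> - \<alpha>) * h \<le> (LINT r:{s - h..s}|lborel. w r)" .
    have "emeasure ?P {s - h..s} = (\<integral>\<^sup>+r. ennreal (indicator {s - h..s} r *\<^sub>R w r) \<partial>lborel)"
      by (subst emeasure_density) (auto intro!: nn_integral_cong simp: indicator_def)
    also have "\<dots> = ennreal (LINT r:{s - h..s}|lborel. w r)"
      unfolding set_lebesgue_integral_def using wI w0
      by (intro nn_integral_eq_integral) (auto simp: set_integrable_def)
    finally have "ennreal ((\<beta> - \<alpha>) * h) \<le> emeasure ?P {s - h..s}" using * by (simp add: ennreal_leI)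
    then show "ennreal (\<beta> - \<alpha>) * emeasure lborel (cball (a i) (?r i)) \<le> emeasure ?P (cball (a i) (?r i))"
      unfolding I using i assms(2) by (simp add: ennreal_mult)
  qed
  also have "\<dots> = emeasure ?P J"
    unfolding J_def using C(1) disj by (intro emeasure_UN_countable[symmetric]) auto
  also have "\<dots> \<le> emeasure ?P U0"
  proof (rule emeasure_mono)
    have "cball (a i) (?r i) \<subseteq> U0" if "i \<in> C" for i
    proof -
      have "i \<in> K" using that C(2) by blast
      then show ?thesis unfolding I by (cases i) (simp add: K_def U_def)
    qed
    then show "J \<subseteq> U0" unfolding J_def by blast
  qed (use U0 in auto)
  also have "\<dots> \<le> ennreal (\<beta> - \<alpha>) * ennreal e" using U0(3) assms(2) \<open>0 < e\<close> by (simp add: ennreal_mult)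
  finally have mJ: "emeasure lborel J \<le> ennreal e"
    using assms(2) by (simp add: ennreal_mult_le_mult_iff)
  have Jm: "J \<in> lmeasurable"
    using mJ J by (intro fmeasurableI) (auto simp: less_top[symmetric] top_unique emeasure_completion main_part_sets dest: order.trans)
  have N: "negligible (?E - J)" using C(4) by (simp add: J_def)
  show "\<exists>T. ?E \<subseteq> T \<and> T \<in> lmeasurable \<and> measure lebesgue T \<le> e"
  proof (intro exI conjI)
    show "?E \<subseteq> J \<union> (?E - J)" by blast
    show "J \<union> (?E - J) \<in> lmeasurable"
      using Jm N by (intro fmeasurable.Un) (auto simp: negligible_imp_measurable)
    have "measure lebesgue (J \<union> (?E - J)) = measure lebesgue J"
      using N Jm by (intro measure_Un_null_set) (auto simp: negligible_iff_null_sets)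
    also have "\<dots> \<le> e" using mJ \<open>0 < e\<close>
      by (simp add: measure_def enn2real_leI)
    finally show "measure lebesgue (J \<union> (?E - J)) \<le> e" .
  qed
qed

text \<open>Rational levels \<open>p < q\<close> and natural numbers \<open>n\<close> leave
  countably many exceptional sets; the estimate from below is the one from above for
  \<open>- f\<close>.\<close>

lemma AE_left_derivative_real:
  fixes f :: "real \<Rightarrow> real"
  assumes f: "integrable lborel f"
  shows "AE s in lborel. ((\<lambda>h. (LINT r:{s - h..s}|lborel. f r) / h) \<longlongrightarrow> f s) (at_right 0)"
proof -
  define E where "E f \<alpha> \<beta> n = {s \<in> {-n<..<n}. f s < \<alpha> \<and> (\<forall>d>0. \<exists>h. 0 < h \<and> h < d \<and> \<beta> * h < (LINT r:{s - h..s}|lborel. f r))}"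
    for f :: "real \<Rightarrow> real" and \<alpha> \<beta> n :: real
  have *: "AE s in lborel. \<forall>n::nat. \<forall>p\<in>\<rat>. \<forall>q\<in>\<rat>. p < q \<longrightarrow> s \<notin> E f p q (real n)" if "integrable lborel f" for f
  proof -
    have "AE s in lborel. s \<notin> E f p q (real n)" if "p < q" for p q n
    proof -
      have "E f p q (real n) \<in> null_sets lebesgue"
        using negligible_upper_derivate_gap[OF \<open>integrable lborel f\<close> that, of n]
        by (simp add: E_def negligible_iff_null_sets)
      from AE_not_in[OF this] show ?thesis by (simp add: AE_completion_iff)
    qed
    then show ?thesis
      by (intro AE_all_countable[THEN iffD2] allI AE_ball_countable[THEN iffD2] ballI countable_rat) auto
  qed
  have up: "\<forall>\<^sub>F h in at_right 0. (LINT r:{s - h..s}|lborel. f r) / h < c"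
    if s: "\<forall>n::nat. \<forall>p\<in>\<rat>. \<forall>q\<in>\<rat>. p < q \<longrightarrow> s \<notin> E f p q (real n)" and "f s < c" for s c f
  proof -
    obtain p where p: "p \<in> \<rat>" "f s < p" "p < c" using Rats_dense_in_real[OF \<open>f s < c\<close>] by blast
    obtain q where q: "q \<in> \<rat>" "p < q" "q < c" using Rats_dense_in_real[OF p(3)] by blast
    obtain n :: nat where "\<bar>s\<bar> < real n" using reals_Archimedean2 by blast
    then have "s \<in> {- real n<..<real n}" by auto
    moreover have "s \<notin> E f p q (real n)" using s p(1) q(1,2) by blast
    ultimately have "\<not> (\<forall>d>0. \<exists>h. 0 < h \<and> h < d \<and> q * h < (LINT r:{s - h..s}|lborel. f r))"
      using p(2) unfolding E_def by blast
    then obtain d where d: "0 < d" "\<And>h. 0 < h \<Longrightarrow> h < d \<Longrightarrow> (LINT r:{s - h..s}|lborel. f r) \<le> q * h"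
      by (metis not_less)
    have "\<forall>\<^sub>F h in at_right 0. h \<in> {0<..<d}" using d by (intro eventually_at_right_real)
    then show ?thesis
    proof eventually_elim
      case (elim h)
      then have "(LINT r:{s - h..s}|lborel. f r) \<le> q * h" by (intro d) auto
      also have "\<dots> < c * h" using q elim by (intro mult_strict_right_mono) auto
      finally show ?case using elim by (simp add: pos_divide_less_eq)
    qed
  qed
  from *[OF f] *[OF Bochner_Integration.integrable_minus[OF f]] show ?thesis
  proof eventually_elim
    case (elim s)
    show ?case
    proof (rule order_tendstoI)
      fix c assume "c < f s"
      then have "- f s < - c" by simp
      from up[OF elim(2) this]
      have "\<forall>\<^sub>F h in at_right 0. (LINT r:{s - h..s}|lborel. - f r) / h < - c" .
      then show "\<forall>\<^sub>F h in at_right 0. c < (LINT r:{s - h..s}|lborel. f r) / h"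
        by eventually_elim (simp add: set_lebesgue_integral_def)
    qed (rule up[OF elim(1)])
  qed
qed

lemma AE_left_derivative:
  fixes f :: "real \<Rightarrow> 'a::euclidean_space"
  assumes f: "set_integrable lborel {a..b} f"
  shows "AE s in lborel. s \<in> {a<..b} \<longrightarrow>
    ((\<lambda>h. (1 / h) *\<^sub>R (LINT r:{s - h..s}|lborel. f r)) \<longlongrightarrow> f s) (at_right 0)"
proof -
  define F where "F i = (\<lambda>r. (indicator {a..b} r *\<^sub>R f r) \<bullet> i)" for i
  have "AE s in lborel. \<forall>i\<in>Basis. ((\<lambda>h. (LINT r:{s - h..s}|lborel. F i r) / h) \<longlongrightarrow> F i s) (at_right 0)"
    using f unfolding F_def set_integrable_def
    by (intro AE_finite_allI AE_left_derivative_real finite_Basis integrable_inner_left)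
  then show ?thesis
  proof (eventually_elim, intro impI)
    fix s assume s: "\<forall>i\<in>Basis. ((\<lambda>h. (LINT r:{s - h..s}|lborel. F i r) / h) \<longlongrightarrow> F i s) (at_right 0)"
      and "s \<in> {a<..b}"
    show "((\<lambda>h. (1 / h) *\<^sub>R (LINT r:{s - h..s}|lborel. f r)) \<longlongrightarrow> f s) (at_right 0)"
    proof (subst tendsto_componentwise_iff, intro ballI)
      fix i :: 'a assume "i \<in> Basis"
      have "((\<lambda>h. (LINT r:{s - h..s}|lborel. F i r) / h) \<longlongrightarrow> f s \<bullet> i) (at_right 0)"
        using s \<open>i \<in> Basis\<close> \<open>s \<in> {a<..b}\<close> by (auto simp: F_def)
      moreover have "\<forall>\<^sub>F h in at_right 0. h \<in> {0<..<s - a}"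
        using \<open>s \<in> {a<..b}\<close> by (intro eventually_at_right_real) auto
      then have "\<forall>\<^sub>F h in at_right 0. (LINT r:{s - h..s}|lborel. F i r) / h =
          ((1 / h) *\<^sub>R (LINT r:{s - h..s}|lborel. f r)) \<bullet> i"
      proof eventually_elim
        case (elim h)
        have fI: "set_integrable lborel {s - h..s} f"
          by (rule set_integrable_subset[OF f]) (use elim \<open>s \<in> {a<..b}\<close> in auto)
        have "(LINT r:{s - h..s}|lborel. F i r) = (LINT r:{s - h..s}|lborel. i \<bullet> f r)"
          by (rule set_lebesgue_integral_cong)
             (use elim \<open>s \<in> {a<..b}\<close> in \<open>auto simp: F_def inner_commute\<close>)
        also have "\<dots> = i \<bullet> (LINT r:{s - h..s}|lborel. f r)" by (rule set_integral_inner(2)[OF fI])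
        finally show ?case by (simp add: inner_commute)
      qed
      ultimately show "((\<lambda>h. ((1 / h) *\<^sub>R (LINT r:{s - h..s}|lborel. f r)) \<bullet> i) \<longlongrightarrow> f s \<bullet> i) (at_right 0)"
        by (rule Lim_transform_eventually)
    qed
  qed
qed

text \<open>The least point of the compact set where \<open>K\<close> does not exceed
  \<open>K b\<close> can only be \<open>a\<close>, since from any other point the hypothesis leads
  further left inside the set. Almost every \<open>s\<close> would not be enough, as minus the
  Cantor function shows; hence the correction term in the application to subsolutions.\<close>

lemma le_if_locally_increasing_from_left:
  fixes K :: "real \<Rightarrow> real"
  assumes "a \<le> b" "continuous_on {a..b} K"
    and loc: "\<And>s. a < s \<Longrightarrow> s \<le> b \<Longrightarrow> \<forall>\<^sub>F h in at_right 0. K (s - h) \<le> K s"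
  shows "K a \<le> K b"
proof -
  let ?S = "{s \<in> {a..b}. K s \<le> K b}"
  have "?S = {a..b} \<inter> K -` {..K b}" by auto
  then have "compact ?S"
    using continuous_closed_preimage[OF assms(2), of "{..K b}"]
    by (auto simp: compact_eq_bounded_closed intro: bounded_subset[OF bounded_closed_interval[of a b]])
  then obtain s where s: "s \<in> ?S" "\<And>r. r \<in> ?S \<Longrightarrow> s \<le> r"
    using compact_attains_inf[of ?S] assms(1) by force
  have "s = a"
  proof (rule ccontr)
    assume "s \<noteq> a"
    then have "\<forall>\<^sub>F h in at_right 0. h \<in> {0<..<s - a}" using s by (intro eventually_at_right_real) auto
    then have "\<forall>\<^sub>F h in at_right 0. h \<in> {0<..<s - a} \<and> K (s - h) \<le> K s"
      using s \<open>s \<noteq> a\<close> by (intro eventually_conj loc) auto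
    then obtain h where "h \<in> {0<..<s - a}" "K (s - h) \<le> K s"
      using eventually_happens[of _ "at_right (0::real)"] by auto
    then show False using s(1) s(2)[of "s - h"] by auto
  qed
  with s show ?thesis by simp
qed

section \<open>Uniformity of local Lipschitz bounds\<close>

lemma locally_Lipschitz_on_isCont:
  fixes f :: "'a::metric_space \<Rightarrow> 'b::metric_space"
  assumes f: "locally_Lipschitz_on S f" and "open S" "z \<in> S"
  shows "isCont f z"
proof -
  obtain r C where r: "0 < r" "C-lipschitz_on (ball z r \<inter> S) f"
    using f \<open>z \<in> S\<close> unfolding locally_Lipschitz_on_def by blast
  have "open (ball z r \<inter> S)" using \<open>open S\<close> by (intro open_Int) auto
  then show ?thesis
    using lipschitz_on_continuous_on[OF r(2)] r(1) \<open>z \<in> S\<close> by (simp add: continuous_on_eq_continuous_at)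
qed

lemma open_pos_times: "open (pos_times :: (real \<times> 'a::euclidean_space) set)"
  unfolding pos_times_def by (intro open_Times) auto

text \<open>A Lebesgue number of a finite subcover provides the common radius, and the sum of the
  finitely many constants a common constant.\<close>

lemma locally_Lipschitz_on_compact:
  fixes f :: "'a::metric_space \<Rightarrow> 'b::metric_space"
  assumes f: "locally_Lipschitz_on S f" and "open S" "compact K" "K \<subseteq> S"
  obtains r C where "0 < r" "0 \<le> C" "\<And>z. z \<in> K \<Longrightarrow> cball z r \<subseteq> S" "\<And>z. z \<in> K \<Longrightarrow> C-lipschitz_on (cball z r) f"
proof -
  have "\<exists>r C. 0 < r \<and> ball z r \<subseteq> S \<and> C-lipschitz_on (ball z r) f" if "z \<in> K" for z
  proof -
    have "z \<in> S" using that assms by auto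
    then obtain r C where r: "0 < r" "C-lipschitz_on (ball z r \<inter> S) f"
      using f unfolding locally_Lipschitz_on_def by blast
    obtain e where e: "0 < e" "ball z e \<subseteq> S" using \<open>open S\<close> \<open>z \<in> S\<close> open_contains_ball by blast
    have "C-lipschitz_on (ball z (min r e)) f"
      using r(2) by (rule lipschitz_on_subset) (use e in auto)
    with r e show ?thesis by (intro exI[of _ "min r e"] exI[of _ C]) auto
  qed
  then obtain r C where rC: "\<And>z. z \<in> K \<Longrightarrow> 0 < r z" "\<And>z. z \<in> K \<Longrightarrow> ball z (r z) \<subseteq> S"
    "\<And>z. z \<in> K \<Longrightarrow> (C z)-lipschitz_on (ball z (r z)) f" by metis
  obtain D where D: "D \<subseteq> K" "finite D" "K \<subseteq> (\<Union>z\<in>D. ball z (r z))"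
    by (rule compactE_image[OF \<open>compact K\<close>, of K "\<lambda>z. ball z (r z)"]) (use rC(1) in force)+
  obtain e where e: "0 < e" "\<And>x. x \<in> K \<Longrightarrow> \<exists>G\<in>(\<lambda>z. ball z (r z)) ` D. ball x e \<subseteq> G"
    by (rule Heine_Borel_lemma[OF \<open>compact K\<close>, of "(\<lambda>z. ball z (r z)) ` D"]) (use D in auto)
  define M where "M = (\<Sum>z\<in>D. \<bar>C z\<bar>)"
  have *: "cball x (e / 2) \<subseteq> S \<and> M-lipschitz_on (cball x (e / 2)) f" if x: "x \<in> K" for x
  proof -
    obtain z where z: "z \<in> D" "ball x e \<subseteq> ball z (r z)" using e(2)[OF x] by auto
    then have sub: "cball x (e / 2) \<subseteq> ball z (r z)" using e(1) by (force simp: subset_iff)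
    have "\<bar>C z\<bar> \<le> M" unfolding M_def using z D(2) by (intro member_le_sum) auto
    then have "C z \<le> M" by simp
    have "z \<in> K" using z D by auto
    have "M-lipschitz_on (ball z (r z)) f"
      using rC(3)[OF \<open>z \<in> K\<close>] \<open>C z \<le> M\<close> by (rule lipschitz_on_le)
    with sub rC(2)[OF \<open>z \<in> K\<close>] show ?thesis by (auto intro: lipschitz_on_subset)
  qed
  have "0 \<le> M" unfolding M_def by (intro sum_nonneg) auto
  with e(1) * show thesis by (intro that[of "e / 2" M]) auto
qed

section \<open>Subsolutions\<close>

context tonelli_lagrangian
begin

text \<open>The curve passes within \<open>o(h)\<close> of \<open>y s - h *\<^sub>R u\<close>,
  whereas \<open>L_plus\<close> demands a start exactly there. So a fraction \<open>\<delta>\<close>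
  of the time is spent on a segment from that point to \<open>y (s - k)\<close> with
  \<open>k = (1 - \<delta>) * h\<close>: the distance is at most
  \<open>\<delta> * h * (norm u + 1)\<close>, so the speed is bounded and the cost is at most
  \<open>C * (\<delta> * h)\<close>. From there on the curve itself is followed.\<close>

lemma L_plus_le_left_mean:
  assumes y: "W11 a b y g" and s: "a < s" "s \<le> b" and fin: "cost L a b y g < \<infinity>"
    and u: "((\<lambda>h. (1 / h) *\<^sub>R (y s - y (s - h))) \<longlongrightarrow> u) (at_right 0)"
    and l: "((\<lambda>h. (LINT r:{s - h..s}|lborel. L (y r) (g r)) / h) \<longlongrightarrow> l) (at_right 0)"
  shows "L_plus L (y s) u \<le> ennreal l"
proof (rule ennreal_le_epsilon)
  fix e :: real assume "0 < e"
  let ?Ly = "\<lambda>r. L (y r) (g r)"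
  note I = cost_eq_set_integral(1)[OF y fin]
  define R where "R = norm (y s) + norm u + 2"
  obtain C where C: "0 \<le> C" "\<And>x v. norm x \<le> R \<Longrightarrow> norm v \<le> R \<Longrightarrow> L x v \<le> C"
    using L_boundedE[of R] by metis
  define \<delta> where "\<delta> = min (1 / 2) (e / (2 * (C + 1)))"
  have \<delta>: "0 < \<delta>" "\<delta> < 1" using \<open>0 < e\<close> C by (auto simp: \<delta>_def)
  have C\<delta>: "C * \<delta> \<le> e / 2"
  proof -
    have "C * \<delta> \<le> (C + 1) * (e / (2 * (C + 1)))" using C(1) \<delta> by (intro mult_mono) (auto simp: \<delta>_def)
    also have "\<dots> = e / 2" using C(1) by (simp add: divide_simps) (simp add: algebra_simps)?
    finally show ?thesis .
  qed
  have "\<forall>\<^sub>F h in at_right 0. dist ((1 / h) *\<^sub>R (y s - y (s - h))) u < \<delta>"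
    using u \<delta>(1) by (rule tendstoD)
  then obtain k0 where k0: "0 < k0" "\<And>k. 0 < k \<Longrightarrow> k < k0 \<Longrightarrow> dist ((1 / k) *\<^sub>R (y s - y (s - k))) u < \<delta>"
    unfolding eventually_at_right_field by auto
  have "\<forall>\<^sub>F h in at_right 0. (LINT r:{s - h..s}|lborel. ?Ly r) / h < l + e / 2"
    using l \<open>0 < e\<close> by (intro order_tendstoD(2)) auto
  moreover have "\<forall>\<^sub>F h in at_right (0::real). h \<in> {0<..<min (min k0 1) (s - a)}"
    using k0(1) s by (intro eventually_at_right_real) auto
  ultimately have "\<forall>\<^sub>F h in at_right 0. ennreal (1 / h) * trans_cost L h (y s - h *\<^sub>R u) (y s) \<le> ennreal (l + e)"
  proof eventually_elim
    case (elim h)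
    then have h: "0 < h" "h < k0" "h \<le> 1" "h < s - a" by auto
    define k where "k = (1 - \<delta>) * h"
    have k: "0 < k" "k < h" "h - k = \<delta> * h" using \<delta> h by (auto simp: k_def algebra_simps)
    have err: "norm (y s - y (s - k) - k *\<^sub>R u) \<le> k * \<delta>"
    proof -
      have "y s - y (s - k) - k *\<^sub>R u = k *\<^sub>R ((1 / k) *\<^sub>R (y s - y (s - k)) - u)"
        using k by (simp add: algebra_simps)
      then have "norm (y s - y (s - k) - k *\<^sub>R u) = k * norm ((1 / k) *\<^sub>R (y s - y (s - k)) - u)"
        by (simp only: norm_scaleR abs_of_pos[OF k(1)])
      also have "\<dots> \<le> k * \<delta>"
        using k0(2)[of k] k h by (intro mult_left_mono) (auto simp: dist_norm)
      finally show ?thesis .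
    qed
    have kd: "k * \<delta> \<le> \<delta> * h" "k * \<delta> \<le> 1" using k \<delta> h by (auto intro!: mult_le_one)
    have "trans_cost L (\<delta> * h) (y s - h *\<^sub>R u) (y (s - k)) \<le> ennreal (C * (\<delta> * h))"
    proof (rule trans_cost_line[of R C])
      show "norm (y s - h *\<^sub>R u) \<le> R"
      proof -
        have "norm (h *\<^sub>R u) \<le> 1 * norm u" using h by (simp only: norm_scaleR, intro mult_right_mono) auto
        then show ?thesis using norm_triangle_ineq4[of "y s" "h *\<^sub>R u"] by (simp add: R_def)
      qed
      show "norm (y (s - k)) \<le> R"
      proof -
        have "norm (k *\<^sub>R u) \<le> 1 * norm u" using h k by (simp only: norm_scaleR, intro mult_right_mono) auto
        moreover have "y (s - k) = y s - k *\<^sub>R u - (y s - y (s - k) - k *\<^sub>R u)" by simp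
        then have "norm (y (s - k)) \<le> norm (y s) + norm (k *\<^sub>R u) + norm (y s - y (s - k) - k *\<^sub>R u)"
          by (metis norm_triangle_le_diff norm_triangle_ineq4 add_right_mono order_trans)
        ultimately show ?thesis using err kd unfolding R_def by linarith
      qed
      show "norm (y (s - k) - (y s - h *\<^sub>R u)) \<le> R * (\<delta> * h)"
      proof -
        have "y (s - k) - (y s - h *\<^sub>R u) = (h - k) *\<^sub>R u - (y s - y (s - k) - k *\<^sub>R u)"
          by (simp add: algebra_simps)
        then have "norm (y (s - k) - (y s - h *\<^sub>R u)) \<le> norm ((h - k) *\<^sub>R u) + norm (y s - y (s - k) - k *\<^sub>R u)"
          by (metis norm_triangle_ineq4)
        also have "norm ((h - k) *\<^sub>R u) = \<delta> * h * norm u" using k by simp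
        also have "\<delta> * h * norm u + norm (y s - y (s - k) - k *\<^sub>R u) \<le> \<delta> * h * norm u + \<delta> * h * 1"
          using err kd by linarith
        also have "\<dots> = (\<delta> * h) * (norm u + 1)" by (simp add: algebra_simps)
        also have "\<dots> \<le> (\<delta> * h) * R" using \<delta> h by (intro mult_left_mono) (auto simp: R_def)
        finally show ?thesis by (simp add: mult.commute)
      qed
    qed (use C \<delta> h in \<open>auto simp: R_def\<close>)
    moreover have "trans_cost L k (y (s - k)) (y s) \<le> ennreal (LINT r:{s - h..s}|lborel. ?Ly r)"
    proof -
      have W: "W11 (s - h) s y g" by (rule W11_subinterval[OF y]) (use h s in auto)
      have "trans_cost L (s - (s - k)) (y (s - k)) (y s) \<le> cost L (s - k) s y g"
        by (rule trans_cost_le_cost) (rule W11_subinterval[OF W], use k in auto)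
      also have "\<dots> \<le> cost L (s - h) s y g" using k by (intro cost_mono) auto
      also have "\<dots> = ennreal (LINT r:{s - h..s}|lborel. ?Ly r)"
      proof (rule cost_eq_set_integral(2)[OF W])
        have "cost L (s - h) s y g \<le> cost L a b y g" using h s by (intro cost_mono) auto
        then show "cost L (s - h) s y g < \<infinity>" using fin by (rule le_less_trans)
      qed
      finally show ?thesis by simp
    qed
    moreover have "h = \<delta> * h + k" using k by simp
    ultimately have "trans_cost L h (y s - h *\<^sub>R u) (y s)
        \<le> ennreal (C * (\<delta> * h)) + ennreal (LINT r:{s - h..s}|lborel. ?Ly r)"
      using trans_cost_triangle[of "\<delta> * h" k "y s - h *\<^sub>R u" "y s" "y (s - k)"] \<delta> h k
      by (smt (verit, best) add_mono mult_nonneg_nonneg order_trans)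
    also have "\<dots> = ennreal (C * (\<delta> * h) + (LINT r:{s - h..s}|lborel. ?Ly r))"
      using C(1) \<delta> h unfolding set_lebesgue_integral_def
      by (subst ennreal_plus) (auto intro!: Bochner_Integration.integral_nonneg simp: L_nonneg)
    also have "\<dots> \<le> ennreal (h * (l + e))"
    proof (rule ennreal_leI)
      have "(LINT r:{s - h..s}|lborel. ?Ly r) \<le> (l + e / 2) * h"
        using elim(1) h by (simp add: pos_divide_less_eq)
      moreover have "h * (C * \<delta>) \<le> h * (e / 2)" using C\<delta> h by (intro mult_left_mono) auto
      ultimately show "C * (\<delta> * h) + (LINT r:{s - h..s}|lborel. ?Ly r) \<le> h * (l + e)"
        by (simp add: algebra_simps)
    qed
    finally have "ennreal (1 / h) * trans_cost L h (y s - h *\<^sub>R u) (y s) \<le> ennreal (1 / h) * ennreal (h * (l + e))"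
      by (rule mult_left_mono) simp
    also have "\<dots> = ennreal (l + e)"
      using h by (simp add: ennreal_mult'[symmetric])
    finally show ?case .
  qed
  then have "L_plus L (y s) u \<le> ennreal (l + e)"
    unfolding L_plus_eq by (rule Limsup_bounded)
  also have "\<dots> \<le> ennreal l + ennreal e"
    using \<open>0 < e\<close> by (cases "0 \<le> l") (auto simp: ennreal_neg intro!: ennreal_leI)
  finally show "L_plus L (y s) u \<le> ennreal l + ennreal e" .
qed

text \<open>The upper derivative is an upper limit over directions as well, so the difference
  quotient of the curve, which tends to \<open>- u\<close>, may be inserted as the
  direction.\<close>

lemma upper_derivative_curve:
  assumes y: "((\<lambda>h. (1 / h) *\<^sub>R (y s - y (s - h))) \<longlongrightarrow> u) (at_right 0)"
    and "upper_derivative W (t, y s) (1, - u) < ereal c"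
  shows "\<forall>\<^sub>F h in at_right 0. W (t + h, y (s - h)) \<le> W (t, y s) + c * h"
proof -
  let ?d = "\<lambda>h. (1 :: real, (1 / h) *\<^sub>R (y (s - h) - y s))"
  have "((\<lambda>h. - ((1 / h) *\<^sub>R (y s - y (s - h)))) \<longlongrightarrow> - u) (at_right 0)"
    using y by (rule tendsto_minus)
  then have "((\<lambda>h. (1 / h) *\<^sub>R (y (s - h) - y s)) \<longlongrightarrow> - u) (at_right 0)"
    by (simp add: scaleR_diff_right)
  then have "(?d \<longlongrightarrow> (1, - u)) (at_right 0)" by (intro tendsto_Pair tendsto_const)
  then have lim: "filterlim (\<lambda>h. (h, ?d h)) (at_right 0 \<times>\<^sub>F nhds (1, - u)) (at_right 0)"
    by (intro filterlim_Pair filterlim_ident)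
  have "\<forall>\<^sub>F p in at_right 0 \<times>\<^sub>F nhds (1, - u).
      (case p of (h, d') \<Rightarrow> ereal ((W ((t, y s) + h *\<^sub>R d') - W (t, y s)) / h)) < ereal c"
    using assms(2) unfolding upper_derivative_def by (rule Limsup_lessD)
  from eventually_compose_filterlim[OF this lim]
  have "\<forall>\<^sub>F h in at_right 0. (W ((t, y s) + h *\<^sub>R ?d h) - W (t, y s)) / h < c" by simp
  moreover have "\<forall>\<^sub>F h in at_right (0::real). h \<in> {0<..<1}" by (intro eventually_at_right_real) auto
  ultimately show ?thesis
  proof eventually_elim
    case (elim h)
    then have "(t, y s) + h *\<^sub>R ?d h = (t + h, y (s - h))" by (simp add: algebra_simps)
    with elim show ?case by (simp add: pos_divide_less_eq)
  qed
qed

text \<open>The differential inequality is available at almost every time only. At every time,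
  however, \<open>W\<close> changes along the curve at most at the integrable rate \<open>G\<close>.
  Adding the integral of \<open>G\<close> over a small open neighbourhood \<open>U\<close> of the
  exceptional set makes the total \<open>F\<close> increase from the left at every point, at a total
  expense of at most \<open>e\<close>.\<close>

lemma subsolution_along_curve:
  assumes sub: "HJ_sub L W" and lip: "locally_Lipschitz_on pos_times W"
    and y: "W11 0 b y g" and fin: "cost L 0 b y g < \<infinity>" and "0 \<le> b" "0 < t"
  shows "W (t + b, y 0) \<le> W (t, y b) + (LINT r:{0..b}|lborel. L (y r) (g r))"
proof -
  let ?Ly = "\<lambda>r. L (y r) (g r)"
  note I = cost_eq_set_integral(1)[OF y fin]
  note gI = W11_integrable[OF y]
  note yc = W11_continuous_on[OF y]
  define z where "z s = (t + b - s, y s)" for s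
  have zc: "continuous_on {0..b} z" unfolding z_def by (intro continuous_intros yc)
  note op = open_pos_times[where 'a = 'a]
  have "z ` {0..b} \<subseteq> pos_times" using \<open>0 < t\<close> by (auto simp: z_def pos_times_def)
  then obtain r C where r: "0 < r" "0 \<le> C" "\<And>p. p \<in> z ` {0..b} \<Longrightarrow> C-lipschitz_on (cball p r) W"
    using locally_Lipschitz_on_compact[OF lip op compact_continuous_image[OF zc compact_Icc]] by metis
  define G where "G = (\<lambda>s. C * (1 + norm (g s)))"
  have G0: "0 \<le> G s" for s using r by (simp add: G_def)
  have GI: "set_integrable lborel {0..b} G"
    unfolding G_def using set_integrable_const_Icc gI by (intro set_integrable_mult_right set_integral_add(1) set_integrable_norm)
  have zclose: "\<forall>\<^sub>F h in at_right 0. h \<in> {0<..<s} \<and> z (s - h) \<in> cball (z s) r" if s: "0 < s" "s \<le> b" for s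
  proof -
    have "(z \<longlongrightarrow> z s) (at s within {0..b})" using zc s unfolding continuous_on_def by auto
    then have "\<forall>\<^sub>F s' in at s within {0..b}. dist (z s') (z s) < r" using r(1) by (rule tendstoD)
    then obtain d where d: "0 < d" "\<And>s'. s' \<in> {0..b} \<Longrightarrow> s' \<noteq> s \<Longrightarrow> dist s' s < d \<Longrightarrow> dist (z s') (z s) < r"
      unfolding eventually_at by blast
    have "\<forall>\<^sub>F h in at_right 0. h \<in> {0<..<min d s}" using d s by (intro eventually_at_right_real) auto
    then show ?thesis
    proof eventually_elim
      case (elim h)
      then show ?case using d(2)[of "s - h"] s by (auto simp: dist_real_def dist_commute less_imp_le)
    qed
  qed
  have ineq: "W (z (s - h)) \<le> W (z s) + (LINT r:{s - h..s}|lborel. G r)"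
    if s: "0 < s" "s \<le> b" "h \<in> {0<..<s}" "z (s - h) \<in> cball (z s) r" for s h
  proof -
    have "dist (W (z (s - h))) (W (z s)) \<le> C * dist (z (s - h)) (z s)"
      using s r by (intro lipschitz_onD[OF r(3)[of "z s"]]) auto
    also have "dist (z (s - h)) (z s) \<le> h + (LINT r:{s - h..s}|lborel. norm (g r))"
    proof -
      have "norm (z (s - h) - z s) \<le> norm h + norm (y (s - h) - y s)"
        using norm_Pair_le[of h "y (s - h) - y s"] by (simp add: z_def)
      moreover have "norm (y s - y (s - h)) \<le> (LINT r:{s - h..s}|lborel. norm (g r))"
        using s by (intro W11_norm_diff_le[OF y]) auto
      ultimately show ?thesis using s by (simp add: dist_norm norm_minus_commute)
    qed
    also have "C * (h + (LINT r:{s - h..s}|lborel. norm (g r))) = (LINT r:{s - h..s}|lborel. G r)"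
    proof -
      have gI': "set_integrable lborel {s - h..s} (\<lambda>r. norm (g r))"
        by (rule set_integrable_subset[OF set_integrable_norm[OF gI]]) (use s in auto)
      have "(LINT r:{s - h..s}|lborel. 1 + norm (g r)) = h + (LINT r:{s - h..s}|lborel. norm (g r))"
        using s by (subst set_integral_add(2)[OF set_integrable_const_Icc gI']) (simp add: set_lebesgue_integral_def)
      then show ?thesis by (simp add: G_def)
    qed
    finally show ?thesis using r(2) by (simp add: dist_real_def mult_left_mono)
  qed
  \<comment> \<open>One \<open>e\<close> is lost to the strict bound on the upper derivative, the
    other to replacing \<open>?Ly s\<close> by its left mean.\<close>
  have good: "AE s in lborel. 0 < s \<and> s \<le> b \<longrightarrow>
      (\<forall>e>0. \<forall>\<^sub>F h in at_right 0. W (z (s - h)) \<le> W (z s) + (LINT r:{s - h..s}|lborel. ?Ly r) + 2 * e * h)"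
    using AE_left_derivative[OF gI] AE_left_derivative[OF I]
  proof (eventually_elim, intro impI allI)
    fix s e :: real
    assume g': "s \<in> {0<..b} \<longrightarrow> ((\<lambda>h. (1 / h) *\<^sub>R (LINT r:{s - h..s}|lborel. g r)) \<longlongrightarrow> g s) (at_right 0)"
      and l': "s \<in> {0<..b} \<longrightarrow> ((\<lambda>h. (1 / h) *\<^sub>R (LINT r:{s - h..s}|lborel. ?Ly r)) \<longlongrightarrow> ?Ly s) (at_right 0)"
      and s: "0 < s \<and> s \<le> b" and "0 < e"
    have small: "\<forall>\<^sub>F h in at_right 0. h \<in> {0<..<s}" using s by (intro eventually_at_right_real) auto
    have u: "((\<lambda>h. (1 / h) *\<^sub>R (y s - y (s - h))) \<longlongrightarrow> g s) (at_right 0)"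
    proof (rule Lim_transform_eventually)
      show "((\<lambda>h. (1 / h) *\<^sub>R (LINT r:{s - h..s}|lborel. g r)) \<longlongrightarrow> g s) (at_right 0)" using g' s by auto
      show "\<forall>\<^sub>F h in at_right 0. (1 / h) *\<^sub>R (LINT r:{s - h..s}|lborel. g r) = (1 / h) *\<^sub>R (y s - y (s - h))"
        using small
      proof eventually_elim
        case (elim h)
        then have "y s = y (s - h) + (LINT r:{s - h..s}|lborel. g r)"
          using s by (intro W11_integral[OF y]) auto
        then show ?case by simp
      qed
    qed
    have l: "((\<lambda>h. (LINT r:{s - h..s}|lborel. ?Ly r) / h) \<longlongrightarrow> ?Ly s) (at_right 0)" using l' s by simp
    have "L_plus L (y s) (g s) \<le> ennreal (?Ly s)"
      using s by (intro L_plus_le_left_mean[OF y _ _ fin u l]) auto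
    then have "enn2ereal (L_plus L (y s) (g s)) \<le> ereal (?Ly s)"
      by (metis L_nonneg enn2ereal_ennreal less_eq_ennreal.rep_eq)
    moreover have "upper_derivative W (t + b - s, y s) (1, - g s) \<le> enn2ereal (L_plus L (y s) (g s))"
      using sub s \<open>0 < t\<close> unfolding HJ_sub_def pos_times_def by auto
    ultimately have "upper_derivative W (t + b - s, y s) (1, - g s) \<le> ereal (?Ly s)"
      by (meson order_trans)
    also have "ereal (?Ly s) < ereal (?Ly s + e)" using \<open>0 < e\<close> by simp
    finally have "upper_derivative W (t + b - s, y s) (1, - g s) < ereal (?Ly s + e)" .
    from upper_derivative_curve[OF u this]
    have "\<forall>\<^sub>F h in at_right 0. W (z (s - h)) \<le> W (z s) + (?Ly s + e) * h"
      by eventually_elim (simp add: z_def algebra_simps)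
    moreover have "\<forall>\<^sub>F h in at_right 0. ?Ly s - e < (LINT r:{s - h..s}|lborel. ?Ly r) / h"
      using l \<open>0 < e\<close> by (intro order_tendstoD(1)) auto
    ultimately show "\<forall>\<^sub>F h in at_right 0. W (z (s - h)) \<le> W (z s) + (LINT r:{s - h..s}|lborel. ?Ly r) + 2 * e * h"
      using small
    proof eventually_elim
      case (elim h)
      then have "(?Ly s - e) * h < (LINT r:{s - h..s}|lborel. ?Ly r)" by (simp add: pos_less_divide_eq)
      with elim show ?case by (simp add: algebra_simps)
    qed
  qed
  then obtain N where N: "N \<in> null_sets lborel" "\<And>s. s \<notin> N \<Longrightarrow> 0 < s \<Longrightarrow> s \<le> b \<Longrightarrow> 0 < e \<Longrightarrow>
      \<forall>\<^sub>F h in at_right 0. W (z (s - h)) \<le> W (z s) + (LINT r:{s - h..s}|lborel. ?Ly r) + 2 * e * h" for e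
    unfolding eventually_ae_filter by auto
  show ?thesis
  proof (rule field_le_epsilon)
    fix e0 :: real assume "0 < e0"
    define e where "e = e0 / (2 * b + 1)"
    have "0 < e" using \<open>0 < e0\<close> \<open>0 \<le> b\<close> by (simp add: e_def)
    have w: "integrable lborel (\<lambda>s. indicator {0..b} s * G s)" using GI by (simp add: set_integrable_def)
    obtain U where U: "open U" "N \<subseteq> U" "emeasure (density lborel (\<lambda>s. ennreal (indicator {0..b} s * G s))) U < ennreal e"
    proof (rule open_superset_small_density[OF w _ _ _ \<open>0 < e\<close>])
      show "N \<in> sets borel" using N(1) by (auto simp: null_sets_def)
      show "AE s in lborel. s \<in> N \<longrightarrow> indicator {0..b} s * G s = 0"
        using AE_not_in[OF N(1)] by eventually_elim auto
    qed (use G0 in auto)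
    \<comment> \<open>At a point of \<open>N\<close> a left neighbourhood lies in \<open>U\<close>,
      so there \<open>M\<close> grows at the full rate \<open>G\<close> and outweighs any decrease
      of \<open>W\<close> along the curve.\<close>
    define M where "M s = (LINT r:{0..s}|lborel. indicator U r * G r)" for s
    have MI: "set_integrable lborel {0..b} (\<lambda>r. indicator U r * G r)"
    proof -
      have "integrable lborel (\<lambda>s. indicator U s *\<^sub>R (indicator {0..b} s * G s))"
        using w U(1) by (intro integrable_mult_indicator) auto
      then show ?thesis unfolding set_integrable_def by (simp add: mult.left_commute)
    qed
    have Me: "M b \<le> e"
    proof -
      have "ennreal (M b) = (\<integral>\<^sup>+s. ennreal (indicator {0..b} s * (indicator U s * G s)) \<partial>lborel)"
        unfolding M_def set_lebesgue_integral_def using MI G0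
        by (subst nn_integral_eq_integral) (auto simp: set_integrable_def)
      also have "\<dots> = emeasure (density lborel (\<lambda>s. ennreal (indicator {0..b} s * G s))) U"
        using U(1) w by (subst emeasure_density) (auto intro!: nn_integral_cong simp: indicator_def)
      finally have lt: "ennreal (M b) < ennreal e" using U(3) by simp
      show ?thesis
      proof (rule ccontr)
        assume "\<not> M b \<le> e"
        then have "ennreal e \<le> ennreal (M b)" by (intro ennreal_leI) simp
        with lt show False by simp
      qed
    qed
    define \<Phi> where "\<Phi> s = (LINT r:{0..s}|lborel. ?Ly r)" for s
    define F where "F s = W (z s) + \<Phi> s + 2 * e * s + M s" for s
    have "F 0 \<le> F b"
    proof (rule le_if_locally_increasing_from_left[where K = F and a = 0 and b = b])
      have "continuous_on (pos_times :: (real \<times> 'a) set) W"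
        using locally_Lipschitz_on_isCont[OF lip op] by (intro continuous_at_imp_continuous_on) auto
      then have "continuous_on {0..b} (\<lambda>s. W (z s))"
        by (rule continuous_on_compose2[OF _ zc]) (use \<open>z ` {0..b} \<subseteq> pos_times\<close> in auto)
      then show "continuous_on {0..b} F"
        unfolding F_def \<Phi>_def M_def
        by (intro continuous_intros set_integral_Icc_continuous I MI)
      fix s assume s: "0 < s" "s \<le> b"
      have \<Phi>: "\<Phi> s = \<Phi> (s - h) + (LINT r:{s - h..s}|lborel. ?Ly r)" if "h \<in> {0<..<s}" for h
        unfolding \<Phi>_def using that s
        by (intro set_integral_Icc_combine[symmetric] set_integrable_subset[OF I]) auto
      have M: "M s = M (s - h) + (LINT r:{s - h..s}|lborel. indicator U r * G r)" if "h \<in> {0<..<s}" for h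
        unfolding M_def using that s
        by (intro set_integral_Icc_combine[symmetric] set_integrable_subset[OF MI]) auto
      have M0: "0 \<le> (LINT r:{s - h..s}|lborel. indicator U r * G r)" for h
        unfolding set_lebesgue_integral_def using G0 by (intro Bochner_Integration.integral_nonneg) auto
      have \<Phi>0: "0 \<le> (LINT r:{s - h..s}|lborel. ?Ly r)" for h
        unfolding set_lebesgue_integral_def using L_nonneg by (intro Bochner_Integration.integral_nonneg) auto
      show "\<forall>\<^sub>F h in at_right 0. F (s - h) \<le> F s"
      proof (cases "s \<in> N")
        case False
        from N(2)[OF False s \<open>0 < e\<close>] zclose[OF s] show ?thesis
        proof eventually_elim
          case (elim h)
          then show ?case using \<Phi>[of h] M[of h] M0[of h] by (simp add: F_def algebra_simps)
        qed
      next
        case True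
        then obtain d where d: "0 < d" "ball s d \<subseteq> U" using U open_contains_ball by blast
        have "\<forall>\<^sub>F h in at_right 0. h \<in> {0<..<d}" using d by (intro eventually_at_right_real)
        with zclose[OF s] show ?thesis
        proof eventually_elim
          case (elim h)
          have "(LINT r:{s - h..s}|lborel. indicator U r * G r) = (LINT r:{s - h..s}|lborel. G r)"
          proof (rule set_lebesgue_integral_cong)
            have "r \<in> U" if "r \<in> {s - h..s}" for r using that d elim by (auto simp: dist_real_def subset_iff)
            then show "\<forall>r. r \<in> {s - h..s} \<longrightarrow> indicator U r * G r = G r" by auto
          qed auto
          moreover have "W (z (s - h)) \<le> W (z s) + (LINT r:{s - h..s}|lborel. G r)"
            using elim by (intro ineq s) auto
          moreover have "0 \<le> e * h" using elim \<open>0 < e\<close> by auto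
          ultimately show ?case using elim(1) \<Phi>[of h] M[of h] \<Phi>0[of h] by (simp add: F_def algebra_simps)
        qed
      qed
    qed (use \<open>0 \<le> b\<close> in auto)
    moreover have "\<Phi> 0 = 0" "M 0 = 0" by (simp_all add: \<Phi>_def M_def)
    ultimately have "W (z 0) \<le> W (z b) + \<Phi> b + (2 * e * b + e)" using Me by (simp add: F_def)
    also have "2 * e * b + e = e0" using \<open>0 \<le> b\<close> by (simp add: e_def divide_simps) (simp add: algebra_simps)?
    finally show "W (t + b, y 0) \<le> W (t, y b) + (LINT r:{0..b}|lborel. ?Ly r) + e0"
      by (simp add: z_def \<Phi>_def)
  qed
qed

lemma subsolution_le_value_fun:
  assumes sub: "HJ_sub L W" and adm: "admissible \<phi> W" and "0 < t"
  shows "ennreal (W (t, x)) \<le> value_fun L \<phi> t x"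
  unfolding value_fun_def
proof (rule INF_greatest, clarify)
  fix y g assume y: "W11 0 t y g" and x: "x = y 0"
  have lip: "locally_Lipschitz_on pos_times W" using adm by (simp add: admissible_def)
  show "ennreal (W (t, y 0)) \<le> cost L 0 t y g + \<phi> (y t)"
  proof (cases "cost L 0 t y g < \<infinity>")
    case True
    define \<tau> where "\<tau> n = t / real (Suc (Suc n))" for n
    \<comment> \<open>An absolutely continuous curve may cover more than any multiple of
      \<open>\<tau> n\<close> in the time \<open>\<tau> n\<close>. Starting the comparison at time
      \<open>\<eta> n\<close> instead puts \<open>(\<eta> n, y (t - \<tau> n))\<close> into the cone
      of slope 1 at \<open>y t\<close>; the summand \<open>\<tau> n\<close> keeps the time
      positive.\<close>
    define \<eta> where "\<eta> n = norm (y (t - \<tau> n) - y t) + \<tau> n" for n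
    have \<tau>: "0 < \<tau> n" "\<tau> n < t" for n using \<open>0 < t\<close> by (auto simp: \<tau>_def divide_simps)
    have \<tau>0: "\<tau> \<longlonglongrightarrow> 0" unfolding \<tau>_def by (intro LIMSEQ_Suc lim_const_over_n)
    have "(\<lambda>n. y (t - \<tau> n)) \<longlonglongrightarrow> y t"
    proof (rule continuous_on_tendsto_compose[OF W11_continuous_on[OF y]])
      show "(\<lambda>n. t - \<tau> n) \<longlonglongrightarrow> t" using tendsto_diff[OF tendsto_const \<tau>0, of t] by simp
    qed (use \<tau> \<open>0 < t\<close> in \<open>auto simp: less_imp_le intro!: always_eventually\<close>)
    note yl = this
    have "(\<lambda>n. norm (y (t - \<tau> n) - y t) + \<tau> n) \<longlonglongrightarrow> norm (y t - y t) + 0"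
      by (intro tendsto_intros yl \<tau>0)
    then have \<eta>0: "\<eta> \<longlonglongrightarrow> 0" by (simp add: \<eta>_def[abs_def])
    have \<eta>pos: "0 < \<eta> n" for n unfolding \<eta>_def using \<tau>[of n] by (intro add_nonneg_pos) auto
    have step: "ennreal (W (\<eta> n + (t - \<tau> n), y 0)) \<le> ennreal (W (\<eta> n, y (t - \<tau> n))) + cost L 0 t y g" for n
    proof -
      have W: "W11 0 (t - \<tau> n) y g" by (rule W11_subinterval[OF y]) (use \<tau>[of n] in auto)
      have le: "cost L 0 (t - \<tau> n) y g \<le> cost L 0 t y g" using \<tau>[of n] by (intro cost_mono) auto
      then have fin: "cost L 0 (t - \<tau> n) y g < \<infinity>" using True by (rule le_less_trans)
      have W0: "0 \<le> W (\<eta> n, y (t - \<tau> n))" using adm \<eta>pos by (auto simp: admissible_def pos_times_def)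
      have "W (\<eta> n + (t - \<tau> n), y 0) \<le> W (\<eta> n, y (t - \<tau> n)) + (LINT r:{0..t - \<tau> n}|lborel. L (y r) (g r))"
        using \<tau>[of n] by (intro subsolution_along_curve[OF sub lip W fin _ \<eta>pos]) auto
      then have "ennreal (W (\<eta> n + (t - \<tau> n), y 0)) \<le> ennreal (W (\<eta> n, y (t - \<tau> n)) + (LINT r:{0..t - \<tau> n}|lborel. L (y r) (g r)))"
        by (rule ennreal_leI)
      also have "\<dots> = ennreal (W (\<eta> n, y (t - \<tau> n))) + ennreal (LINT r:{0..t - \<tau> n}|lborel. L (y r) (g r))"
        using W0 by (intro ennreal_plus)
          (auto simp: set_lebesgue_integral_def L_nonneg intro!: Bochner_Integration.integral_nonneg)
      also have "\<dots> \<le> ennreal (W (\<eta> n, y (t - \<tau> n))) + cost L 0 t y g"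
        using le cost_eq_set_integral(2)[OF W fin] by (intro add_left_mono) simp
      finally show ?thesis .
    qed
    have "(\<lambda>n. W (\<eta> n + (t - \<tau> n), y 0)) \<longlonglongrightarrow> W (t, y 0)"
    proof -
      have "isCont W (t, y 0)"
        using \<open>0 < t\<close> by (intro locally_Lipschitz_on_isCont[OF lip open_pos_times]) (simp add: pos_times_def)
      moreover have "(\<lambda>n. (\<eta> n + (t - \<tau> n), y 0)) \<longlonglongrightarrow> (0 + (t - 0), y 0)"
        by (intro tendsto_intros \<eta>0 \<tau>0)
      ultimately show ?thesis by (intro isCont_tendsto_compose[where g = W]) auto
    qed
    then have lim1: "(\<lambda>n. ennreal (W (\<eta> n + (t - \<tau> n), y 0))) \<longlonglongrightarrow> ennreal (W (t, y 0))"
      by (rule tendsto_ennrealI)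
    have "filterlim (\<lambda>n. (\<eta> n, y (t - \<tau> n)))
        (inf (at_right 0 \<times>\<^sub>F nhds (y t)) (principal {(h, x). norm (x - y t) \<le> 1 * h})) sequentially"
      unfolding filterlim_inf
    proof
      show "LIM n sequentially. (\<eta> n, y (t - \<tau> n)) :> at_right 0 \<times>\<^sub>F nhds (y t)"
        by (intro filterlim_Pair tendsto_imp_filterlim_at_right \<eta>0 yl) (use \<eta>pos in auto)
      show "LIM n sequentially. (\<eta> n, y (t - \<tau> n)) :> principal {(h, x). norm (x - y t) \<le> 1 * h}"
        unfolding filterlim_principal using \<tau> by (intro always_eventually) (auto simp: \<eta>_def less_imp_le)
    qed
    moreover have "((\<lambda>z. ennreal (W z)) \<longlongrightarrow> \<phi> (y t))
        (inf (at_right 0 \<times>\<^sub>F nhds (y t)) (principal {(h, x). norm (x - y t) \<le> 1 * h}))"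
      using adm unfolding admissible_def initial_lim_cones_def by (metis zero_less_one)
    ultimately have "(\<lambda>n. ennreal (W (\<eta> n, y (t - \<tau> n)))) \<longlonglongrightarrow> \<phi> (y t)"
      by (rule filterlim_compose[rotated])
    then have "(\<lambda>n. ennreal (W (\<eta> n, y (t - \<tau> n))) + cost L 0 t y g) \<longlonglongrightarrow> \<phi> (y t) + cost L 0 t y g"
      by (intro tendsto_add tendsto_const)
    from LIMSEQ_le[OF lim1 this] step show ?thesis by (auto simp: add.commute)
  qed (simp add: less_top[symmetric])
qed

end

section \<open>Discrete trajectories of supersolutions\<close>

text \<open>Separate the origin from the strict epigraph, translated so that \<open>(u, f u)\<close>
  becomes the origin. The hyperplane is not vertical because \<open>f\<close> is finite in every
  direction, and its slope is the subgradient.\<close>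

lemma convex_on_subgradient:
  fixes f :: "'a::euclidean_space \<Rightarrow> real"
  assumes f: "convex_on UNIV f"
  obtains q where "\<And>w. f u + q \<bullet> (w - u) \<le> f w"
proof -
  define S where "S = {(v, r). f (u + v) < f u + r}"
  have "convex S"
    unfolding convex_alt
  proof (intro ballI allI impI)
    fix p p' and c :: real assume p: "p \<in> S" "p' \<in> S" and c: "0 \<le> c \<and> c \<le> 1"
    obtain v r v' r' where [simp]: "p = (v, r)" "p' = (v', r')" by (cases p, cases p') auto
    have lt: "f (u + v) < f u + r" "f (u + v') < f u + r'" using p by (auto simp: S_def)
    have "u + ((1 - c) *\<^sub>R v + c *\<^sub>R v') = (1 - c) *\<^sub>R (u + v) + c *\<^sub>R (u + v')"
      by (simp add: algebra_simps)
    then have "f (u + ((1 - c) *\<^sub>R v + c *\<^sub>R v')) \<le> (1 - c) * f (u + v) + c * f (u + v')"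
      using convex_onD[OF f, of c "u + v" "u + v'"] c by simp
    also have "\<dots> < (1 - c) * (f u + r) + c * (f u + r')"
    proof (cases "c = 0")
      case False
      with c lt show ?thesis by (intro add_le_less_mono mult_left_mono mult_strict_left_mono) auto
    qed (use lt in simp)
    also have "\<dots> = f u + ((1 - c) * r + c * r')" by (simp add: algebra_simps)
    finally show "(1 - c) *\<^sub>R p + c *\<^sub>R p' \<in> S" by (simp add: S_def)
  qed
  moreover have "0 \<notin> S" by (simp add: S_def zero_prod_def)
  ultimately obtain ab where ab: "ab \<noteq> 0" "\<And>p. p \<in> S \<Longrightarrow> 0 \<le> ab \<bullet> p"
    using separating_hyperplane_set_0[of S] by blast
  obtain a b where [simp]: "ab = (a, b)" by (cases ab)
  have *: "0 \<le> a \<bullet> v + b * r" if "f (u + v) < f u + r" for v r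
    using ab(2)[of "(v, r)"] that by (simp add: S_def)
  have "0 \<le> b" using *[of 0 1] by simp
  moreover have "b \<noteq> 0"
  proof
    assume "b = 0"
    then have "0 \<le> a \<bullet> (- a)" using *[of "- a" "f (u - a) - f u + 1"] by simp
    then have "a \<bullet> a \<le> 0" by simp
    then have "a = 0" by (metis inner_eq_zero_iff inner_ge_zero antisym)
    with \<open>b = 0\<close> ab(1) show False by (simp add: zero_prod_def)
  qed
  ultimately have "0 < b" by simp
  have "f u + (- (1 / b) *\<^sub>R a) \<bullet> (w - u) \<le> f w" for w
  proof (rule field_le_epsilon)
    fix e :: real assume "0 < e"
    then have "0 \<le> a \<bullet> (w - u) + b * (f w - f u + e)" by (intro *) simp
    then have "0 \<le> (a \<bullet> (w - u) + b * (f w - f u + e)) / b" using \<open>0 < b\<close> by simp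
    also have "\<dots> = a \<bullet> (w - u) / b + (f w - f u + e)" using \<open>0 < b\<close> by (simp add: add_divide_distrib)
    finally have "- (a \<bullet> (w - u) / b) \<le> f w - f u + e" by linarith
    then show "f u + (- (1 / b) *\<^sub>R a) \<bullet> (w - u) \<le> f w + e" by simp
  qed
  then show thesis by (rule that)
qed

lemma proximal_subgradient:
  assumes "0 < \<delta>" "0 \<le> k"
    and prox: "\<And>z'. dist z' z < \<delta> \<Longrightarrow> p \<bullet> (z' - z) - k * (norm (z' - z))\<^sup>2 \<le> W z' - W z"
  shows "p \<in> subdifferential W z"
  unfolding subdifferential_def mem_Collect_eq le_Liminf_iff
proof (intro allI impI)
  fix y :: ereal assume "y < 0"
  then obtain c where c: "y < ereal c" "c < 0" using ereal_dense2[of y 0] by (auto simp: zero_ereal_def)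
  define d where "d = min \<delta> (- c / (k + 1))"
  have "0 < d" using assms c by (auto simp: d_def intro!: divide_pos_pos divide_neg_pos)
  show "\<forall>\<^sub>F z' in at z. y < ereal ((W z' - W z - p \<bullet> (z' - z)) / norm (z' - z))"
    unfolding eventually_at
  proof (intro exI conjI ballI impI)
    fix z' assume z': "z' \<noteq> z \<and> dist z' z < d"
    let ?n = "norm (z' - z)"
    have n: "0 < ?n" "?n < d" using z' by (auto simp: dist_norm)
    have "?n < - c / (k + 1)" using n(2) unfolding d_def by linarith
    then have "?n * (k + 1) < - c" using pos_less_divide_eq[THEN iffD1, of "k + 1" ?n "- c"] assms(2) by simp
    then have "k * ?n + ?n < - c" by (simp add: algebra_simps)
    then have "c < - (k * ?n)" using n(1) by linarith
    then have "c < - k * ?n" by simp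
    then have "c * ?n \<le> - k * ?n * ?n" using n by (intro mult_right_mono) auto
    also have "\<dots> \<le> W z' - W z - p \<bullet> (z' - z)"
      using prox[of z'] z' by (simp add: d_def power2_eq_square algebra_simps)
    finally have "c \<le> (W z' - W z - p \<bullet> (z' - z)) / ?n" using n by (simp add: pos_le_divide_eq)
    with c show "y < ereal ((W z' - W z - p \<bullet> (z' - z)) / norm (z' - z))"
      by (meson ereal_less_eq(3) less_le_trans)
  qed (rule \<open>0 < d\<close>)
qed

section \<open>Convex envelopes of nearby Lagrangians and one time step of a supersolution\<close>

context tonelli_lagrangian
begin

text \<open>The closed convex envelope in the velocity of \<open>inf {L x' \<cdot> | x' \<in> cball x \<rho>}\<close>; it increases to
  \<open>L x\<close> as \<open>\<rho>\<close> decreases to \<open>0\<close>.\<close>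

definition minorants :: "'a \<Rightarrow> real \<Rightarrow> (real \<times> 'a) set" where
  "minorants x \<rho> = {(a, q). \<forall>x'\<in>cball x \<rho>. \<forall>w. a + q \<bullet> w \<le> L x' w}"

definition envelope :: "'a \<Rightarrow> real \<Rightarrow> 'a \<Rightarrow> real" where
  "envelope x \<rho> v = (SUP (a, q)\<in>minorants x \<rho>. a + q \<bullet> v)"

lemma zero_minorant: "(0, 0) \<in> minorants x \<rho>"
  by (simp add: minorants_def L_nonneg)

lemma minorants_nonempty: "minorants x \<rho> \<noteq> {}"
  using zero_minorant by blast

lemma envelope_le:
  assumes "x' \<in> cball x \<rho>"
  shows "envelope x \<rho> v \<le> L x' v"
  unfolding envelope_def
  by (rule cSUP_least[OF minorants_nonempty]) (use assms in \<open>auto simp: minorants_def\<close>)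

lemma envelope_ge:
  assumes "0 \<le> \<rho>" "(a, q) \<in> minorants x \<rho>"
  shows "a + q \<bullet> v \<le> envelope x \<rho> v"
proof -
  have "bdd_above ((\<lambda>(a, q). a + q \<bullet> v) ` minorants x \<rho>)"
    by (rule bdd_aboveI2[where M = "L x v"]) (use assms(1) in \<open>auto simp: minorants_def\<close>)
  from cSUP_upper[OF assms(2) this] show ?thesis by (simp add: envelope_def)
qed

lemma envelope_nonneg: "0 \<le> \<rho> \<Longrightarrow> 0 \<le> envelope x \<rho> v"
  using envelope_ge[OF _ zero_minorant] by force

lemma envelope_convex:
  assumes "0 \<le> \<rho>"
  shows "convex_on UNIV (envelope x \<rho>)"
proof (rule convex_onI)
  fix c u v assume c: "0 < c" "c < (1 :: real)"
  show "envelope x \<rho> ((1 - c) *\<^sub>R u + c *\<^sub>R v) \<le> (1 - c) * envelope x \<rho> u + c * envelope x \<rho> v"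
    unfolding envelope_def[of x \<rho> "(1 - c) *\<^sub>R u + c *\<^sub>R v"]
  proof (rule cSUP_least[OF minorants_nonempty])
    fix p assume "p \<in> minorants x \<rho>"
    moreover obtain a q where [simp]: "p = (a, q)" by (cases p)
    ultimately have "a + q \<bullet> u \<le> envelope x \<rho> u" "a + q \<bullet> v \<le> envelope x \<rho> v"
      by (auto intro: envelope_ge[OF assms])
    then have "(1 - c) * (a + q \<bullet> u) + c * (a + q \<bullet> v) \<le> (1 - c) * envelope x \<rho> u + c * envelope x \<rho> v"
      using c by (intro add_mono mult_left_mono) auto
    then show "(case p of (a, q) \<Rightarrow> a + q \<bullet> ((1 - c) *\<^sub>R u + c *\<^sub>R v)) \<le> (1 - c) * envelope x \<rho> u + c * envelope x \<rho> v"
      by (simp add: algebra_simps inner_add_right)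
  qed
qed auto

text \<open>A smaller ball has more minorants. This is how envelopes at many nearby centres are
  compared with one at a common centre.\<close>

lemma envelope_antimono:
  assumes "cball x' \<rho>' \<subseteq> cball x \<rho>" "0 \<le> \<rho>'"
  shows "envelope x \<rho> v \<le> envelope x' \<rho>' v"
  unfolding envelope_def[of x \<rho>]
proof (rule cSUP_least[OF minorants_nonempty])
  fix p assume "p \<in> minorants x \<rho>"
  then have "p \<in> minorants x' \<rho>'" using assms(1) by (auto simp: minorants_def)
  then show "(case p of (a, q) \<Rightarrow> a + q \<bullet> v) \<le> envelope x' \<rho>' v"
    using envelope_ge[OF assms(2)] by (cases p) auto
qed

lemma envelope_growth:
  assumes "0 \<le> \<rho>" and C: "\<And>x u. norm u - C \<le> L x u"
  shows "norm v - C \<le> envelope x \<rho> v"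
proof -
  \<comment> \<open>Among the linear functions below the norm, the one of slope \<open>sgn v\<close>
    attains it at \<open>v\<close>.\<close>
  have "(- C, sgn v) \<in> minorants x \<rho>"
    unfolding minorants_def mem_Collect_eq prod.case
  proof (intro ballI allI)
    fix x' w
    have "sgn v \<bullet> w \<le> norm (sgn v) * norm w" by (rule norm_cauchy_schwarz)
    also have "\<dots> \<le> norm w" by (simp add: norm_sgn)
    finally show "- C + sgn v \<bullet> w \<le> L x' w" using C[of w x'] by simp
  qed
  moreover have "sgn v \<bullet> v = norm v"
    by (cases "v = 0") (simp_all add: sgn_div_norm dot_square_norm power2_eq_square)
  ultimately show ?thesis using envelope_ge[OF assms(1), of "- C" "sgn v" x v] by simp
qed

text \<open>Joint lower semicontinuity at \<open>(x, u)\<close> in a quantitative form: a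
  subgradient of \<open>L x\<close> at \<open>u\<close>, lowered by \<open>\<epsilon>\<close>,
  remains a minorant on a whole ball, hence for every smaller ball inside it. The term with
  \<open>q\<close> vanishes as \<open>v\<close> tends to \<open>u\<close>.\<close>

lemma envelope_lower_bound:
  assumes "0 < \<epsilon>"
  obtains \<rho> q where "0 < \<rho>"
    "\<And>y \<sigma> v. cball y \<sigma> \<subseteq> cball x \<rho> \<Longrightarrow> 0 \<le> \<sigma> \<Longrightarrow> L x u - \<epsilon> + q \<bullet> (v - u) \<le> envelope y \<sigma> v"
proof -
  obtain q where q: "\<And>w. L x u + q \<bullet> (w - u) \<le> L x w"
    using convex_on_subgradient[OF L_convex] by metis
  then have "\<And>w. (L x u - q \<bullet> u) + q \<bullet> w \<le> L x w" by (simp add: inner_diff_right algebra_simps)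
  then obtain \<rho> where \<rho>: "0 < \<rho>" "\<And>x' w. x' \<in> cball x \<rho> \<Longrightarrow> (L x u - q \<bullet> u) + q \<bullet> w - \<epsilon> \<le> L x' w"
    using affine_minorant_perturb[OF _ assms] by metis
  show thesis
  proof (rule that[OF \<rho>(1)])
    fix y \<sigma> v assume "cball y \<sigma> \<subseteq> cball x \<rho>" "0 \<le> \<sigma>"
    then have "(L x u - q \<bullet> u - \<epsilon>, q) \<in> minorants y \<sigma>"
      using \<rho>(2) unfolding minorants_def by (auto simp: algebra_simps)
    from envelope_ge[OF \<open>0 \<le> \<sigma>\<close> this, of v]
    show "L x u - \<epsilon> + q \<bullet> (v - u) \<le> envelope y \<sigma> v" by (simp add: inner_diff_right)
  qed
qed

text \<open>A multidirectional mean value argument: were the claim false, a penalised minimisation over the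
  cone from \<open>(t, x)\<close> to the time slice \<open>t - \<Delta>\<close> would produce a subgradient violating the inequality
  satisfied by \<open>W\<close>.\<close>

lemma supersolution_step:
  assumes super: "HJ_super L W" and lip: "C-lipschitz_on (cball (t, x) r) W" and dom: "cball (t, x) r \<subseteq> pos_times"
    and l: "convex_on UNIV l" "\<And>x' u. x' \<in> cball x r \<Longrightarrow> l u \<le> L x' u"
    and R: "\<And>x' u. L x' u \<le> 2 * C + 1 + 2 * C * norm u \<Longrightarrow> norm u \<le> R" "0 \<le> R"
    and \<Delta>: "0 < \<Delta>" "\<Delta> * (R + 1) \<le> r / 2" and \<epsilon>: "0 < \<epsilon>" "\<epsilon> \<le> 1"
  obtains u where "norm u \<le> R" "W (t - \<Delta>, x + \<Delta> *\<^sub>R u) + \<Delta> * l u \<le> W (t, x) + \<epsilon> * \<Delta>"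
proof (rule ccontr)
  assume "\<not> thesis"
  with that have neg: "\<And>u. norm u \<le> R \<Longrightarrow> W (t, x) + \<epsilon> * \<Delta> < W (t - \<Delta>, x + \<Delta> *\<^sub>R u) + \<Delta> * l u"
    by (meson not_less)
  have "0 \<le> C" using lip by (rule lipschitz_on_nonneg)
  have "0 < \<Delta> * (R + 1)" using \<Delta> R by simp
  with \<Delta> have "0 < r" by simp
  \<comment> \<open>The second summand makes the error \<open>C * norm d\<close> smaller than
    \<open>\<epsilon> / 2 * \<Delta>\<close>, the third keeps \<open>z\<close> within
    \<open>r / 2\<close> of \<open>P s u\<close>, and the 1 makes both strict.\<close>
  define k where "k = 1 + C * C / (\<epsilon> / 2 * \<Delta>) + 2 * C / r"
  have kpos: "0 < k" using \<open>0 \<le> C\<close> \<Delta> \<epsilon> \<open>0 < r\<close> by (auto simp: k_def intro!: add_pos_nonneg)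
  have k1: "C * C < k * (\<epsilon> / 2 * \<Delta>)"
  proof -
    have "C * C = (C * C / (\<epsilon> / 2 * \<Delta>)) * (\<epsilon> / 2 * \<Delta>)" using \<Delta> \<epsilon> by simp
    also have "\<dots> < k * (\<epsilon> / 2 * \<Delta>)"
      using \<Delta> \<epsilon> \<open>0 \<le> C\<close> \<open>0 < r\<close> by (intro mult_strict_right_mono) (auto simp: k_def intro!: add_pos_nonneg)
    finally show ?thesis .
  qed
  have k2: "C < k * (r / 2)"
  proof -
    have "C = (2 * C / r) * (r / 2)" using \<open>0 < r\<close> by simp
    also have "\<dots> < k * (r / 2)"
      using \<Delta> \<epsilon> \<open>0 \<le> C\<close> \<open>0 < r\<close> by (intro mult_strict_right_mono) (auto simp: k_def intro!: add_pos_nonneg)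
    finally show ?thesis .
  qed
  define P where "P s u = (t - s * \<Delta>, x + (s * \<Delta>) *\<^sub>R u)" for s and u :: 'a
  \<comment> \<open>Doubling of variables: \<open>z\<close> is only tied to \<open>P s u\<close> by
    a penalty, so minimality in \<open>z\<close> yields a proximal subgradient, while minimality in
    \<open>(s, u)\<close> meets only the smooth penalty and the convex \<open>l\<close>. The last
    term spends half of the permitted error on a tilt, which makes the final contradiction
    strict.\<close>
  define G where "G = (\<lambda>(s, u, z). W z + k * (norm (z - P s u))\<^sup>2 + s * \<Delta> * l u - s * (\<epsilon> / 2 * \<Delta>))"
  let ?D = "{0..1::real} \<times> cball (0::'a) R \<times> cball (t, x) r"
  have lc: "continuous_on UNIV l" using l(1) by (intro convex_on_continuous) auto
  have "continuous_on ?D (\<lambda>p. W (snd (snd p)))"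
    by (rule continuous_on_compose2[OF lipschitz_on_continuous_on[OF lip]]) (auto intro!: continuous_intros)
  moreover have "continuous_on ?D (\<lambda>p. l (fst (snd p)))"
    by (rule continuous_on_compose2[OF lc]) (auto intro!: continuous_intros)
  ultimately have "continuous_on ?D G"
    unfolding G_def P_def split_def by (intro continuous_intros)
  moreover have "compact ?D" by (intro compact_Times compact_cball compact_Icc)
  moreover have "?D \<noteq> {}" using R(2) \<open>0 < r\<close> by auto
  ultimately obtain p0 where p0: "p0 \<in> ?D" "\<And>p. p \<in> ?D \<Longrightarrow> G p0 \<le> G p"
    using continuous_attains_inf[of ?D G] by blast
  obtain s u z where [simp]: "p0 = (s, u, z)" by (cases p0) auto
  have s: "0 \<le> s" "s \<le> 1" and u: "norm u \<le> R" and z: "z \<in> cball (t, x) r" using p0(1) by auto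
  have min: "G (s, u, z) \<le> G (s', u', z')"
    if "0 \<le> s'" "s' \<le> 1" "norm u' \<le> R" "z' \<in> cball (t, x) r" for s' u' z'
    using p0(2)[of "(s', u', z')"] that by auto
  have Pdist: "dist (P s' u') (t, x) \<le> r / 2" if "0 \<le> s'" "s' \<le> 1" "norm u' \<le> R" for s' u'
  proof -
    have "dist (P s' u') (t, x) \<le> norm (- (s' * \<Delta>)) + norm ((s' * \<Delta>) *\<^sub>R u')"
      using norm_Pair_le[of "- (s' * \<Delta>)" "(s' * \<Delta>) *\<^sub>R u'"] by (simp add: P_def dist_norm)
    also have "\<dots> = s' * (\<Delta> * (norm u' + 1))" using that \<Delta> by (simp add: algebra_simps abs_mult)
    also have "\<dots> \<le> 1 * (\<Delta> * (R + 1))" using that \<Delta> by (intro mult_mono) auto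
    finally show ?thesis using \<Delta>(2) by simp
  qed
  have Pin: "P s u \<in> cball (t, x) r"
    using Pdist[OF s u] \<open>0 < r\<close> by (simp add: dist_commute)
  define d where "d = z - P s u"
  have WP: "W (P s u) - W z \<le> C * norm d"
    using lipschitz_onD[OF lip Pin z] by (simp add: d_def dist_norm dist_real_def norm_minus_commute)
  have "G (s, u, z) \<le> G (s, u, P s u)" by (rule min[OF s u Pin])
  then have "k * (norm d)\<^sup>2 \<le> W (P s u) - W z" by (simp add: G_def d_def)
  with WP have "(k * norm d) * norm d \<le> C * norm d" by (simp add: power2_eq_square mult.assoc)
  then have kd: "k * norm d \<le> C" using \<open>0 \<le> C\<close> by (cases "norm d = 0") auto
  have "k * norm d < k * (r / 2)" using kd k2 by linarith
  then have dr: "norm d < r / 2" using kpos by simp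
  have zball: "dist z (t, x) < r"
  proof -
    have "dist z (P s u) < r / 2" using dr by (simp add: d_def dist_norm)
    then show ?thesis using dist_triangle[of z "(t, x)" "P s u"] Pdist[OF s u] by simp
  qed
  \<comment> \<open>On the last slice the negated claim pushes \<open>G\<close> above its value at
    the vertex \<open>(t, x)\<close>. Hence \<open>s < 1\<close>, and the path can be
    prolonged.\<close>
  have "s \<noteq> 1"
  proof
    assume "s = 1"
    have "C * norm d < \<epsilon> / 2 * \<Delta>"
    proof -
      have "k * (C * norm d) \<le> C * C" using mult_left_mono[OF kd \<open>0 \<le> C\<close>] by (simp add: algebra_simps)
      then have "k * (C * norm d) < k * (\<epsilon> / 2 * \<Delta>)" using k1 by linarith
      then show ?thesis using kpos by (simp only: mult_less_cancel_left_pos)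
    qed
    moreover have "W (t, x) + \<epsilon> * \<Delta> < W (P s u) + \<Delta> * l u"
      using neg[OF u] by (simp add: P_def \<open>s = 1\<close>)
    moreover have "0 \<le> k * (norm d)\<^sup>2" using kpos by simp
    moreover have "G (s, u, z) = W z + k * (norm d)\<^sup>2 + \<Delta> * l u - \<epsilon> / 2 * \<Delta>"
      by (simp add: G_def d_def \<open>s = 1\<close>)
    ultimately have "W (t, x) < G (s, u, z)" using WP by (simp add: algebra_simps)
    also have "\<dots> \<le> G (0, 0, (t, x))" using R(2) \<open>0 < r\<close> by (intro min) auto
    also have "\<dots> = W (t, x)" by (simp add: G_def P_def)
    finally show False by simp
  qed
  with s have "s < 1" by simp
  define p where "p = (- 2 * k) *\<^sub>R d"
  obtain pt px where ptx: "p = (pt, px)" by (cases p)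
  obtain tz xz where tx: "z = (tz, xz)" by (cases z)
  have "p \<in> subdifferential W z"
  proof (rule proximal_subgradient[of "r - dist z (t, x)" k])
    fix z' assume z': "dist z' z < r - dist z (t, x)"
    have "dist z' (t, x) < r" using z' dist_triangle[of z' "(t, x)" z] by simp
    then have "G (s, u, z) \<le> G (s, u, z')" by (intro min s u) (simp add: dist_commute)
    then have "W z + k * (norm d)\<^sup>2 \<le> W z' + k * (norm (z' - P s u))\<^sup>2" by (simp add: G_def d_def)
    also have "z' - P s u = (z' - z) + d" by (simp add: d_def)
    also have "(norm ((z' - z) + d))\<^sup>2 = (norm (z' - z))\<^sup>2 + 2 * (d \<bullet> (z' - z)) + (norm d)\<^sup>2"
      by (simp only: power2_norm_eq_inner) (simp add: inner_add_left inner_add_right inner_commute)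
    finally show "p \<bullet> (z' - z) - k * (norm (z' - z))\<^sup>2 \<le> W z' - W z"
      by (simp add: p_def algebra_simps)
  qed (use zball kpos in auto)
  moreover have "z \<in> pos_times" using z dom by auto
  ultimately have "0 \<le> ereal pt + hamiltonian L xz (- px)"
    using super unfolding HJ_super_def ptx tx by auto
  \<comment> \<open>The supremum in the Hamiltonian need not be attained; a loss of
    \<open>\<epsilon> / 4\<close> stays below the tilt \<open>\<epsilon> / 2\<close>.\<close>
  then have "ereal (- pt - \<epsilon> / 4) < hamiltonian L xz (- px)"
    using \<epsilon> by (cases "hamiltonian L xz (- px)") auto
  then obtain u' where "ereal (- pt - \<epsilon> / 4) < ereal (- px \<bullet> u' - L xz u')"
    unfolding hamiltonian_def less_SUP_iff by blast
  then have u'L: "px \<bullet> u' + L xz u' < pt + \<epsilon> / 4" by simp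
  have np: "norm p \<le> 2 * C" using kd kpos by (simp add: p_def abs_mult)
  have "\<bar>pt\<bar> \<le> 2 * C" "norm px \<le> 2 * C"
    using np norm_fst_le[of pt px] norm_snd_le[of px pt] unfolding ptx by auto
  have u'R: "norm u' \<le> R"
  proof (rule R(1)[of xz])
    have "- (px \<bullet> u') \<le> norm px * norm u'" using norm_cauchy_schwarz[of "- px" u'] by simp
    also have "\<dots> \<le> 2 * C * norm u'" using \<open>norm px \<le> 2 * C\<close> by (intro mult_right_mono) auto
    finally show "L xz u' \<le> 2 * C + 1 + 2 * C * norm u'" using u'L \<open>\<bar>pt\<bar> \<le> 2 * C\<close> \<epsilon> by linarith
  qed
  have "xz \<in> cball x r" using z dist_snd_le[of "(t, x)" z] by (simp add: tx)
  then have lu': "px \<bullet> u' + l u' < pt + \<epsilon> / 4" using u'L l(2)[of xz u'] by simp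
  define e where "e = \<Delta> *\<^sub>R ((- 1, u') :: real \<times> 'a)"
  define X where "X = - 2 * k * (d \<bullet> e) + \<Delta> * l u' - \<epsilon> / 2 * \<Delta>"
  have var: "0 \<le> X + k * h * (norm e)\<^sup>2" if h: "0 < h" "h \<le> 1 - s" for h
  proof -
    define s' where "s' = s + h"
    \<comment> \<open>Chosen so that \<open>s' *\<^sub>R v = s *\<^sub>R u + h *\<^sub>R u'\<close>:
      the tip of the path moves on with velocity \<open>u'\<close> while the mean velocity
      \<open>v\<close> stays in the ball, also when \<open>s = 0\<close>. Convexity of
      \<open>l\<close> then bounds the change of cost; dividing by \<open>h\<close> and letting
      \<open>h\<close> tend to 0 gives \<open>0 \<le> X\<close>.\<close>
    define v where "v = (1 - h / s') *\<^sub>R u + (h / s') *\<^sub>R u'"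
    have s': "0 < s'" "s' \<le> 1" "0 \<le> s'" using s h by (auto simp: s'_def)
    have hs: "0 \<le> h / s'" "h / s' \<le> 1" using h s by (auto simp: s'_def)
    have "v \<in> cball 0 R"
      unfolding v_def using hs u u'R by (intro convexD_alt[OF convex_cball]) auto
    then have vR: "norm v \<le> R" by simp
    have s'v: "s' *\<^sub>R v = s *\<^sub>R u + h *\<^sub>R u'"
      using s' by (simp add: v_def algebra_simps) (simp add: s'_def algebra_simps)
    have "l v \<le> (1 - h / s') * l u + (h / s') * l u'"
      unfolding v_def using hs by (intro convex_onD[OF l(1)]) auto
    then have "s' * l v \<le> s' * ((1 - h / s') * l u + (h / s') * l u')" using s' by (intro mult_left_mono) auto
    also have "\<dots> = s * l u + h * l u'" using s' by (simp add: algebra_simps) (simp add: s'_def algebra_simps)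
    finally have lv: "\<Delta> * (s' * l v) \<le> \<Delta> * (s * l u + h * l u')" using \<Delta> by (intro mult_left_mono) auto
    have "z - P s' v = d - h *\<^sub>R e"
    proof -
      have "(s' * \<Delta>) *\<^sub>R v = \<Delta> *\<^sub>R (s *\<^sub>R u + h *\<^sub>R u')" using s'v by (metis scaleR_scaleR mult.commute)
      then have "P s' v = P s u + h *\<^sub>R e" by (simp add: P_def e_def s'_def algebra_simps)
      then show ?thesis by (simp add: d_def)
    qed
    then have nd: "(norm (z - P s' v))\<^sup>2 = (norm d)\<^sup>2 - 2 * h * (d \<bullet> e) + h * h * (norm e)\<^sup>2"
      by (simp only: power2_norm_eq_inner) (simp add: inner_diff_left inner_diff_right inner_commute)
    have "G (s, u, z) \<le> G (s', v, z)" by (rule min[OF s'(3,2) vR z])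
    then have "k * (norm d)\<^sup>2 + s * \<Delta> * l u - s * (\<epsilon> / 2 * \<Delta>)
        \<le> k * ((norm d)\<^sup>2 - 2 * h * (d \<bullet> e) + h * h * (norm e)\<^sup>2) + s' * \<Delta> * l v - s' * (\<epsilon> / 2 * \<Delta>)"
      unfolding G_def prod.case nd by (simp add: d_def)
    with lv have "0 \<le> h * (X + k * h * (norm e)\<^sup>2)"
      by (simp add: X_def s'_def algebra_simps add_divide_distrib)
    then show ?thesis using h by (simp add: zero_le_mult_iff)
  qed
  have "0 \<le> X"
  proof (rule field_le_epsilon)
    fix \<eta> :: real assume "0 < \<eta>"
    define h where "h = min (1 - s) (\<eta> / (k * (norm e)\<^sup>2 + 1))"
    have den: "0 < k * (norm e)\<^sup>2 + 1" using kpos by (intro add_nonneg_pos) auto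
    have h: "0 < h" "h \<le> 1 - s" using \<open>s < 1\<close> \<open>0 < \<eta>\<close> den by (auto simp: h_def)
    have "h * (k * (norm e)\<^sup>2) \<le> h * (k * (norm e)\<^sup>2 + 1)" using h by (intro mult_left_mono) auto
    also have "\<dots> \<le> (\<eta> / (k * (norm e)\<^sup>2 + 1)) * (k * (norm e)\<^sup>2 + 1)"
      using den by (intro mult_right_mono) (auto simp: h_def)
    also have "\<dots> = \<eta>" using den by simp
    finally show "0 \<le> X + \<eta>" using var[OF h] by (simp add: algebra_simps)
  qed
  also have "X = \<Delta> * (- pt + px \<bullet> u' + l u' - \<epsilon> / 2)"
  proof -
    have "- 2 * k * (d \<bullet> e) = p \<bullet> e" by (simp add: p_def)
    also have "\<dots> = \<Delta> * (- pt + px \<bullet> u')" by (simp add: ptx e_def algebra_simps)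
    finally show ?thesis by (simp add: X_def algebra_simps)
  qed
  finally have "0 \<le> - pt + px \<bullet> u' + l u' - \<epsilon> / 2" using \<Delta>(1) by (simp add: zero_le_mult_iff)
  with lu' \<epsilon> show False by linarith
qed

text \<open>The one-step lemma needs a radius and a Lipschitz constant of \<open>W\<close>, which
  are uniform only on compact sets. An a priori bound on the displacement keeps all nodes in such a
  set, whatever the number of steps, and so makes \<open>R\<close> independent of
  \<open>\<Delta>\<close>.\<close>

lemma supersolution_chain:
  assumes super: "HJ_super L W" and lip: "locally_Lipschitz_on pos_times W"
    and nonneg: "\<And>z. z \<in> pos_times \<Longrightarrow> 0 \<le> W z"
    and C1: "0 \<le> C1" "\<And>x u. norm u - C1 \<le> L x u"
    and \<tau>: "0 < \<tau>" "\<tau> < t0" and \<epsilon>: "0 < \<epsilon>" "\<epsilon> \<le> 1"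
  obtains R \<Delta>0 where "0 \<le> R" "0 < \<Delta>0"
    "\<forall>\<Delta> N. 0 < \<Delta> \<longrightarrow> \<Delta> \<le> \<Delta>0 \<longrightarrow> real N * \<Delta> = t0 - \<tau> \<longrightarrow>
      (\<exists>u. (\<forall>j<N. norm (u j) \<le> R) \<and>
        norm (\<Delta> *\<^sub>R (\<Sum>i<N. u i)) \<le> W (t0, x0) + (1 + C1) * t0 \<and>
        W (\<tau>, x0 + \<Delta> *\<^sub>R (\<Sum>i<N. u i)) +
          (\<Sum>j<N. \<Delta> * envelope (x0 + \<Delta> *\<^sub>R (\<Sum>i<j. u i)) (2 * \<Delta> * (R + 1)) (u j)) \<le> W (t0, x0) + \<epsilon> * (t0 - \<tau>))"
proof -
  \<comment> \<open>By \<open>envelope_growth\<close> the displacement is at most the accumulated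
    cost plus \<open>C1\<close> times the elapsed time; the cost is at most
    \<open>W (t0, x0) + t0\<close>, because \<open>W\<close> is non-negative and
    \<open>\<epsilon> \<le> 1\<close>.\<close>
  define M where "M = W (t0, x0) + (1 + C1) * t0"
  define K where "K = {\<tau>..t0} \<times> cball x0 M"
  have "compact K" unfolding K_def by (intro compact_Times compact_cball compact_Icc)
  moreover note op = open_pos_times[where 'a = 'a]
  moreover have "K \<subseteq> pos_times" using \<tau> by (auto simp: K_def pos_times_def)
  ultimately obtain r C where r: "0 < r" "0 \<le> C" "\<And>z. z \<in> K \<Longrightarrow> cball z r \<subseteq> pos_times"
    "\<And>z. z \<in> K \<Longrightarrow> C-lipschitz_on (cball z r) W"
    using locally_Lipschitz_on_compact[OF lip op] by metis
  obtain C2 where C2: "0 \<le> C2" "\<And>x u. (2 * C + 1) * norm u - C2 \<le> L x u" using L_growthE[of "2 * C + 1"] by metis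
  \<comment> \<open>Growth of slope \<open>2 * C + 1\<close> turns the hypothesis of
    \<open>supersolution_step\<close> on \<open>R\<close> into this number.\<close>
  define R where "R = 2 * C + 1 + C2"
  have R0: "0 \<le> R" using r C2 by (simp add: R_def)
  have R: "norm u \<le> R" if "L x' u \<le> 2 * C + 1 + 2 * C * norm u" for x' u
    using that C2(2)[of u x'] by (simp add: R_def algebra_simps)
  show thesis
  proof (rule that[OF R0 _ allI[OF allI[OF impI[OF impI[OF impI]]]]])
    show "0 < r / (2 * (R + 1))" using r R0 by simp
    fix \<Delta> :: real and N :: nat
    assume \<Delta>: "0 < \<Delta>" "\<Delta> \<le> r / (2 * (R + 1))" and N: "real N * \<Delta> = t0 - \<tau>"
    \<comment> \<open>The smallest radius that \<open>supersolution_step\<close> accepts. It shrinks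
      with \<open>\<Delta>\<close>, so that the envelopes regain \<open>L\<close> in the
      limit.\<close>
    define \<rho> where "\<rho> = 2 * \<Delta> * (R + 1)"
    have "0 < \<rho>" unfolding \<rho>_def using \<Delta>(1) R0 by (intro mult_pos_pos) auto
    then have \<rho>: "0 < \<rho>" "\<rho> \<le> r" "\<Delta> * (R + 1) \<le> \<rho> / 2"
      using \<Delta> R0 by (auto simp: \<rho>_def field_simps)
    define X where "X u j = x0 + \<Delta> *\<^sub>R (\<Sum>i<j. u i)" for u :: "nat \<Rightarrow> 'a" and j
    define E where "E u j = (\<Sum>i<j. \<Delta> * envelope (X u i) \<rho> (u i))" for u j
    have bound: "norm (\<Delta> *\<^sub>R (\<Sum>i<j. u i)) \<le> M"
      if "j \<le> N" "W (t0 - real j * \<Delta>, X u j) + E u j \<le> W (t0, x0) + \<epsilon> * (real j * \<Delta>)" for u j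
    proof -
      have jN: "real j * \<Delta> \<le> t0 - \<tau>" using that(1) \<Delta>(1) unfolding N[symmetric] by (intro mult_right_mono) auto
      have "norm (\<Delta> *\<^sub>R (\<Sum>i<j. u i)) = \<Delta> * norm (\<Sum>i<j. u i)" using \<Delta> by simp
      also have "\<dots> \<le> \<Delta> * (\<Sum>i<j. norm (u i))" using \<Delta> by (intro mult_left_mono norm_sum) auto
      also have "\<dots> = (\<Sum>i<j. \<Delta> * norm (u i))" by (simp add: sum_distrib_left)
      also have "\<dots> \<le> (\<Sum>i<j. \<Delta> * envelope (X u i) \<rho> (u i) + \<Delta> * C1)"
      proof (rule sum_mono)
        fix i
        have "norm (u i) \<le> envelope (X u i) \<rho> (u i) + C1"
          using envelope_growth[of \<rho> C1 "u i" "X u i"] C1(2) \<rho>(1) by (simp add: less_imp_le algebra_simps)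
        then have "\<Delta> * norm (u i) \<le> \<Delta> * (envelope (X u i) \<rho> (u i) + C1)" using \<Delta> by (intro mult_left_mono) auto
        then show "\<Delta> * norm (u i) \<le> \<Delta> * envelope (X u i) \<rho> (u i) + \<Delta> * C1" by (simp add: algebra_simps)
      qed
      also have "\<dots> = E u j + C1 * (real j * \<Delta>)" by (simp add: E_def sum.distrib algebra_simps)
      also have "\<dots> \<le> W (t0, x0) + \<epsilon> * (real j * \<Delta>) + C1 * (real j * \<Delta>)"
      proof -
        have "0 \<le> W (t0 - real j * \<Delta>, X u j)" using jN \<tau> by (intro nonneg) (auto simp: pos_times_def)
        with that(2) show ?thesis by linarith
      qed
      also have "\<dots> \<le> W (t0, x0) + 1 * t0 + C1 * t0"
        using jN \<tau> \<epsilon> C1(1) \<Delta> by (intro add_mono mult_mono order_refl) auto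
      finally show ?thesis by (simp add: M_def algebra_simps)
    qed
    have "\<exists>u. (\<forall>i<j. norm (u i) \<le> R) \<and> W (t0 - real j * \<Delta>, X u j) + E u j \<le> W (t0, x0) + \<epsilon> * (real j * \<Delta>)"
      if "j \<le> N" for j
      using that
    proof (induction j)
      case 0
      then show ?case by (intro exI[of _ "\<lambda>_. 0"]) (simp add: X_def E_def)
    next
      case (Suc j)
      then obtain u where u: "\<forall>i<j. norm (u i) \<le> R"
        "W (t0 - real j * \<Delta>, X u j) + E u j \<le> W (t0, x0) + \<epsilon> * (real j * \<Delta>)" by auto
      have jN: "real j * \<Delta> \<le> t0 - \<tau>" using Suc.prems \<Delta>(1) unfolding N[symmetric] by (intro mult_right_mono) auto
      have "norm (\<Delta> *\<^sub>R (\<Sum>i<j. u i)) \<le> M" using bound[OF _ u(2)] Suc.prems by simp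
      then have inK: "(t0 - real j * \<Delta>, X u j) \<in> K"
        using jN \<Delta> by (auto simp: K_def X_def dist_norm)
      have sub: "cball (t0 - real j * \<Delta>, X u j) \<rho> \<subseteq> cball (t0 - real j * \<Delta>, X u j) r" using \<rho>(2) by auto
      obtain v where v: "norm v \<le> R" "W (t0 - real j * \<Delta> - \<Delta>, X u j + \<Delta> *\<^sub>R v) + \<Delta> * envelope (X u j) \<rho> v
          \<le> W (t0 - real j * \<Delta>, X u j) + \<epsilon> * \<Delta>"
      proof (rule supersolution_step[OF super lipschitz_on_subset[OF r(4)[OF inK] sub] _ _ _ R R0 \<Delta>(1) \<rho>(3) \<epsilon>])
        show "cball (t0 - real j * \<Delta>, X u j) \<rho> \<subseteq> pos_times" using sub r(3)[OF inK] by blast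
        show "convex_on UNIV (envelope (X u j) \<rho>)" using \<rho>(1) by (intro envelope_convex) simp
      qed (auto intro: envelope_le)
      define u' where "u' = u(j := v)"
      have Xeq: "X u' i = X u i" if "i \<le> j" for i
      proof -
        have "(\<Sum>i'<i. u' i') = (\<Sum>i'<i. u i')" by (rule sum.cong) (use that in \<open>auto simp: u'_def\<close>)
        then show ?thesis by (simp add: X_def)
      qed
      have "E u' j = E u j" unfolding E_def by (rule sum.cong) (auto simp: Xeq, auto simp: u'_def)
      then have E': "E u' (Suc j) = E u j + \<Delta> * envelope (X u j) \<rho> v"
        unfolding E_def by (simp add: Xeq) (simp add: u'_def)
      have X': "X u' (Suc j) = X u j + \<Delta> *\<^sub>R v"
        using Xeq[of j] by (simp add: X_def algebra_simps) (simp add: u'_def)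
      have t': "t0 - real (Suc j) * \<Delta> = t0 - real j * \<Delta> - \<Delta>" by (simp add: algebra_simps)
      show ?case
      proof (intro exI[of _ u'] conjI)
        show "\<forall>i<Suc j. norm (u' i) \<le> R" using u(1) v(1) by (auto simp: u'_def less_Suc_eq)
        show "W (t0 - real (Suc j) * \<Delta>, X u' (Suc j)) + E u' (Suc j) \<le> W (t0, x0) + \<epsilon> * (real (Suc j) * \<Delta>)"
          unfolding t' X' E' using v(2) u(2) by (simp add: algebra_simps)
      qed
    qed
    from this[of N] obtain u where u: "\<forall>i<N. norm (u i) \<le> R"
      "W (t0 - real N * \<Delta>, X u N) + E u N \<le> W (t0, x0) + \<epsilon> * (real N * \<Delta>)" by auto
    from bound[OF order_refl u(2)] u
    show "\<exists>u. (\<forall>j<N. norm (u j) \<le> R) \<and> norm (\<Delta> *\<^sub>R (\<Sum>i<N. u i)) \<le> W (t0, x0) + (1 + C1) * t0 \<and>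
        W (\<tau>, x0 + \<Delta> *\<^sub>R (\<Sum>i<N. u i)) +
          (\<Sum>j<N. \<Delta> * envelope (x0 + \<Delta> *\<^sub>R (\<Sum>i<j. u i)) (2 * \<Delta> * (R + 1)) (u j)) \<le> W (t0, x0) + \<epsilon> * (t0 - \<tau>)"
      by (intro exI[of _ u]) (simp add: N X_def E_def \<rho>_def M_def)
  qed
qed

end

section \<open>Lower semicontinuity of the cost along polygons\<close>

lemma dyadic_mesh_tendsto_0: "(\<lambda>n. T / 2 ^ n :: real) \<longlonglongrightarrow> 0"
proof -
  have "(\<lambda>n. T * (1 / 2) ^ n) \<longlonglongrightarrow> T * 0" by (intro tendsto_intros LIMSEQ_power_zero) auto
  then show ?thesis by (simp add: power_divide)
qed

lemma step_function_integral:
  fixes F :: "nat \<Rightarrow> 'b::euclidean_space"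
  assumes "0 < \<delta>"
  shows "set_integrable lborel {0..<real N * \<delta>} (\<lambda>s. F (nat \<lfloor>s / \<delta>\<rfloor>)) \<and>
    (LINT s:{0..<real N * \<delta>}|lborel. F (nat \<lfloor>s / \<delta>\<rfloor>)) = (\<Sum>i<N. \<delta> *\<^sub>R F i)"
proof (induction N)
  case 0
  then show ?case by (simp add: set_lebesgue_integral_def)
next
  case (Suc N)
  let ?A = "{0..<real N * \<delta>}" and ?B = "{real N * \<delta>..<real (Suc N) * \<delta>}" and ?f = "\<lambda>s. F (nat \<lfloor>s / \<delta>\<rfloor>)"
  have const: "?f s = F N" if "s \<in> ?B" for s
  proof -
    have "\<lfloor>s / \<delta>\<rfloor> = int N"
      using that assms by (intro floor_unique) (auto simp: field_simps)
    then show ?thesis by simp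
  qed
  have cI: "set_integrable lborel ?B (\<lambda>s. F N)"
    unfolding set_integrable_def using assms by (intro integrable_scaleR_left integrable_real_indicator) auto
  have B: "set_integrable lborel ?B ?f"
    using cI by (subst set_integrable_cong[OF refl refl, where f' = "\<lambda>s. F N"]) (auto simp: const)
  have "(LINT s:?B|lborel. ?f s) = (LINT s:?B|lborel. F N)"
    by (rule set_lebesgue_integral_cong) (auto simp: const)
  also have "\<dots> = \<delta> *\<^sub>R F N"
    using assms by (simp add: set_lebesgue_integral_def algebra_simps)
  finally have B': "(LINT s:?B|lborel. ?f s) = \<delta> *\<^sub>R F N" .
  have Un: "{0..<real (Suc N) * \<delta>} = ?A \<union> ?B"
    using assms by (intro ivl_disj_un_two(3)[symmetric]) (auto simp: algebra_simps)
  have disj: "?A \<inter> ?B = {}" by auto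
  show ?case
    unfolding Un set_integral_Un[OF disj conjunct1[OF Suc] B] using Suc B B'
    by (auto intro!: set_integrable_Un)
qed

section \<open>Dyadic difference quotients of a Lipschitz curve\<close>

context
  fixes y :: "real \<Rightarrow> 'a::euclidean_space" and R T :: real
  assumes lip: "R-lipschitz_on UNIV y" and T: "0 < T"
begin

definition dquot :: "nat \<Rightarrow> nat \<Rightarrow> 'a" where
  "dquot n i = (2 ^ n / T) *\<^sub>R (y (real (Suc i) * (T / 2 ^ n)) - y (real i * (T / 2 ^ n)))"

lemma norm_dquot_le: "norm (dquot n i) \<le> R"
proof -
  let ?\<delta> = "T / 2 ^ n"
  have "norm (y (real (Suc i) * ?\<delta>) - y (real i * ?\<delta>)) \<le> R * \<bar>real (Suc i) * ?\<delta> - real i * ?\<delta>\<bar>"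
    using lipschitz_onD[OF lip, of "real (Suc i) * ?\<delta>" "real i * ?\<delta>"] by (simp add: dist_norm)
  also have "real (Suc i) * ?\<delta> - real i * ?\<delta> = ?\<delta>" by (simp add: algebra_simps add_divide_distrib)
  finally have "(2 ^ n / T) * norm (y (real (Suc i) * ?\<delta>) - y (real i * ?\<delta>)) \<le> (2 ^ n / T) * (R * \<bar>?\<delta>\<bar>)"
    using T by (intro mult_left_mono) auto
  then have "norm (dquot n i) \<le> (2 ^ n / T) * (R * \<bar>?\<delta>\<bar>)"
    using T unfolding dquot_def norm_scaleR by (simp only: abs_of_pos[of "2 ^ n / T"] divide_pos_pos zero_less_power zero_less_numeral)
  then show ?thesis using T by simp
qed

lemma sum_dquot:
  assumes "a \<le> b"
  shows "(\<Sum>j\<in>{a..<b}. dquot n j) = (2 ^ n / T) *\<^sub>R (y (real b * (T / 2 ^ n)) - y (real a * (T / 2 ^ n)))"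
  unfolding dquot_def scaleR_right.sum[symmetric] using sum_Suc_diff'[OF assms, of "\<lambda>j. y (real j * (T / 2 ^ n))"] by simp

lemma sum_dquot_refine:
  assumes "n \<le> m"
  shows "(\<Sum>j\<in>{i * 2 ^ (m - n)..<i * 2 ^ (m - n) + 2 ^ (m - n)}. dquot m j) = (2 ^ (m - n) :: real) *\<^sub>R dquot n i"
proof -
  have pw: "(2 :: real) ^ m = 2 ^ (m - n) * 2 ^ n" using assms by (simp add: power_add[symmetric])
  have "real (i * 2 ^ (m - n) + 2 ^ (m - n)) * (T / 2 ^ m) = real (Suc i) * (T / 2 ^ n)"
    "real (i * 2 ^ (m - n)) * (T / 2 ^ m) = real i * (T / 2 ^ n)"
    unfolding pw by (simp_all add: field_simps)
  then show ?thesis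
    by (subst sum_dquot) (simp_all add: dquot_def pw)
qed

definition energy :: "nat \<Rightarrow> real" where
  "energy n = (\<Sum>i<2 ^ n. (T / 2 ^ n) * (norm (dquot n i))\<^sup>2)"

text \<open>Pythagoras for martingales: \<open>dquot n i\<close> is the mean of the finer quotients
  in its interval, so increments are orthogonal and \<open>energy\<close> is the squared L2 norm.
  Being monotone and bounded it converges, which makes the quotients Cauchy.\<close>

lemma energy_diff:
  assumes "n \<le> m"
  shows "(\<Sum>j<2 ^ m. (T / 2 ^ m) * (norm (dquot m j - dquot n (j div 2 ^ (m - n))))\<^sup>2) = energy m - energy n"
proof -
  let ?K = "2 ^ (m - n) :: nat"
  have pw: "(2 :: nat) ^ m = 2 ^ n * ?K" using assms by (simp add: power_add[symmetric])
  have pwr: "(2 :: real) ^ m = 2 ^ n * 2 ^ (m - n)" using assms by (simp add: power_add[symmetric])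
  have cell: "(\<Sum>j\<in>{i * ?K..<i * ?K + ?K}. (norm (dquot m j - dquot n (j div ?K)))\<^sup>2)
      = (\<Sum>j\<in>{i * ?K..<i * ?K + ?K}. (norm (dquot m j))\<^sup>2) - 2 ^ (m - n) * (norm (dquot n i))\<^sup>2" for i
  proof -
    let ?q = "dquot n i" and ?I = "{i * ?K..<i * ?K + ?K}"
    have "(\<Sum>j\<in>?I. (norm (dquot m j - dquot n (j div ?K)))\<^sup>2) = (\<Sum>j\<in>?I. (norm (dquot m j - ?q))\<^sup>2)"
    proof (rule sum.cong[OF refl])
      fix j assume "j \<in> ?I"
      then have "j div ?K = i" by (intro div_nat_eqI) (auto simp: algebra_simps)
      then show "(norm (dquot m j - dquot n (j div ?K)))\<^sup>2 = (norm (dquot m j - ?q))\<^sup>2" by simp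
    qed
    also have "\<dots> = (\<Sum>j\<in>?I. (norm (dquot m j))\<^sup>2 - 2 * (dquot m j \<bullet> ?q) + (norm ?q)\<^sup>2)"
      by (simp only: power2_norm_eq_inner) (simp add: inner_diff_left inner_diff_right inner_commute algebra_simps)
    also have "\<dots> = (\<Sum>j\<in>?I. (norm (dquot m j))\<^sup>2) - 2 * ((\<Sum>j\<in>?I. dquot m j) \<bullet> ?q) + 2 ^ (m - n) * (norm ?q)\<^sup>2"
      by (simp add: sum.distrib sum_subtractf sum_distrib_left[symmetric] inner_sum_left)
    also have "(\<Sum>j\<in>?I. dquot m j) \<bullet> ?q = 2 ^ (m - n) * (norm ?q)\<^sup>2"
      unfolding sum_dquot_refine[OF assms] by (simp add: dot_square_norm)
    finally show ?thesis by simp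
  qed
  have "(\<Sum>j<2 ^ m. (T / 2 ^ m) * (norm (dquot m j - dquot n (j div ?K)))\<^sup>2)
      = (T / 2 ^ m) * (\<Sum>i<2 ^ n. \<Sum>j\<in>{i * ?K..<i * ?K + ?K}. (norm (dquot m j - dquot n (j div ?K)))\<^sup>2)"
    unfolding sum_distrib_left[symmetric] pw sum.nat_group[symmetric] ..
  also have "\<dots> = (T / 2 ^ m) * (\<Sum>j<2 ^ m. (norm (dquot m j))\<^sup>2) - (T / 2 ^ m) * (2 ^ (m - n) * (\<Sum>i<2 ^ n. (norm (dquot n i))\<^sup>2))"
    unfolding cell pw sum.nat_group[symmetric] by (simp add: sum_subtractf sum_distrib_left right_diff_distrib)
  also have "(T / 2 ^ m) * (2 ^ (m - n) * (\<Sum>i<2 ^ n. (norm (dquot n i))\<^sup>2)) = (T / 2 ^ n) * (\<Sum>i<2 ^ n. (norm (dquot n i))\<^sup>2)"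
    unfolding pwr by simp
  finally show ?thesis by (simp add: energy_def sum_distrib_left)
qed

lemma energy_Cauchy: "Cauchy energy"
proof -
  have "incseq energy"
  proof (rule monoI)
    fix n m :: nat assume "n \<le> m"
    have "0 \<le> energy m - energy n"
      unfolding energy_diff[OF \<open>n \<le> m\<close>, symmetric] using T by (intro sum_nonneg) auto
    then show "energy n \<le> energy m" by simp
  qed
  moreover have "energy n \<le> T * R\<^sup>2" for n
  proof -
    have "energy n \<le> (\<Sum>i<(2::nat) ^ n. (T / 2 ^ n) * R\<^sup>2)"
      unfolding energy_def using T norm_dquot_le
      by (intro sum_mono mult_left_mono power_mono) auto
    also have "\<dots> = T * R\<^sup>2" by simp
    finally show ?thesis .
  qed
  ultimately show ?thesis by (metis incseq_convergent convergent_def LIMSEQ_imp_Cauchy)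
qed

definition dstep :: "nat \<Rightarrow> real \<Rightarrow> 'a" where
  "dstep n s = dquot n (nat \<lfloor>s / (T / 2 ^ n)\<rfloor>)"

lemma dyadic_length: "real (2 ^ n) * (T / 2 ^ n) = T"
  by simp

lemma dstep_refine:
  assumes "n \<le> m"
  shows "dstep n s = dquot n (nat \<lfloor>s / (T / 2 ^ m)\<rfloor> div 2 ^ (m - n))"
proof -
  have "s / (T / 2 ^ n) = (s / (T / 2 ^ m)) / real_of_int (2 ^ (m - n))"
    using assms T by (simp add: field_simps power_add[symmetric])
  then have "\<lfloor>s / (T / 2 ^ n)\<rfloor> = \<lfloor>s / (T / 2 ^ m)\<rfloor> div (2 ^ (m - n))"
    using floor_divide_real_eq_div[of "2 ^ (m - n)" "s / (T / 2 ^ m)"] by simp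
  then show ?thesis by (simp add: dstep_def nat_div_distrib' nat_power_eq)
qed

lemma dstep_L1:
  assumes "n \<le> m"
  shows "(LINT s|lborel. norm (indicator {0..<T} s *\<^sub>R dstep m s - indicator {0..<T} s *\<^sub>R dstep n s))
    \<le> sqrt (T * (energy m - energy n))"
proof -
  let ?F = "\<lambda>j. norm (dquot m j - dquot n (j div 2 ^ (m - n)))"
  have \<delta>: "0 < T / 2 ^ m" using T by simp
  have "(LINT s|lborel. norm (indicator {0..<T} s *\<^sub>R dstep m s - indicator {0..<T} s *\<^sub>R dstep n s))
      = (LINT s:{0..<T}|lborel. ?F (nat \<lfloor>s / (T / 2 ^ m)\<rfloor>))"
    unfolding set_lebesgue_integral_def
    by (rule Bochner_Integration.integral_cong) (auto simp: dstep_refine[OF assms] dstep_def[of m] indicator_def)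
  also have "\<dots> = (\<Sum>j<2 ^ m. (T / 2 ^ m) * ?F j)"
    using step_function_integral[OF \<delta>, of "2 ^ m" ?F] unfolding dyadic_length by simp
  also have "\<dots> = (\<Sum>j<2 ^ m. sqrt (T / 2 ^ m) * (sqrt (T / 2 ^ m) * ?F j))"
    using T by (intro sum.cong refl) (simp add: mult.assoc[symmetric])
  also have "\<dots> \<le> sqrt (T * (energy m - energy n))"
  proof (rule real_le_rsqrt)
    have "(\<Sum>j<2 ^ m. sqrt (T / 2 ^ m) * (sqrt (T / 2 ^ m) * ?F j))\<^sup>2
        \<le> (\<Sum>j<(2::nat) ^ m. (sqrt (T / 2 ^ m))\<^sup>2) * (\<Sum>j<2 ^ m. (sqrt (T / 2 ^ m) * ?F j)\<^sup>2)"
      by (rule Cauchy_Schwarz_ineq_sum)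
    also have "(\<Sum>j<(2::nat) ^ m. (sqrt (T / 2 ^ m))\<^sup>2) = T" using \<delta> T by simp
    also have "(\<Sum>j<2 ^ m. (sqrt (T / 2 ^ m) * ?F j)\<^sup>2) = energy m - energy n"
      unfolding energy_diff[OF assms, symmetric] power_mult_distrib using \<delta> by simp
    finally show "(\<Sum>j<2 ^ m. sqrt (T / 2 ^ m) * (sqrt (T / 2 ^ m) * ?F j))\<^sup>2 \<le> T * (energy m - energy n)" .
  qed
  finally show ?thesis .
qed

lemma dstep_set_integrable: "set_integrable lborel {0..<T} (dstep n)"
  using step_function_integral[of "T / 2 ^ n" "2 ^ n" "dquot n"] T
  unfolding dyadic_length dstep_def[abs_def] by simp

text \<open>Complete cells telescope to increments of \<open>y\<close>; the last, incomplete cell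
  contributes at most \<open>R\<close> times the mesh to the integral and as much to
  \<open>y\<close>.\<close>

lemma dstep_integral_close:
  assumes s: "0 \<le> s" "s \<le> T"
  shows "norm ((LINT r:{0..s}|lborel. indicator {0..<T} r *\<^sub>R dstep n r) - (y s - y 0)) \<le> 2 * R * (T / 2 ^ n)"
proof -
  let ?\<delta> = "T / 2 ^ n" and ?S = "\<lambda>r. indicator {0..<T} r *\<^sub>R dstep n r"
  have \<delta>: "0 < ?\<delta>" using T by simp
  define m where "m = nat \<lfloor>s / ?\<delta>\<rfloor>"
  have m1: "real m * ?\<delta> \<le> s" "s \<le> real m * ?\<delta> + ?\<delta>"
  proof -
    have "real m \<le> s / ?\<delta>" "s / ?\<delta> \<le> real m + 1"
      unfolding m_def using s \<delta> by auto
    then show "real m * ?\<delta> \<le> s" "s \<le> real m * ?\<delta> + ?\<delta>"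
      using \<delta> T by (auto simp: field_simps)
  qed
  have SI: "integrable lborel ?S" using dstep_set_integrable by (simp add: set_integrable_def)
  have SI': "set_integrable lborel A ?S" if "A \<in> sets borel" for A
    unfolding set_integrable_def by (rule integrable_mult_indicator[OF _ SI]) (use that in simp)
  have "{0..s} = {0..<real m * ?\<delta>} \<union> {real m * ?\<delta>..s}"
    using m1 T by (intro ivl_disj_un_two(7)[symmetric]) auto
  then have "(LINT r:{0..s}|lborel. ?S r) = (LINT r:{0..<real m * ?\<delta>}|lborel. ?S r) + (LINT r:{real m * ?\<delta>..s}|lborel. ?S r)"
    by (simp only:) (rule set_integral_Un, auto intro: SI')
  also have "(LINT r:{0..<real m * ?\<delta>}|lborel. ?S r) = (LINT r:{0..<real m * ?\<delta>}|lborel. dstep n r)"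
    by (rule set_lebesgue_integral_cong) (use m1 s in auto)
  also have "\<dots> = (\<Sum>i<m. ?\<delta> *\<^sub>R dquot n i)"
    using step_function_integral[OF \<delta>, of m "dquot n"] unfolding dstep_def by simp
  also have "\<dots> = y (real m * ?\<delta>) - y 0"
    using sum_dquot[of 0 m n] T by (simp add: scaleR_right.sum[symmetric] atLeast0LessThan)
  finally have eq: "(LINT r:{0..s}|lborel. ?S r) - (y s - y 0)
      = (LINT r:{real m * ?\<delta>..s}|lborel. ?S r) - (y s - y (real m * ?\<delta>))" by simp
  have R0: "0 \<le> R" using lip by (rule lipschitz_on_nonneg)
  have cI: "set_integrable lborel {real m * ?\<delta>..s} (\<lambda>r. R)"
    by (rule set_integrable_const_Icc)
  have "norm (LINT r:{real m * ?\<delta>..s}|lborel. ?S r) \<le> (LINT r:{real m * ?\<delta>..s}|lborel. norm (?S r))"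
    by (rule set_integral_norm_bound[OF SI']) auto
  also have "\<dots> \<le> (LINT r:{real m * ?\<delta>..s}|lborel. R)"
    by (intro set_integral_mono set_integrable_norm SI' cI)
       (auto simp: indicator_def dstep_def norm_dquot_le R0)
  also have "\<dots> = R * (s - real m * ?\<delta>)" using m1 by (simp add: set_lebesgue_integral_def mult.commute)
  also have "\<dots> \<le> R * ?\<delta>" using m1 R0 by (intro mult_left_mono) auto
  finally have 1: "norm (LINT r:{real m * ?\<delta>..s}|lborel. ?S r) \<le> R * ?\<delta>" .
  have "norm (y s - y (real m * ?\<delta>)) \<le> R * \<bar>s - real m * ?\<delta>\<bar>"
    using lipschitz_onD[OF lip, of s "real m * ?\<delta>"] by (simp add: dist_norm)
  also have "\<dots> \<le> R * ?\<delta>" using m1 R0 by (intro mult_left_mono) auto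
  finally have 2: "norm (y s - y (real m * ?\<delta>)) \<le> R * ?\<delta>" .
  show ?thesis
    unfolding eq using 1 2 norm_triangle_ineq4[of "LINT r:{real m * ?\<delta>..s}|lborel. ?S r" "y s - y (real m * ?\<delta>)"]
    by simp
qed

text \<open>Besides providing a derivative, this records that dyadic quotients converge to it almost
  everywhere along a subsequence. The same quotients come out of Jensen's inequality, so Fatou's
  lemma can use precisely this convergence.\<close>

lemma lipschitz_W11:
  obtains g r where "W11 0 T y g" "strict_mono (r :: nat \<Rightarrow> nat)"
    "AE s in lborel. s \<in> {0..<T} \<longrightarrow> (\<lambda>n. dstep (r n) s) \<longlonglongrightarrow> g s"
proof -
  let ?S = "\<lambda>n s. indicator {0..<T} s *\<^sub>R dstep n s"
  have SI: "integrable lborel (?S n)" for n using dstep_set_integrable by (simp add: set_integrable_def)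
  have "\<exists>N. \<forall>i\<ge>N. \<forall>j\<ge>N. (LINT s|lborel. norm (?S i s - ?S j s)) < e" if "0 < e" for e
  proof -
    have "0 < e\<^sup>2 / T" using that T by simp
    then obtain N where N: "\<And>i j. N \<le> i \<Longrightarrow> N \<le> j \<Longrightarrow> \<bar>energy i - energy j\<bar> < e\<^sup>2 / T"
      using energy_Cauchy unfolding Cauchy_def dist_real_def by blast
    have *: "(LINT s|lborel. norm (?S i s - ?S j s)) < e" if "N \<le> j" "j \<le> i" for i j
    proof -
      have "T * (energy i - energy j) < T * (e\<^sup>2 / T)"
        using N[of i j] that T by (intro mult_strict_left_mono) auto
      then have "sqrt (T * (energy i - energy j)) < sqrt (e\<^sup>2)" using T by (intro real_sqrt_less_mono) simp
      then show ?thesis using dstep_L1[OF that(2)] \<open>0 < e\<close> by simp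
    qed
    have "(LINT s|lborel. norm (?S i s - ?S j s)) < e" if "N \<le> i" "N \<le> j" for i j
      using *[of j i] *[of i j] that by (cases "j \<le> i") (auto simp: norm_minus_commute)
    then show ?thesis by blast
  qed
  then obtain r where r: "strict_mono r" "AE s in lborel. Cauchy (\<lambda>i. ?S (r i) s)"
    using cauchy_L1_AE_cauchy_subseq[of lborel ?S] SI by blast
  define g where "g s = lim (\<lambda>i. ?S (r i) s)" for s
  have conv: "AE s in lborel. (\<lambda>i. ?S (r i) s) \<longlonglongrightarrow> g s"
    using r(2) by eventually_elim (simp add: g_def Cauchy_convergent_iff convergent_LIMSEQ_iff)
  have gm[measurable]: "g \<in> borel_measurable lborel"
    unfolding g_def by (rule borel_measurable_lim_metric) (use SI in auto)
  have R0: "0 \<le> R" using lip by (rule lipschitz_on_nonneg)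
  have dom: "integrable lborel (\<lambda>s. indicator {0..b} s *\<^sub>R g s)"
      "(\<lambda>i. LINT s:{0..b}|lborel. ?S (r i) s) \<longlonglongrightarrow> (LINT s:{0..b}|lborel. g s)" if "b \<le> T" for b
  proof -
    have wI: "integrable lborel (\<lambda>s. indicator {0..T} s * R)"
      using T by (intro integrable_mult_left integrable_real_indicator) auto
    have m: "(\<lambda>s. indicator {0..b} s *\<^sub>R ?S (r i) s) \<in> borel_measurable lborel" for i
      using SI[of "r i"] by measurable
    have lim: "AE s in lborel. (\<lambda>i. indicator {0..b} s *\<^sub>R ?S (r i) s) \<longlonglongrightarrow> indicator {0..b} s *\<^sub>R g s"
      using conv by eventually_elim (intro tendsto_intros)
    have bd: "AE s in lborel. norm (indicator {0..b} s *\<^sub>R ?S (r i) s) \<le> indicator {0..T} s * R" for i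
      using that R0 by (intro AE_I2) (auto simp: indicator_def dstep_def norm_dquot_le)
    show "integrable lborel (\<lambda>s. indicator {0..b} s *\<^sub>R g s)"
      by (rule integrable_dominated_convergence[OF _ m wI lim bd]) measurable
    show "(\<lambda>i. LINT s:{0..b}|lborel. ?S (r i) s) \<longlonglongrightarrow> (LINT s:{0..b}|lborel. g s)"
      unfolding set_lebesgue_integral_def
      by (rule integral_dominated_convergence[OF _ m wI lim bd]) measurable
  qed
  show thesis
  proof (rule that[OF _ r(1)])
    show "W11 0 T y g"
      unfolding W11_def
    proof (intro conjI ballI)
      show "set_integrable lborel {0..T} g" using dom(1)[of T] by (simp add: set_integrable_def)
      fix s assume s: "s \<in> {0..T}"
      have "(\<lambda>n. 2 * R * (T / 2 ^ n)) \<longlonglongrightarrow> 2 * R * 0"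
        by (intro tendsto_intros dyadic_mesh_tendsto_0)
      then have "(\<lambda>n. 2 * R * (T / 2 ^ n)) \<longlonglongrightarrow> 0" by simp
      then have "(\<lambda>i. (LINT x:{0..s}|lborel. ?S i x) - (y s - y 0)) \<longlonglongrightarrow> 0"
        by (rule Lim_null_comparison[rotated]) (use s dstep_integral_close in auto)
      then have "(\<lambda>i. LINT x:{0..s}|lborel. ?S i x) \<longlonglongrightarrow> y s - y 0" by (simp add: LIM_zero_iff)
      from LIMSEQ_subseq_LIMSEQ[OF this r(1)]
      have "(\<lambda>i. LINT x:{0..s}|lborel. ?S (r i) x) \<longlonglongrightarrow> y s - y 0" by (simp add: o_def)
      with dom(2)[of s] s have "(LINT x:{0..s}|lborel. g x) = y s - y 0"
        by (auto intro: LIMSEQ_unique)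
      then show "y s = y 0 + (LINT x:{0..s}|lborel. g x)" by simp
    qed
    show "AE s in lborel. s \<in> {0..<T} \<longrightarrow> (\<lambda>n. dstep (r n) s) \<longlonglongrightarrow> g s"
      using conv by eventually_elim auto
  qed
qed

end

text \<open>The part of the interval from \<open>j * \<Delta>\<close> to
  \<open>(j + 1) * \<Delta>\<close> elapsed at time \<open>s\<close>. With these weights a polygon
  is a single sum without cases; it is constant outside its time interval, hence Lipschitz on the
  whole line.\<close>

definition clamp_step :: "real \<Rightarrow> nat \<Rightarrow> real \<Rightarrow> real" where
  "clamp_step \<Delta> j s = max 0 (min \<Delta> (s - real j * \<Delta>))"

lemma sum_clamp_step:
  assumes "0 < \<Delta>"
  shows "(\<Sum>j<N. clamp_step \<Delta> j s) = max 0 (min s (real N * \<Delta>))"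
proof (induction N)
  case 0
  then show ?case by simp
next
  case (Suc N)
  have key: "max 0 (min s a) + max 0 (min \<Delta> (s - a)) = max 0 (min s (a + \<Delta>))" if "0 \<le> a" for a
    using that assms by linarith
  have "(\<Sum>j<Suc N. clamp_step \<Delta> j s) = max 0 (min s (real N * \<Delta>)) + clamp_step \<Delta> N s"
    by (simp only: sum.lessThan_Suc Suc)
  also have "\<dots> = max 0 (min s (real N * \<Delta> + \<Delta>))"
    unfolding clamp_step_def using assms by (intro key) simp
  also have "real N * \<Delta> + \<Delta> = real (Suc N) * \<Delta>" by (simp add: algebra_simps)
  finally show ?case .
qed

definition polygon :: "real \<Rightarrow> nat \<Rightarrow> 'a::euclidean_space \<Rightarrow> (nat \<Rightarrow> 'a) \<Rightarrow> real \<Rightarrow> 'a" where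
  "polygon \<Delta> N x u s = x + (\<Sum>j<N. clamp_step \<Delta> j s *\<^sub>R u j)"

lemma polygon_node:
  assumes "0 < \<Delta>" "m \<le> N"
  shows "polygon \<Delta> N x u (real m * \<Delta>) = x + \<Delta> *\<^sub>R (\<Sum>j<m. u j)"
proof -
  have "(\<Sum>j<N. clamp_step \<Delta> j (real m * \<Delta>) *\<^sub>R u j) = (\<Sum>j<m. clamp_step \<Delta> j (real m * \<Delta>) *\<^sub>R u j)"
  proof (rule sum.mono_neutral_right)
    show "\<forall>j\<in>{..<N} - {..<m}. clamp_step \<Delta> j (real m * \<Delta>) *\<^sub>R u j = 0"
    proof
      fix j assume "j \<in> {..<N} - {..<m}"
      then have "real m * \<Delta> \<le> real j * \<Delta>" using assms by (intro mult_right_mono) auto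
      then show "clamp_step \<Delta> j (real m * \<Delta>) *\<^sub>R u j = 0" by (simp add: clamp_step_def)
    qed
  qed (use assms in auto)
  also have "\<dots> = (\<Sum>j<m. \<Delta> *\<^sub>R u j)"
  proof (rule sum.cong[OF refl])
    fix j assume "j \<in> {..<m}"
    then have "real (Suc j) * \<Delta> \<le> real m * \<Delta>" using assms by (intro mult_right_mono) auto
    then show "clamp_step \<Delta> j (real m * \<Delta>) *\<^sub>R u j = \<Delta> *\<^sub>R u j"
      using assms by (simp add: clamp_step_def algebra_simps)
  qed
  finally show ?thesis by (simp add: polygon_def scaleR_right.sum)
qed

lemma polygon_lipschitz:
  assumes "0 < \<Delta>" "0 \<le> R" and u: "\<And>j. j < N \<Longrightarrow> norm (u j) \<le> R"
  shows "R-lipschitz_on UNIV (polygon \<Delta> N x u)"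
proof (rule lipschitz_onI)
  have *: "norm (polygon \<Delta> N x u s' - polygon \<Delta> N x u s) \<le> R * (s' - s)" if "s \<le> s'" for s s'
  proof -
    have mono: "clamp_step \<Delta> j s \<le> clamp_step \<Delta> j s'" for j
      using that by (auto simp: clamp_step_def)
    have "polygon \<Delta> N x u s' - polygon \<Delta> N x u s = (\<Sum>j<N. (clamp_step \<Delta> j s' - clamp_step \<Delta> j s) *\<^sub>R u j)"
      by (simp add: polygon_def sum_subtractf algebra_simps)
    also have "norm \<dots> \<le> (\<Sum>j<N. (clamp_step \<Delta> j s' - clamp_step \<Delta> j s) * R)"
      using mono u by (intro sum_norm_le) (auto intro!: mult_left_mono)
    also have "\<dots> = R * ((\<Sum>j<N. clamp_step \<Delta> j s') - (\<Sum>j<N. clamp_step \<Delta> j s))"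
      by (simp add: sum_distrib_right[symmetric] sum_subtractf)
    also have "\<dots> \<le> R * (s' - s)"
      unfolding sum_clamp_step[OF assms(1)] using that assms(2) by (intro mult_left_mono) auto
    finally show ?thesis .
  qed
  fix s s' :: real
  show "dist (polygon \<Delta> N x u s) (polygon \<Delta> N x u s') \<le> R * dist s s'"
    using *[of s s'] *[of s' s] by (cases "s \<le> s'") (auto simp: dist_norm norm_minus_commute)
qed (rule assms(2))

section \<open>From costs of polygons to the cost of a limit curve\<close>

context tonelli_lagrangian
begin

text \<open>Jensen's inequality on each interval of level \<open>n\<close>, where the coarse
  quotient is the mean of the fine velocities. The radius \<open>(R + 1) * (T / 2 ^ n)\<close>
  covers all the fine balls: \<open>R\<close> accounts for the motion of \<open>Y\<close> during the
  interval, 1 for its distance to \<open>y\<close> and for \<open>\<rho>\<close>. The left side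
  involves a fixed number of convex functions that depend on \<open>y\<close> alone, ready for a
  limit in \<open>Y\<close>.\<close>

lemma envelope_sum_coarsen:
  assumes "n \<le> m" "0 < T" "0 \<le> R" "0 \<le> \<rho>"
    and u: "\<And>j. j < 2 ^ m \<Longrightarrow> norm (u j) \<le> R"
    and Y: "Y = polygon (T / 2 ^ m) (2 ^ m) x u"
    and close: "\<And>i. i < 2 ^ n \<Longrightarrow> norm (Y (real i * (T / 2 ^ n)) - y (real i * (T / 2 ^ n))) + \<rho> \<le> T / 2 ^ n"
  shows "(\<Sum>i<2 ^ n. (T / 2 ^ n) * envelope (y (real i * (T / 2 ^ n))) ((R + 1) * (T / 2 ^ n)) (dquot Y T n i))
    \<le> (\<Sum>j<2 ^ m. (T / 2 ^ m) * envelope (x + (T / 2 ^ m) *\<^sub>R (\<Sum>i<j. u i)) \<rho> (u j))"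
proof -
  let ?K = "2 ^ (m - n) :: nat" and ?\<delta> = "T / 2 ^ n" and ?\<Delta> = "T / 2 ^ m"
  have pw: "(2 :: nat) ^ m = 2 ^ n * ?K" using assms(1) by (simp add: power_add[symmetric])
  have pwr: "(2 :: real) ^ m = 2 ^ n * 2 ^ (m - n)" using assms(1) by (simp add: power_add[symmetric])
  have \<Delta>: "0 < ?\<Delta>" and \<delta>: "0 < ?\<delta>" using assms(2) by auto
  have \<delta>\<Delta>: "?\<delta> = 2 ^ (m - n) * ?\<Delta>" unfolding pwr by simp
  have lip: "R-lipschitz_on UNIV Y" unfolding Y by (rule polygon_lipschitz[OF \<Delta> assms(3)]) (use u in auto)
  have node: "x + ?\<Delta> *\<^sub>R (\<Sum>i<j. u i) = Y (real j * ?\<Delta>)" if "j \<le> 2 ^ m" for j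
    unfolding Y by (rule polygon_node[OF \<Delta> that, symmetric])
  have quot: "dquot Y T m j = u j" if "j < 2 ^ m" for j
  proof -
    have "Y (real (Suc j) * ?\<Delta>) = x + ?\<Delta> *\<^sub>R (\<Sum>i<j. u i) + ?\<Delta> *\<^sub>R u j"
      by (rule trans[OF node[symmetric]]) (use that in \<open>simp_all add: scaleR_add_right add.assoc\<close>)
    moreover have "Y (real j * ?\<Delta>) = x + ?\<Delta> *\<^sub>R (\<Sum>i<j. u i)"
      by (rule node[symmetric]) (use that in simp)
    ultimately have "Y (real (Suc j) * ?\<Delta>) - Y (real j * ?\<Delta>) = ?\<Delta> *\<^sub>R u j"
      by (simp only: add_diff_cancel_left')
    then show ?thesis unfolding dquot_def[OF lip assms(2)] using assms(2) by simp
  qed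
  have cell: "?\<delta> * envelope (y (real i * ?\<delta>)) ((R + 1) * ?\<delta>) (dquot Y T n i)
      \<le> (\<Sum>j\<in>{i * ?K..<i * ?K + ?K}. ?\<Delta> * envelope (x + ?\<Delta> *\<^sub>R (\<Sum>i<j. u i)) \<rho> (u j))" if i: "i < 2 ^ n" for i
  proof -
    let ?I = "{i * ?K..<i * ?K + ?K}" and ?e = "envelope (y (real i * ?\<delta>)) ((R + 1) * ?\<delta>)"
    have "Suc i * ?K \<le> 2 ^ m" unfolding pw using i by (intro mult_le_mono1) simp
    then have I: "j < 2 ^ m" if "j \<in> ?I" for j using that by simp
    have nonneg: "0 \<le> (R + 1) * ?\<delta>" using assms \<delta> by simp
    have "dquot Y T n i = (\<Sum>j\<in>?I. (1 / 2 ^ (m - n)) *\<^sub>R dquot Y T m j)"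
      unfolding scaleR_right.sum[symmetric] sum_dquot_refine[OF lip assms(2,1)] by simp
    also have "\<dots> = (\<Sum>j\<in>?I. (1 / 2 ^ (m - n)) *\<^sub>R u j)"
      by (rule sum.cong) (auto simp: quot I)
    finally have "?e (dquot Y T n i) = ?e (\<Sum>j\<in>?I. (1 / 2 ^ (m - n)) *\<^sub>R u j)" by simp
    also have "\<dots> \<le> (\<Sum>j\<in>?I. (1 / 2 ^ (m - n)) * ?e (u j))"
      by (rule convex_on_sum[OF _ _ envelope_convex[OF nonneg]]) auto
    also have "\<dots> \<le> (\<Sum>j\<in>?I. (1 / 2 ^ (m - n)) * envelope (x + ?\<Delta> *\<^sub>R (\<Sum>i<j. u i)) \<rho> (u j))"
    proof (intro sum_mono mult_left_mono envelope_antimono)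
      fix j assume j: "j \<in> ?I"
      have "dist (Y (real j * ?\<Delta>)) (Y (real i * ?\<delta>)) \<le> R * \<bar>real j * ?\<Delta> - real i * ?\<delta>\<bar>"
        using lipschitz_onD[OF lip, of "real j * ?\<Delta>" "real i * ?\<delta>"] by (simp add: dist_real_def)
      also have "\<dots> \<le> R * ?\<delta>"
      proof (intro mult_left_mono assms(3))
        have "real (i * ?K) * ?\<Delta> \<le> real j * ?\<Delta>" "real j * ?\<Delta> \<le> real (i * ?K + ?K) * ?\<Delta>"
          by (rule mult_right_mono[OF _ less_imp_le[OF \<Delta>]], unfold of_nat_le_iff, use j in simp)+
        then show "\<bar>real j * ?\<Delta> - real i * ?\<delta>\<bar> \<le> ?\<delta>" unfolding \<delta>\<Delta> by (simp add: algebra_simps)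
      qed
      finally have "dist (Y (real j * ?\<Delta>)) (y (real i * ?\<delta>)) + \<rho> \<le> (R + 1) * ?\<delta>"
        using close[OF i] dist_triangle[of "Y (real j * ?\<Delta>)" "y (real i * ?\<delta>)" "Y (real i * ?\<delta>)"]
        unfolding dist_norm distrib_right mult_1_left by linarith
      then show "cball (x + ?\<Delta> *\<^sub>R (\<Sum>i<j. u i)) \<rho> \<subseteq> cball (y (real i * ?\<delta>)) ((R + 1) * ?\<delta>)"
        unfolding node[OF less_imp_le[OF I[OF j]]] by (simp add: cball_subset_cball_iff)
    qed (use assms in auto)
    finally have "?\<delta> * ?e (dquot Y T n i) \<le> ?\<delta> * (\<Sum>j\<in>?I. (1 / 2 ^ (m - n)) * envelope (x + ?\<Delta> *\<^sub>R (\<Sum>i<j. u i)) \<rho> (u j))"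
      using \<delta> by (intro mult_left_mono) auto
    also have "\<dots> = (\<Sum>j\<in>?I. ?\<Delta> * envelope (x + ?\<Delta> *\<^sub>R (\<Sum>i<j. u i)) \<rho> (u j))"
      unfolding \<delta>\<Delta> sum_distrib_left by (rule sum.cong) auto
    finally show ?thesis .
  qed
  show ?thesis
    unfolding pw sum.nat_group[symmetric] by (intro sum_mono) (use cell in auto)
qed

text \<open>Fatou's lemma. The dyadic sums are integrals of step functions whose velocities tend to
  \<open>g s\<close> for almost every \<open>s\<close> while their balls shrink to
  \<open>y s\<close>, so \<open>envelope_lower_bound\<close> puts \<open>L (y s) (g s)\<close> below
  their lower limit.\<close>

lemma cost_le_of_dyadic_sums:
  assumes lip: "R-lipschitz_on UNIV y" and T: "0 < T"
    and sums: "\<And>n. (\<Sum>i<2 ^ n. (T / 2 ^ n) * envelope (y (real i * (T / 2 ^ n))) ((R + 1) * (T / 2 ^ n)) (dquot y T n i)) \<le> B"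
  shows "trans_cost L T (y 0) (y T) \<le> ennreal B"
proof -
  obtain g r where g: "W11 0 T y g" "strict_mono (r :: nat \<Rightarrow> nat)"
    "AE s in lborel. s \<in> {0..<T} \<longrightarrow> (\<lambda>n. dstep y T (r n) s) \<longlonglongrightarrow> g s"
    by (rule lipschitz_W11[OF lip T])
  have R0: "0 \<le> R" using lip by (rule lipschitz_on_nonneg)
  define F where "F n i = envelope (y (real i * (T / 2 ^ n))) ((R + 1) * (T / 2 ^ n)) (dquot y T n i)" for n i
  define f where "f n s = F n (nat \<lfloor>s / (T / 2 ^ n)\<rfloor>)" for n s
  have F0: "0 \<le> F n i" for n i unfolding F_def using R0 T by (intro envelope_nonneg) auto
  have fI: "set_integrable lborel {0..<T} (f n)" "(LINT s:{0..<T}|lborel. f n s) \<le> B" for n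
    using step_function_integral[of "T / 2 ^ n" "2 ^ n" "F n"] T sums[of n]
    unfolding dyadic_length[OF lip T] f_def[abs_def] F_def by auto
  have int: "(\<integral>\<^sup>+s. ennreal (indicator {0..<T} s *\<^sub>R f n s) \<partial>lborel) \<le> ennreal B" for n
  proof -
    have "(\<integral>\<^sup>+s. ennreal (indicator {0..<T} s *\<^sub>R f n s) \<partial>lborel) = ennreal (LINT s:{0..<T}|lborel. f n s)"
      unfolding set_lebesgue_integral_def using fI(1) F0
      by (intro nn_integral_eq_integral) (auto simp: set_integrable_def f_def)
    then show ?thesis using fI(2) by (simp add: ennreal_leI)
  qed
  have \<delta>0: "(\<lambda>n. T / 2 ^ r n) \<longlonglongrightarrow> 0"
  proof -
    from LIMSEQ_subseq_LIMSEQ[OF dyadic_mesh_tendsto_0 g(2)] show ?thesis by (simp add: o_def)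
  qed
  have "AE s in lborel. ennreal (L (y s) (g s)) * indicator {0..T} s
      \<le> liminf (\<lambda>n. ennreal (indicator {0..<T} s *\<^sub>R f (r n) s))"
    using g(3) AE_lborel_singleton[of T]
  proof eventually_elim
    fix s assume conv: "s \<in> {0..<T} \<longrightarrow> (\<lambda>n. dstep y T (r n) s) \<longlonglongrightarrow> g s" and "s \<noteq> T"
    show "ennreal (L (y s) (g s)) * indicator {0..T} s \<le> liminf (\<lambda>n. ennreal (indicator {0..<T} s *\<^sub>R f (r n) s))"
    proof (cases "s \<in> {0..<T}")
      case True
      have "ennreal (L (y s) (g s)) \<le> liminf (\<lambda>n. ennreal (f (r n) s))"
        unfolding le_Liminf_iff
      proof (intro allI impI)
        fix c assume c: "c < ennreal (L (y s) (g s))"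
        then obtain c' where c': "c = ennreal c'" "0 \<le> c'" "c' < L (y s) (g s)"
          by (cases c) (auto simp: ennreal_less_iff)
        define \<epsilon> where "\<epsilon> = (L (y s) (g s) - c') / 2"
        have "0 < \<epsilon>" using c' by (simp add: \<epsilon>_def)
        then obtain \<rho> q where \<rho>: "0 < \<rho>" and q: "\<And>y' \<sigma> v. cball y' \<sigma> \<subseteq> cball (y s) \<rho> \<Longrightarrow> 0 \<le> \<sigma> \<Longrightarrow>
            L (y s) (g s) - \<epsilon> + q \<bullet> (v - g s) \<le> envelope y' \<sigma> v"
          using envelope_lower_bound[of \<epsilon> "y s" "g s"] by metis
        have "(\<lambda>n. q \<bullet> (dstep y T (r n) s - g s)) \<longlonglongrightarrow> q \<bullet> (g s - g s)"
          using conv True by (intro tendsto_intros) auto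
        then have "\<forall>\<^sub>F n in sequentially. - \<epsilon> < q \<bullet> (dstep y T (r n) s - g s)"
          using \<open>0 < \<epsilon>\<close> by (intro order_tendstoD(1)) auto
        \<comment> \<open>\<open>R\<close> times the mesh bounds the distance from
          \<open>y s\<close> to the preceding node, and \<open>R + 1\<close> times the mesh is the
          radius of the ball there.\<close>
        moreover have "(\<lambda>n. (2 * R + 1) * (T / 2 ^ r n)) \<longlonglongrightarrow> (2 * R + 1) * 0"
          by (intro tendsto_intros \<delta>0)
        then have "\<forall>\<^sub>F n in sequentially. (2 * R + 1) * (T / 2 ^ r n) < \<rho>"
          using \<rho> by (intro order_tendstoD(2)) auto
        ultimately show "\<forall>\<^sub>F n in sequentially. c < ennreal (f (r n) s)"
        proof eventually_elim
          case (elim n)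
          let ?\<delta> = "T / 2 ^ r n"
          define i where "i = nat \<lfloor>s / ?\<delta>\<rfloor>"
          have \<delta>: "0 < ?\<delta>" using T by simp
          have "real i \<le> s / ?\<delta>" "s / ?\<delta> \<le> real i + 1"
            unfolding i_def using True \<delta> by auto
          then have "real i * ?\<delta> \<le> s" "s \<le> real i * ?\<delta> + ?\<delta>" using \<delta> T by (auto simp: field_simps)
          then have "R * \<bar>real i * ?\<delta> - s\<bar> \<le> R * ?\<delta>" by (intro mult_left_mono R0) auto
          then have "dist (y (real i * ?\<delta>)) (y s) \<le> R * ?\<delta>"
            using lipschitz_onD[OF lip, of "real i * ?\<delta>" s] by (simp add: dist_real_def)
          moreover have "(2 * R + 1) * ?\<delta> = R * ?\<delta> + (R + 1) * ?\<delta>" unfolding distrib_right by simp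
          ultimately have "dist (y (real i * ?\<delta>)) (y s) + (R + 1) * ?\<delta> \<le> (2 * R + 1) * ?\<delta>" by linarith
          with elim(2) have "cball (y (real i * ?\<delta>)) ((R + 1) * ?\<delta>) \<subseteq> cball (y s) \<rho>"
            by (simp add: cball_subset_cball_iff)
          from q[OF this, of "dquot y T (r n) i"]
          have "L (y s) (g s) - \<epsilon> + q \<bullet> (dstep y T (r n) s - g s) \<le> f (r n) s"
            using R0 T by (simp add: f_def F_def i_def dstep_def[OF lip T])
          with elim(1) have "c' < f (r n) s" by (simp add: \<epsilon>_def field_simps)
          then show ?case using c' by (simp add: ennreal_less_iff)
        qed
      qed
      with True show ?thesis by simp
    qed (use \<open>s \<noteq> T\<close> in auto)
  qed
  then have "cost L 0 T y g \<le> (\<integral>\<^sup>+s. liminf (\<lambda>n. ennreal (indicator {0..<T} s *\<^sub>R f (r n) s)) \<partial>lborel)"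
    unfolding cost_def by (rule nn_integral_mono_AE)
  also have "\<dots> \<le> liminf (\<lambda>n. \<integral>\<^sup>+s. ennreal (indicator {0..<T} s *\<^sub>R f (r n) s) \<partial>lborel)"
    using fI(1) by (intro nn_integral_liminf) (auto simp: set_integrable_def)
  also have "\<dots> \<le> liminf (\<lambda>n. ennreal B)" using int by (intro Liminf_mono) auto
  also have "\<dots> = ennreal B" by (simp add: Liminf_const)
  finally show ?thesis using trans_cost_le_cost[OF g(1)] by (auto intro: order_trans)
qed

end

section \<open>Supersolutions\<close>

context tonelli_lagrangian
begin

text \<open>Two limits in a fixed order: for each level \<open>n\<close> the polygons tend to
  \<open>y\<close> in finitely many continuous convex functions, and only afterwards does
  \<open>n\<close> grow, inside \<open>cost_le_of_dyadic_sums\<close>.\<close>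

lemma supersolution_curve:
  assumes super: "HJ_super L W" and lip: "locally_Lipschitz_on pos_times W"
    and nonneg: "\<And>z. z \<in> pos_times \<Longrightarrow> 0 \<le> W z"
    and C1: "0 \<le> C1" "\<And>x u. norm u - C1 \<le> L x u"
    and \<tau>: "0 < \<tau>" "\<tau> < t0" and \<epsilon>: "0 < \<epsilon>" "\<epsilon> \<le> 1"
  obtains z where "norm (z - x0) \<le> W (t0, x0) + (1 + C1) * t0"
    "trans_cost L (t0 - \<tau>) x0 z + ennreal (W (\<tau>, z)) \<le> ennreal (W (t0, x0) + \<epsilon> * (t0 - \<tau>))"
proof -
  define T where "T = t0 - \<tau>"
  have T: "0 < T" using \<tau> by (simp add: T_def)
  define M where "M = W (t0, x0) + (1 + C1) * t0"
  obtain R \<Delta>0 where R: "0 \<le> R" "0 < \<Delta>0" and chain: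
    "\<forall>\<Delta> N. 0 < \<Delta> \<longrightarrow> \<Delta> \<le> \<Delta>0 \<longrightarrow> real N * \<Delta> = t0 - \<tau> \<longrightarrow>
      (\<exists>u. (\<forall>j<N. norm (u j) \<le> R) \<and>
        norm (\<Delta> *\<^sub>R (\<Sum>i<N. u i)) \<le> M \<and>
        W (\<tau>, x0 + \<Delta> *\<^sub>R (\<Sum>i<N. u i)) +
          (\<Sum>j<N. \<Delta> * envelope (x0 + \<Delta> *\<^sub>R (\<Sum>i<j. u i)) (2 * \<Delta> * (R + 1)) (u j)) \<le> W (t0, x0) + \<epsilon> * (t0 - \<tau>))"
    unfolding M_def by (rule supersolution_chain[OF super lip nonneg C1 \<tau> \<epsilon>, of x0])
  from order_tendstoD(2)[OF dyadic_mesh_tendsto_0 R(2)] obtain k0 where k0: "\<And>m. k0 \<le> m \<Longrightarrow> T / 2 ^ m < \<Delta>0"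
    unfolding eventually_sequentially by blast
  define Q where "Q m u \<longleftrightarrow> (\<forall>j<(2::nat) ^ m. norm (u j) \<le> R) \<and>
        norm ((T / 2 ^ m) *\<^sub>R (\<Sum>i<(2::nat) ^ m. u i)) \<le> M \<and>
        W (\<tau>, x0 + (T / 2 ^ m) *\<^sub>R (\<Sum>i<(2::nat) ^ m. u i)) +
          (\<Sum>j<(2::nat) ^ m. (T / 2 ^ m) * envelope (x0 + (T / 2 ^ m) *\<^sub>R (\<Sum>i<j. u i)) (2 * (T / 2 ^ m) * (R + 1)) (u j))
          \<le> W (t0, x0) + \<epsilon> * T" for m u
  define u where "u m = (SOME u. Q m u)" for m
  have Qu: "Q m (u m)" if "k0 \<le> m" for m
    unfolding u_def
  proof (rule someI_ex[where P = "Q m"])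
    show "\<exists>u. Q m u"
      unfolding Q_def by (rule chain[rule_format, folded T_def]) (use k0[OF that] T in auto)
  qed
  have u: "\<And>m j. k0 \<le> m \<Longrightarrow> j < (2::nat) ^ m \<Longrightarrow> norm (u m j) \<le> R"
    "\<And>m. k0 \<le> m \<Longrightarrow> norm ((T / 2 ^ m) *\<^sub>R (\<Sum>i<(2::nat) ^ m. u m i)) \<le> M"
    "\<And>m. k0 \<le> m \<Longrightarrow> W (\<tau>, x0 + (T / 2 ^ m) *\<^sub>R (\<Sum>i<(2::nat) ^ m. u m i)) +
          (\<Sum>j<(2::nat) ^ m. (T / 2 ^ m) * envelope (x0 + (T / 2 ^ m) *\<^sub>R (\<Sum>i<j. u m i)) (2 * (T / 2 ^ m) * (R + 1)) (u m j))
          \<le> W (t0, x0) + \<epsilon> * T"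
    using Qu unfolding Q_def by blast+
  define Y where "Y m = polygon (T / 2 ^ m) (2 ^ m) x0 (u m)" for m
  have Ylip: "R-lipschitz_on UNIV (Y m)" if "k0 \<le> m" for m
    unfolding Y_def using T R(1) u(1)[OF that] by (intro polygon_lipschitz) auto
  have Y0: "Y m 0 = x0" for m
    unfolding Y_def using polygon_node[of "T / 2 ^ m" 0 "2 ^ m" x0 "u m"] T by simp
  have YT: "Y m T = x0 + (T / 2 ^ m) *\<^sub>R (\<Sum>i<2 ^ m. u m i)" for m
    unfolding Y_def using polygon_node[of "T / 2 ^ m" "2 ^ m" "2 ^ m" x0 "u m"] T by simp
  obtain y0 k where y0: "strict_mono (k :: nat \<Rightarrow> nat)"
    "\<And>e. 0 < e \<Longrightarrow> \<exists>N. \<forall>n s. n \<ge> N \<and> s \<in> {0..T} \<longrightarrow> norm (Y (k n + k0) s - y0 s) < e"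
  \<comment> \<open>The shift by \<open>k0\<close> discards the levels whose mesh may exceed
    \<open>\<Delta>0\<close>, for which \<open>u m\<close> is an arbitrary choice.\<close>
  proof (rule Arzela_Ascoli[of "{0..T}" "\<lambda>n. Y (n + k0)" "norm x0 + R * T"])
    show "compact {0..T}" by simp
    show "norm (Y (n + k0) s) \<le> norm x0 + R * T" if s: "s \<in> {0..T}" for n s
    proof -
      have "norm (Y (n + k0) s - Y (n + k0) 0) \<le> R * s"
        using lipschitz_onD[OF Ylip, of "n + k0" s 0] s by (simp add: dist_norm)
      also have "\<dots> \<le> R * T" using s R(1) by (intro mult_left_mono) auto
      finally show ?thesis using norm_triangle_ineq2[of "Y (n + k0) s" x0] unfolding Y0 by linarith
    qed
    show "\<exists>d>0. \<forall>n s'. s' \<in> {0..T} \<and> norm (s - s') < d \<longrightarrow> norm (Y (n + k0) s - Y (n + k0) s') < e"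
      if "0 < e" for s e
    proof (intro exI conjI allI impI)
      show "0 < e / (R + 1)" using that R by simp
      fix n s' assume s': "s' \<in> {0..T} \<and> norm (s - s') < e / (R + 1)"
      have "norm (Y (n + k0) s - Y (n + k0) s') \<le> R * norm (s - s')"
        using lipschitz_onD[OF Ylip, of "n + k0" s s'] by (simp add: dist_norm)
      also have "\<dots> \<le> (R + 1) * norm (s - s')" by (intro mult_right_mono) auto
      also have "\<dots> < e" using s' R(1) by (simp add: pos_less_divide_eq mult.commute)
      finally show "norm (Y (n + k0) s - Y (n + k0) s') < e" .
    qed
  qed blast
  define K where "K n = k n + k0" for n
  have Yconv: "(\<lambda>n. Y (K n) s) \<longlonglongrightarrow> y0 s" if "s \<in> {0..T}" for s
  proof (rule LIMSEQ_I)
    fix e :: real assume "0 < e"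
    then show "\<exists>N. \<forall>n\<ge>N. norm (Y (K n) s - y0 s) < e"
      using y0(2)[of e] that unfolding K_def by blast
  qed
  have Kk: "k0 \<le> K n" for n by (simp add: K_def)
  have Kmono: "strict_mono K" using y0(1) by (simp add: K_def strict_mono_def)
  \<comment> \<open>The uniform limit is controlled on \<open>{0..T}\<close> only; clamping the time
    makes it Lipschitz on the whole line, as the dyadic quotients require.\<close>
  define y where "y s = y0 (max 0 (min s T))" for s
  have y_eq: "y s = y0 s" if "s \<in> {0..T}" for s using that by (simp add: y_def)
  have ylip: "R-lipschitz_on UNIV y"
  proof (rule lipschitz_onI)
    fix s s' :: real
    let ?c = "\<lambda>s. max 0 (min s T)"
    have c: "?c r \<in> {0..T}" for r using T by auto
    have "dist (y s) (y s') \<le> R * dist (?c s) (?c s')"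
    proof (rule tendsto_upperbound)
      show "(\<lambda>n. dist (Y (K n) (?c s)) (Y (K n) (?c s'))) \<longlonglongrightarrow> dist (y s) (y s')"
        unfolding y_def by (intro tendsto_intros Yconv c)
      show "\<forall>\<^sub>F n in sequentially. dist (Y (K n) (?c s)) (Y (K n) (?c s')) \<le> R * dist (?c s) (?c s')"
        using lipschitz_onD[OF Ylip[OF Kk]] by (intro always_eventually) auto
    qed auto
    also have "\<dots> \<le> R * dist s s'"
      using R(1) by (intro mult_left_mono) (auto simp: dist_real_def)
    finally show "dist (y s) (y s') \<le> R * dist s s'" .
  qed (rule R(1))
  have "y 0 = x0" using Yconv[of 0] T by (auto simp: Y0 y_eq LIMSEQ_const_iff)
  have YTc: "(\<lambda>n. Y (K n) T) \<longlonglongrightarrow> y T" using Yconv[of T] T by (simp add: y_eq)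
  define B where "B = W (t0, x0) + \<epsilon> * T - W (\<tau>, y T)"
  have sums: "(\<Sum>i<2 ^ n. (T / 2 ^ n) * envelope (y (real i * (T / 2 ^ n))) ((R + 1) * (T / 2 ^ n)) (dquot y T n i)) \<le> B" for n
  proof (rule LIMSEQ_le)
    let ?\<delta> = "T / 2 ^ n"
    let ?S = "\<lambda>Z. (\<Sum>i<2 ^ n. ?\<delta> * envelope (y (real i * ?\<delta>)) ((R + 1) * ?\<delta>) (dquot Z T n i))"
    have node: "real i * ?\<delta> \<in> {0..T}" if "i \<le> 2 ^ n" for i
    proof -
      have "real i * ?\<delta> \<le> real (2 ^ n) * ?\<delta>" by (rule mult_right_mono) (use that T in auto)
      then show ?thesis using T by simp
    qed
    show "(\<lambda>m. ?S (Y (K m))) \<longlonglongrightarrow> ?S y"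
    proof (intro tendsto_sum tendsto_mult tendsto_const)
      fix i :: nat assume "i \<in> {..<2 ^ n}"
      then have i: "Suc i \<le> 2 ^ n" "i \<le> 2 ^ n" by auto
      have q: "(\<lambda>m. dquot (Y (K m)) T n i) \<longlonglongrightarrow> dquot y T n i"
        unfolding dquot_def[OF ylip T] dquot_def[OF Ylip[OF Kk] T]
        using Yconv[OF node[OF i(1)]] Yconv[OF node[OF i(2)]] y_eq[OF node[OF i(1)]] y_eq[OF node[OF i(2)]]
        by (intro tendsto_intros) auto
      have c: "continuous_on UNIV (envelope (y (real i * ?\<delta>)) ((R + 1) * ?\<delta>))"
        using R T by (intro convex_on_continuous envelope_convex) auto
      show "(\<lambda>m. envelope (y (real i * ?\<delta>)) ((R + 1) * ?\<delta>) (dquot (Y (K m)) T n i))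
          \<longlonglongrightarrow> envelope (y (real i * ?\<delta>)) ((R + 1) * ?\<delta>) (dquot y T n i)"
        by (rule continuous_on_tendsto_compose[OF c q]) auto
    qed
    have "isCont W (\<tau>, y T)"
      using \<tau> by (intro locally_Lipschitz_on_isCont[OF lip open_pos_times]) (simp add: pos_times_def)
    then have "(\<lambda>m. W (\<tau>, Y (K m) T)) \<longlonglongrightarrow> W (\<tau>, y T)"
      by (rule isCont_tendsto_compose) (intro tendsto_intros YTc)
    then show "(\<lambda>m. W (t0, x0) + \<epsilon> * T - W (\<tau>, Y (K m) T)) \<longlonglongrightarrow> B"
      unfolding B_def by (intro tendsto_intros)
    have "(\<lambda>m. 2 * (T / 2 ^ K m) * (R + 1)) \<longlonglongrightarrow> 2 * 0 * (R + 1)"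
      using LIMSEQ_subseq_LIMSEQ[OF dyadic_mesh_tendsto_0 Kmono] by (intro tendsto_intros) (simp add: o_def)
    \<comment> \<open>Half of the coarse mesh is reserved for the envelope radius and half for the
      uniform distance, as \<open>envelope_sum_coarsen\<close> requires.\<close>
    moreover have "0 < ?\<delta> / 2" using T by simp
    ultimately have "\<forall>\<^sub>F m in sequentially. 2 * (T / 2 ^ K m) * (R + 1) < ?\<delta> / 2"
      by (intro order_tendstoD(2)) auto
    moreover have "\<forall>\<^sub>F m in sequentially. \<forall>s\<in>{0..T}. norm (Y (K m) s - y0 s) < ?\<delta> / 2"
      using y0(2)[OF \<open>0 < ?\<delta> / 2\<close>] unfolding K_def eventually_sequentially by blast
    moreover have "\<forall>\<^sub>F m in sequentially. n \<le> K m"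
      using seq_suble[OF Kmono] unfolding eventually_sequentially by (meson order_trans)
    ultimately have "\<forall>\<^sub>F m in sequentially. ?S (Y (K m)) \<le> W (t0, x0) + \<epsilon> * T - W (\<tau>, Y (K m) T)"
    proof eventually_elim
      case (elim m)
      have "?S (Y (K m)) \<le> (\<Sum>j<2 ^ K m. (T / 2 ^ K m) *
          envelope (x0 + (T / 2 ^ K m) *\<^sub>R (\<Sum>i<j. u (K m) i)) (2 * (T / 2 ^ K m) * (R + 1)) (u (K m) j))"
      proof (rule envelope_sum_coarsen[OF elim(3) T R(1) _ u(1)[OF Kk] Y_def])
        show "0 \<le> 2 * (T / 2 ^ K m) * (R + 1)" using T R by simp
        fix i :: nat assume "i < 2 ^ n"
        then have "real i * ?\<delta> \<in> {0..T}" by (intro node) simp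
        with elim show "norm (Y (K m) (real i * ?\<delta>) - y (real i * ?\<delta>)) + 2 * (T / 2 ^ K m) * (R + 1) \<le> ?\<delta>"
          by (fastforce simp: y_eq)
      qed
      then show ?case using u(3)[OF Kk[of m]] unfolding YT by linarith
    qed
    then show "\<exists>N. \<forall>m\<ge>N. ?S (Y (K m)) \<le> W (t0, x0) + \<epsilon> * T - W (\<tau>, Y (K m) T)"
      unfolding eventually_sequentially .
  qed
  have "0 \<le> (\<Sum>i<2 ^ 0. (T / 2 ^ 0) * envelope (y (real i * (T / 2 ^ 0))) ((R + 1) * (T / 2 ^ 0)) (dquot y T 0 i))"
    using T R by (intro sum_nonneg mult_nonneg_nonneg envelope_nonneg) auto
  with sums[of 0] have B0: "0 \<le> B" by linarith
  show thesis
  proof (rule that[of "y T"])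
    show "norm (y T - x0) \<le> W (t0, x0) + (1 + C1) * t0"
    proof (rule tendsto_upperbound)
      show "(\<lambda>n. norm (Y (K n) T - x0)) \<longlonglongrightarrow> norm (y T - x0)" by (intro tendsto_intros YTc)
      show "\<forall>\<^sub>F n in sequentially. norm (Y (K n) T - x0) \<le> W (t0, x0) + (1 + C1) * t0"
        using u(2)[OF Kk] unfolding YT M_def by (intro always_eventually) simp
    qed auto
    have W0: "0 \<le> W (\<tau>, y T)" using \<tau> by (intro nonneg) (simp add: pos_times_def)
    have "trans_cost L T x0 (y T) \<le> ennreal B"
      using cost_le_of_dyadic_sums[OF ylip T sums] \<open>y 0 = x0\<close> by simp
    then have "trans_cost L T x0 (y T) + ennreal (W (\<tau>, y T)) \<le> ennreal B + ennreal (W (\<tau>, y T))"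
      by (rule add_right_mono)
    also have "\<dots> = ennreal (W (t0, x0) + \<epsilon> * T)"
      using B0 W0 by (subst ennreal_plus[symmetric]) (auto simp: B_def)
    finally show "trans_cost L (t0 - \<tau>) x0 (y T) + ennreal (W (\<tau>, y T)) \<le> ennreal (W (t0, x0) + \<epsilon> * (t0 - \<tau>))"
      by (simp add: T_def)
  qed
qed

end

context bolza_problem
begin

text \<open>Curves stopped at the remaining time \<open>\<tau> n\<close> end at points
  \<open>Z n\<close> of a fixed ball. At a limit point \<open>z\<close>, condition (c) bounds
  \<open>\<phi> z\<close> by the lower limit of \<open>W\<close>, so \<open>\<phi> z\<close> is
  finite and ending in \<open>z\<close> is affordable.\<close>

lemma value_fun_le_supersolution:
  assumes super: "HJ_super L W" and adm: "admissible \<phi> W" and "0 < t"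
  shows "value_fun L \<phi> t x \<le> ennreal (W (t, x))"
proof -
  have lip: "locally_Lipschitz_on pos_times W" and nonneg: "\<And>z. z \<in> pos_times \<Longrightarrow> 0 \<le> W z"
    and init: "Liminf (at_right 0 \<times>\<^sub>F nhds z) (\<lambda>p. ennreal (W p)) = \<phi> z" for z
    using adm by (auto simp: admissible_def initial_liminf_def)
  obtain C1 where C1: "0 \<le> C1" "\<And>x u. norm u - C1 \<le> L x u" using L_growthE[of 1] by auto
  define M where "M = W (t, x) + (1 + C1) * t"
  have W0: "0 \<le> W (t, x)" using \<open>0 < t\<close> by (intro nonneg) (simp add: pos_times_def)
  have "value_real L \<phi> (t, x) \<le> W (t, x)"
  proof (rule field_le_epsilon)
    fix e :: real assume "0 < e"
    define \<epsilon> where "\<epsilon> = min 1 (e / (2 * t))"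
    have \<epsilon>: "0 < \<epsilon>" "\<epsilon> \<le> 1" using \<open>0 < e\<close> \<open>0 < t\<close> by (auto simp: \<epsilon>_def)
    have \<epsilon>t: "\<epsilon> * t \<le> e / 2"
    proof -
      have "\<epsilon> * t \<le> (e / (2 * t)) * t" using \<open>0 < t\<close> by (intro mult_right_mono) (auto simp: \<epsilon>_def)
      then show ?thesis using \<open>0 < t\<close> by simp
    qed
    define A where "A = W (t, x) + e / 2"
    have A0: "0 \<le> A" using W0 \<open>0 < e\<close> by (simp add: A_def)
    define \<tau> where "\<tau> n = t / real (Suc (Suc n))" for n
    have \<tau>: "0 < \<tau> n" "\<tau> n < t" for n using \<open>0 < t\<close> by (auto simp: \<tau>_def divide_simps)
    have \<tau>0: "\<tau> \<longlonglongrightarrow> 0" unfolding \<tau>_def by (intro LIMSEQ_Suc lim_const_over_n)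
    have "\<exists>z. norm (z - x) \<le> M \<and> trans_cost L (t - \<tau> n) x z + ennreal (W (\<tau> n, z)) \<le> ennreal A" for n
    proof -
      obtain z where z: "norm (z - x) \<le> W (t, x) + (1 + C1) * t"
        "trans_cost L (t - \<tau> n) x z + ennreal (W (\<tau> n, z)) \<le> ennreal (W (t, x) + \<epsilon> * (t - \<tau> n))"
        by (rule supersolution_curve[OF super lip nonneg C1 \<tau>[of n] \<epsilon>, where ?x0.0 = x])
      have "\<epsilon> * (t - \<tau> n) \<le> \<epsilon> * t" using \<tau>[of n] \<epsilon> by (intro mult_left_mono) auto
      then have "ennreal (W (t, x) + \<epsilon> * (t - \<tau> n)) \<le> ennreal A"
        unfolding A_def using \<epsilon>t by (intro ennreal_leI) linarith
      with z show ?thesis unfolding M_def by (meson order_trans)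
    qed
    then obtain Z where Z: "\<And>n. norm (Z n - x) \<le> M"
      "\<And>n. trans_cost L (t - \<tau> n) x (Z n) + ennreal (W (\<tau> n, Z n)) \<le> ennreal A" by metis
    have "Z n \<in> cball x M" for n using Z(1)[of n] by (simp add: dist_norm norm_minus_commute)
    then obtain z r where zM: "z \<in> cball x M" and r: "strict_mono (r :: nat \<Rightarrow> nat)" and "(Z \<circ> r) \<longlonglongrightarrow> z"
      using compact_cball[of x M] unfolding compact_def by metis
    then have Zr: "(\<lambda>n. Z (r n)) \<longlonglongrightarrow> z" by (simp add: o_def)
    have \<tau>r: "(\<lambda>n. \<tau> (r n)) \<longlonglongrightarrow> 0" using LIMSEQ_subseq_LIMSEQ[OF \<tau>0 r] by (simp add: o_def)
    have flt: "filterlim (\<lambda>n. (\<tau> (r n), Z (r n))) (at_right 0 \<times>\<^sub>F nhds z) sequentially"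
      by (intro filterlim_Pair tendsto_imp_filterlim_at_right \<tau>r Zr) (use \<tau> in auto)
    have low: "\<forall>\<^sub>F n in sequentially. c < ennreal (W (\<tau> (r n), Z (r n)))" if "c < \<phi> z" for c
    proof -
      have "\<forall>\<^sub>F p in at_right 0 \<times>\<^sub>F nhds z. c < ennreal (W p)"
        using that unfolding init[of z, symmetric] by (rule less_LiminfD)
      from eventually_compose_filterlim[OF this flt] show ?thesis .
    qed
    have WA: "ennreal (W (\<tau> n, Z n)) \<le> ennreal A" for n
      using Z(2)[of n] by (metis add_increasing order_trans zero_le order_refl)
    have "\<phi> z \<le> ennreal A"
    proof (rule dense_le)
      fix c assume "c < \<phi> z"
      from low[OF this] obtain n where "c < ennreal (W (\<tau> (r n), Z (r n)))"
        using eventually_happens'[OF sequentially_bot] by blast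
      then show "c \<le> ennreal A" using WA[of "r n"] by (meson less_imp_le order_trans)
    qed
    then obtain f where f: "\<phi> z = ennreal f" "0 \<le> f" by (cases "\<phi> z") (auto simp: top_unique)
    have ev: "\<forall>\<^sub>F n in sequentially. f \<le> W (\<tau> (r n), Z (r n)) + e / 2"
    proof (cases "f \<le> e / 2")
      case True
      then show ?thesis using \<tau> by (intro always_eventually allI) (smt (verit) nonneg pos_times_def greaterThan_iff mem_Sigma_iff UNIV_I)
    next
      case False
      then have "ennreal (f - e / 2) < \<phi> z" unfolding f using \<open>0 < e\<close> by (intro ennreal_lessI) auto
      from low[OF this] show ?thesis
      proof eventually_elim
        case (elim n)
        then have "f - e / 2 < W (\<tau> (r n), Z (r n))" using False by (simp add: ennreal_less_iff)
        then show ?case by simp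
      qed
    qed
    define R where "R = norm x + \<bar>M\<bar> + 1"
    obtain C where C: "0 \<le> C" "\<And>x u. norm x \<le> R \<Longrightarrow> norm u \<le> R \<Longrightarrow> L x u \<le> C" using L_boundedE[of R] by metis
    \<comment> \<open>The distance to \<open>z\<close> may be large compared with
      \<open>\<tau> n\<close>, so the closing segment takes the time \<open>h n\<close>, which keeps
      its speed at most 1. The total time becomes \<open>t + \<eta> n\<close>, and continuity of the
      value function removes the delay.\<close>
    define h where "h n = norm (z - Z (r n)) + \<tau> (r n)" for n
    define \<eta> where "\<eta> n = norm (z - Z (r n))" for n
    have zR: "norm v \<le> R" if "norm (v - x) \<le> M" for v
      using that norm_triangle_ineq2[of v x] by (simp add: R_def)
    have "\<forall>\<^sub>F n in sequentially. value_real L \<phi> (t + \<eta> n, x) \<le> A + e / 2 + C * h n"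
      using ev
    proof eventually_elim
      case (elim n)
      have h0: "0 \<le> h n" unfolding h_def using \<tau>[of "r n"] by (intro add_nonneg_nonneg) auto
      have tp: "0 < t + \<eta> n" unfolding \<eta>_def using \<open>0 < t\<close> by (intro add_pos_nonneg) auto
      have Wn: "0 \<le> W (\<tau> (r n), Z (r n))" using \<tau> by (intro nonneg) (simp add: pos_times_def)
      have tc: "trans_cost L (h n) (Z (r n)) z \<le> ennreal (C * h n)"
      proof (rule trans_cost_line[of R C])
        have "norm (z - Z (r n)) \<le> 1 * h n" using \<tau>[of "r n"] by (simp add: h_def)
        also have "\<dots> \<le> R * h n" using h0 by (intro mult_right_mono) (auto simp: R_def)
        finally show "norm (z - Z (r n)) \<le> R * h n" .
      qed (use C h0 zR Z(1) zM in \<open>auto simp: dist_norm norm_minus_commute\<close>)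
      have "value_fun L \<phi> (t + \<eta> n) x = value_fun L \<phi> ((t - \<tau> (r n)) + h n) x" by (simp add: h_def \<eta>_def)
      also have "\<dots> \<le> trans_cost L ((t - \<tau> (r n)) + h n) x z + \<phi> z" by (rule value_fun_le_trans_cost)
      also have "\<dots> \<le> (trans_cost L (t - \<tau> (r n)) x (Z (r n)) + trans_cost L (h n) (Z (r n)) z) + \<phi> z"
        using \<tau>[of "r n"] h0 by (intro add_right_mono trans_cost_triangle) auto
      also have "\<dots> \<le> (trans_cost L (t - \<tau> (r n)) x (Z (r n)) + ennreal (C * h n)) + ennreal (W (\<tau> (r n), Z (r n)) + e / 2)"
        unfolding f using tc elim by (intro add_mono ennreal_leI order_refl)
      also have "ennreal (W (\<tau> (r n), Z (r n)) + e / 2) = ennreal (W (\<tau> (r n), Z (r n))) + ennreal (e / 2)"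
        using Wn \<open>0 < e\<close> by (intro ennreal_plus) auto
      also have "(trans_cost L (t - \<tau> (r n)) x (Z (r n)) + ennreal (C * h n)) + (ennreal (W (\<tau> (r n), Z (r n))) + ennreal (e / 2))
          = (trans_cost L (t - \<tau> (r n)) x (Z (r n)) + ennreal (W (\<tau> (r n), Z (r n)))) + (ennreal (e / 2) + ennreal (C * h n))"
        by (simp add: algebra_simps)
      also have "\<dots> \<le> ennreal A + (ennreal (e / 2) + ennreal (C * h n))" using Z(2) by (intro add_right_mono)
      also have "\<dots> = ennreal (A + e / 2 + C * h n)"
        using A0 C(1) h0 \<open>0 < e\<close> by (simp add: ennreal_plus[symmetric] add.assoc del: ennreal_plus)
      finally show ?case
        using A0 C(1) h0 \<open>0 < e\<close> by (simp add: value_fun_eq_ennreal[OF tp] del: ennreal_plus)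
    qed
    moreover have "(\<lambda>n. value_real L \<phi> (t + \<eta> n, x)) \<longlonglongrightarrow> value_real L \<phi> (t, x)"
    proof (rule isCont_tendsto_compose[where g = "value_real L \<phi>"])
      show "isCont (value_real L \<phi>) (t, x)"
        using \<open>0 < t\<close> by (intro locally_Lipschitz_on_isCont[OF value_real_locally_Lipschitz open_pos_times]) (simp add: pos_times_def)
      have "(\<lambda>n. (t + norm (z - Z (r n)), x)) \<longlonglongrightarrow> (t + norm (z - z), x)" by (intro tendsto_intros Zr)
      then show "(\<lambda>n. (t + \<eta> n, x)) \<longlonglongrightarrow> (t, x)" by (simp add: \<eta>_def)
    qed
    moreover have "(\<lambda>n. A + e / 2 + C * h n) \<longlonglongrightarrow> A + e / 2 + C * (norm (z - z) + 0)"
      unfolding h_def by (intro tendsto_intros Zr \<tau>r)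
    ultimately have "value_real L \<phi> (t, x) \<le> A + e / 2 + C * (norm (z - z) + 0)"
      by (intro tendsto_le[of sequentially]) auto
    then show "value_real L \<phi> (t, x) \<le> W (t, x) + e" by (simp add: A_def)
  qed
  then show ?thesis using \<open>0 < t\<close> by (simp add: value_fun_eq_ennreal ennreal_leI)
qed

end

section \<open>The comparison theorem\<close>

lemma locally_bounded_on_compact:
  fixes f :: "'a::metric_space \<Rightarrow> 'b::metric_space"
  assumes "locally_bounded f" "compact K"
  shows "bounded (f ` K)"
proof -
  obtain r where r: "\<And>z. 0 < r z" "\<And>z. bounded (f ` ball z (r z))"
    using assms(1) unfolding locally_bounded_def by metis
  obtain D where D: "D \<subseteq> K" "finite D" "K \<subseteq> (\<Union>z\<in>D. ball z (r z))"
    by (rule compactE_image[OF \<open>compact K\<close>, of K "\<lambda>z. ball z (r z)"]) (use r(1) in force)+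
  have "bounded (\<Union>z\<in>D. f ` ball z (r z))" using D(2) r(2) by (intro bounded_UN) auto
  then show ?thesis by (rule bounded_subset) (use D(3) in blast)
qed

lemma superlinear_lower_bound:
  fixes \<Theta> :: "'a::euclidean_space \<Rightarrow> real"
  assumes "\<And>u. 0 \<le> \<Theta> u" "filterlim (\<lambda>u. \<Theta> u / norm u) at_top at_infinity"
  shows "\<exists>C. \<forall>u. K * norm u - C \<le> \<Theta> u"
proof -
  have "\<forall>\<^sub>F u in at_infinity. K \<le> \<Theta> u / norm u" using assms(2) unfolding filterlim_at_top by blast
  then obtain b where b: "\<And>u. b \<le> norm u \<Longrightarrow> K \<le> \<Theta> u / norm u" unfolding eventually_at_infinity by blast
  \<comment> \<open>\<open>max b 1\<close> instead of \<open>b\<close> keeps \<open>norm u\<close>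
    positive, so that the quotient can be cleared.\<close>
  have "K * norm u - \<bar>K\<bar> * max b 1 \<le> \<Theta> u" for u
  proof (cases "max b 1 \<le> norm u")
    case True
    then have "0 < norm u" "b \<le> norm u" by linarith+
    then have "K * norm u \<le> \<Theta> u" using b[of u] by (simp only: pos_le_divide_eq)
    moreover have "0 \<le> \<bar>K\<bar> * max b 1" by (intro mult_nonneg_nonneg) auto
    ultimately show ?thesis by linarith
  next
    case False
    have "K * norm u \<le> \<bar>K\<bar> * norm u" by (intro mult_right_mono) auto
    also have "\<dots> \<le> \<bar>K\<bar> * max b 1" using False by (intro mult_left_mono) auto
    finally show ?thesis using assms(1)[of u] by linarith
  qed
  then show ?thesis by blast
qed

theorem theorem5p5:
  fixes L :: "real ^ 'n \<Rightarrow> real ^ 'n \<Rightarrow> real"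
    and \<phi> :: "real ^ 'n \<Rightarrow> ennreal"
    and \<Theta> :: "real ^ 'n \<Rightarrow> real"
  assumes L_nonneg: "\<And>x u. 0 \<le> L x u"
    and L_lsc: "lsc (\<lambda>(x, u). L x u)"
    and L_convex: "\<And>x. convex_on UNIV (L x)"
    and \<Theta>_nonneg: "\<And>u. 0 \<le> \<Theta> u"
    and \<Theta>_convex: "convex_on UNIV \<Theta>"
    and \<Theta>_superlinear: "filterlim (\<lambda>u. \<Theta> u / norm u) at_top at_infinity"
    and L_ge_\<Theta>: "\<And>x u. \<Theta> u \<le> L x u"
    and \<phi>_lsc: "lsc \<phi>"
    and \<phi>_proper: "\<exists>x. \<phi> x \<noteq> \<infinity>"
    and L_locally_bounded: "locally_bounded (\<lambda>(x, u). L x u)"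
  shows
    "((\<forall>t>0. \<forall>x. value_fun L \<phi> t x < \<infinity>) \<and>
      locally_Lipschitz_on pos_times (value_real L \<phi>) \<and>
      HJ_super L (value_real L \<phi>) \<and>
      HJ_sub L (value_real L \<phi>))
     \<and>
     (\<forall>W. admissible \<phi> W \<longrightarrow>
        (HJ_super L W \<longrightarrow> (\<forall>t>0. \<forall>x. value_fun L \<phi> t x \<le> ennreal (W (t, x)))) \<and>
        (HJ_sub L W \<longrightarrow> (\<forall>t>0. \<forall>x. ennreal (W (t, x)) \<le> value_fun L \<phi> t x)))
     \<and>
     (admissible \<phi> (value_real L \<phi>) \<and>
      HJ_super L (value_real L \<phi>) \<and>
      HJ_sub L (value_real L \<phi>) \<and>
      (\<forall>W. admissible \<phi> W \<and> HJ_super L W \<and> HJ_sub L W \<longrightarrow>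
         (\<forall>z\<in>pos_times. W z = value_real L \<phi> z)))"
proof -
  interpret bolza_problem L \<phi>
  proof
    show "0 \<le> L x u" for x u by (rule L_nonneg)
    show "lsc (\<lambda>(x, u). L x u)" by (rule L_lsc)
    show "convex_on UNIV (L x)" for x by (rule L_convex)
    show "\<exists>C. \<forall>x u. K * norm u - C \<le> L x u" for K
      using superlinear_lower_bound[OF \<Theta>_nonneg \<Theta>_superlinear, of K] L_ge_\<Theta> by (meson order_trans)
    show "\<exists>C. \<forall>x u. norm x \<le> R \<longrightarrow> norm u \<le> R \<longrightarrow> L x u \<le> C" for R
    proof -
      have "bounded ((\<lambda>(x, u). L x u) ` (cball 0 R \<times> cball 0 R))"
        by (intro locally_bounded_on_compact L_locally_bounded compact_Times compact_cball)
      then obtain C where "\<And>x u. norm x \<le> R \<Longrightarrow> norm u \<le> R \<Longrightarrow> \<bar>L x u\<bar> \<le> C"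
        unfolding bounded_iff by fastforce
      then show ?thesis by (meson abs_le_D1)
    qed
    show "lsc \<phi>" by (rule \<phi>_lsc)
    show "\<exists>x. \<phi> x \<noteq> \<infinity>" by (rule \<phi>_proper)
  qed
  have uniq: "W z = value_real L \<phi> z"
    if W: "admissible \<phi> W" "HJ_super L W" "HJ_sub L W" and z: "z \<in> pos_times" for W z
  proof -
    obtain t x where tx: "z = (t, x)" "0 < t" using z by (auto simp: pos_times_def)
    \<comment> \<open>The comparisons meet in \<open>ennreal\<close>; both functions are
      non-negative, so the equality descends to the reals.\<close>
    have "ennreal (value_real L \<phi> (t, x)) = ennreal (W (t, x))"
      using value_fun_le_supersolution[OF W(2,1) tx(2), of x] subsolution_le_value_fun[OF W(3,1) tx(2), of x]
      by (simp add: value_fun_eq_ennreal[OF tx(2)])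
    moreover have "0 \<le> W (t, x)" using W(1) z tx by (auto simp: admissible_def)
    ultimately show ?thesis using tx by (simp add: value_real_nonneg)
  qed
  show ?thesis
    using value_fun_finite value_real_locally_Lipschitz value_HJ_super value_HJ_sub value_admissible
      value_fun_le_supersolution subsolution_le_value_fun uniq by blast
qed

end
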